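(* Suppose that for all $i,j\in\{1,\dots,d\}$ with $i\ne j$ we have $u_i+u_j<1$ and $v_i+v_j<1$. Let $s\in(0,2)$ and, for $\mathbf t\in\mathbb R^{2d}$, let $\mu$ be the K\"aenm\"aki measure (for parameter $s$) on the self-affine set $F$ generated by the maps $S_i(x)=A_ix+t_i$. Then for Lebesgue almost all $\mathbf t=(t_1,\dots,t_d)\in\mathbb R^{2d}$ for which the strong separation property holds (i.e. $S_i(F)\cap S_j(F)=\emptyset$ for all $i\neq j$), we have $$\dim\mu=\begin{cases}\dfrac{h(\mu)}{\chi_1(\mu)}&\text{if }h(\mu)\le\chi_1(\mu),\\[2mm]1+\dfrac{h(\mu)-\chi_1(\mu)}{\chi_2(\mu)}&\text{if }h(\mu)>\chi_1(\mu).\end{cases}$$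
   Context: **Iterated function system.** Let $\mathcal I=\{1,\dots,d\}$, let $1<l\le d$, and let $a_i,b_i\in(0,1)$ for $i\in\mathcal I$. Put $A_i=\begin{bmatrix} a_i & 0 \\ 0 & b_i \end{bmatrix}$ for $i<l$ and $A_i=\begin{bmatrix} 0 & a_i \\ b_i & 0 \end{bmatrix}$ for $i\ge l$. Assume $a_i\ne b_i$ for some $1\le i\le l-1$. The matrices are fixed. For $\mathbf t=(t_1,\dots,t_d)$ with $t_i\in\mathbb R^2$, put $S_i(x)=A_ix+t_i$; $F$ is the unique non-empty compact set with $F=\bigcup_{i\in\mathcal I}S_i(F)$. **The numbers $u_i$, $v_i$.** $u_i=a_i$ and $v_i=b_i$ for $1\le i\le l-1$; $u_i=a_i\max\{b_j:l\le j\le d\}$ and $v_i=b_i\max\{a_j:l\le j\le d\}$ for $l\le i\le d$. **Symbolic notation.** $\mathcal I^*=\bigcup_{k\ge1}\mathcal I^k$; $\Sigma=\mathcal I^{\mathbb N}$ with the product topology and left shift $\sigma$. For $\mathbf i=(i_1,i_2,\dots)\in\Sigma$, $\mathbf i|_k=(i_1,\dots,i_k)$. For a finite word $\mathbf i=(i_1,\dots,i_k)$, $|\mathbf i|=k$, $S_{\mathbf i}=S_{i_1}\circ\cdots\circ S_{i_k}$, $[\mathbf i]$ is the cylinder of sequences beginning with $\mathbf i$, and $\alpha_1(\mathbf i)\ge\alpha_2(\mathbf i)>0$ are the singular values of $A_{i_1}\cdots A_{i_k}$. The coding map $\Pi:\Sigma\to\mathbb R^2$ is $\Pi(\mathbf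 i)=\lim_{k\to\infty}S_{\mathbf i|_k}(0)$ (when every $S_i$ maps $[0,1]^2$ into itself this is the unique point of $\bigcap_kS_{\mathbf i|_k}([0,1]^2)$). **K\"aenm\"aki measure.** For $s\in(0,2]$ let $\phi^s(\mathbf i)=\alpha_1(\mathbf i)^s$ if $s<1$ and $\phi^s(\mathbf i)=\alpha_1(\mathbf i)\alpha_2(\mathbf i)^{s-1}$ if $s\in[1,2]$, and $P(s)=\lim_{n\to\infty}\frac1n\log\sum_{\mathbf i\in\mathcal I^n}\phi^s(\mathbf i)$. For $s\in(0,2)$, $m=m^s$ denotes the (unique) $\sigma$-invariant ergodic Borel probability measure on $\Sigma$ for which there is $C_0\ge1$ with $C_0^{-1}e^{-P(s)|\mathbf i|}\phi^s(\mathbf i)\le m([\mathbf i])\le C_0e^{-P(s)|\mathbf i|}\phi^s(\mathbf i)$ for all $\mathbf i\in\mathcal I^*$; the K\"aenm\"aki measure on $F$ is $\mu=m\circ\Pi^{-1}$. **Exponents, entropy, dimension.** $\chi_1(\mu)\le\chi_2(\mu)$ are the constants with $\chi_r(\mu)=-\lim_n\frac1n\log\alpha_r(\mathbf i|_n)$ for $m$-a.e. $\mathbf i$ ($r=1,2$), and $h(\mu)=-\lim_n\frac1n\log m([\mathbf i|_n])$ for $m$-a.e. $\mathbf i$. (These depend only on the matrices and $s$, not on $\mathbf t$.) A Borel probability measure $\lambda$ is exact dimensional with exact dimension $\dim\lambda=\alpha$ if $\lim_{r\to0}\frac{\log\lambda(B(x,r))}{\log r}=\alpha$ for $\lambda$-a.e.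 $x$; under strong separation $\mu$ is known to be exact dimensional, and $\dim\mu$ is its exact dimension. *)

theory Defs
  imports "HOL-Probability.Probability"
begin

text \<open>The symbols are \<open>1, \<dots>, d\<close>.  Families indexed by the symbols (matrices,
  translations, weights) are functions on \<^typ>\<open>nat\<close> that are only evaluated on \<open>{1..d}\<close>.\<close>

definition ifs_matrix :: "nat \<Rightarrow> (nat \<Rightarrow> real) \<Rightarrow> (nat \<Rightarrow> real) \<Rightarrow> nat \<Rightarrow> real^2^2" where
  "ifs_matrix l a b i =
     (if i < l then vector [vector [a i, 0], vector [0, b i]]
      else vector [vector [0, a i], vector [b i, 0]])"

definition u_num :: "nat \<Rightarrow> nat \<Rightarrow> (nat \<Rightarrow> real) \<Rightarrow> (nat \<Rightarrow> real) \<Rightarrow> nat \<Rightarrow> real" where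
  "u_num d l a b i = (if i < l then a i else a i * Max (b ` {l..d}))"

definition v_num :: "nat \<Rightarrow> nat \<Rightarrow> (nat \<Rightarrow> real) \<Rightarrow> (nat \<Rightarrow> real) \<Rightarrow> nat \<Rightarrow> real" where
  "v_num d l a b i = (if i < l then b i else b i * Max (a ` {l..d}))"


section \<open>The iterated function system\<close>

definition ifs_map :: "(nat \<Rightarrow> real^2^2) \<Rightarrow> (nat \<Rightarrow> real^2) \<Rightarrow> nat \<Rightarrow> real^2 \<Rightarrow> real^2" where
  "ifs_map A t i x = A i *v x + t i"

definition word_map :: "(nat \<Rightarrow> real^2^2) \<Rightarrow> (nat \<Rightarrow> real^2) \<Rightarrow> nat list \<Rightarrow> real^2 \<Rightarrow> real^2" where
  "word_map A t w = foldr (\<lambda>i f. ifs_map A t i \<circ> f) w id"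

definition attractor :: "nat \<Rightarrow> (nat \<Rightarrow> real^2^2) \<Rightarrow> (nat \<Rightarrow> real^2) \<Rightarrow> (real^2) set" where
  "attractor d A t =
     (THE F. F \<noteq> {} \<and> compact F \<and> F = (\<Union>i\<in>{1..d}. ifs_map A t i ` F))"

definition strong_separation :: "nat \<Rightarrow> (nat \<Rightarrow> real^2^2) \<Rightarrow> (nat \<Rightarrow> real^2) \<Rightarrow> bool" where
  "strong_separation d A t \<longleftrightarrow>
     (\<forall>i\<in>{1..d}. \<forall>j\<in>{1..d}. i \<noteq> j \<longrightarrow>
        ifs_map A t i ` attractor d A t \<inter> ifs_map A t j ` attractor d A t = {})"


section \<open>Symbolic space\<close>

text \<open>Sequences are indexed from \<open>0\<close>, so the first symbol of \<open>\<omega>\<close> is \<open>\<omega> 0\<close>.  The topology on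
  \<^typ>\<open>nat \<Rightarrow> nat\<close> is the product of discrete topologies, and \<open>symbol_space d\<close> carries the Borel
  sets of its subspace topology.\<close>

definition symbol_seqs :: "nat \<Rightarrow> (nat \<Rightarrow> nat) set" where
  "symbol_seqs d = {\<omega>. range \<omega> \<subseteq> {1..d}}"

definition symbol_space :: "nat \<Rightarrow> (nat \<Rightarrow> nat) measure" where
  "symbol_space d = restrict_space borel (symbol_seqs d)"

definition left_shift :: "(nat \<Rightarrow> nat) \<Rightarrow> nat \<Rightarrow> nat" where
  "left_shift \<omega> = (\<lambda>n. \<omega> (Suc n))"

definition initial_word :: "(nat \<Rightarrow> nat) \<Rightarrow> nat \<Rightarrow> nat list" where
  "initial_word \<omega> k = map \<omega> [0..<k]"

definition words :: "nat \<Rightarrow> nat \<Rightarrow> nat list set" where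
  "words d n = {w. length w = n \<and> set w \<subseteq> {1..d}}"

definition cylinder :: "nat \<Rightarrow> nat list \<Rightarrow> (nat \<Rightarrow> nat) set" where
  "cylinder d w = {\<omega> \<in> symbol_seqs d. initial_word \<omega> (length w) = w}"

definition coding_map :: "(nat \<Rightarrow> real^2^2) \<Rightarrow> (nat \<Rightarrow> real^2) \<Rightarrow> (nat \<Rightarrow> nat) \<Rightarrow> real^2" where
  "coding_map A t \<omega> = lim (\<lambda>k. word_map A t (initial_word \<omega> k) 0)"


section \<open>Singular values, singular value function and pressure\<close>

definition singular_values :: "real^2^2 \<Rightarrow> real set" where
  "singular_values M = {sqrt e |e. \<exists>v. v \<noteq> 0 \<and> (transpose M ** M) *v v = e *\<^sub>R v}"

definition word_matrix :: "(nat \<Rightarrow> real^2^2) \<Rightarrow> nat list \<Rightarrow> real^2^2" where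
  "word_matrix A w = foldr (\<lambda>i M. A i ** M) w (mat 1)"

text \<open>In dimension two the largest and the smallest element of the set of singular values are the
  two singular values listed with multiplicity, also when the set is a singleton.\<close>

definition alpha1 :: "(nat \<Rightarrow> real^2^2) \<Rightarrow> nat list \<Rightarrow> real" where
  "alpha1 A w = Max (singular_values (word_matrix A w))"

definition alpha2 :: "(nat \<Rightarrow> real^2^2) \<Rightarrow> nat list \<Rightarrow> real" where
  "alpha2 A w = Min (singular_values (word_matrix A w))"

text \<open>Used for \<open>0 < s \<le> 2\<close> only.\<close>

definition sv_fun :: "(nat \<Rightarrow> real^2^2) \<Rightarrow> real \<Rightarrow> nat list \<Rightarrow> real" where
  "sv_fun A s w =
     (if s < 1 then alpha1 A w powr s else alpha1 A w * alpha2 A w powr (s - 1))"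

definition pressure :: "nat \<Rightarrow> (nat \<Rightarrow> real^2^2) \<Rightarrow> real \<Rightarrow> real" where
  "pressure d A s = lim (\<lambda>n. 1 / real n * ln (\<Sum>w\<in>words d n. sv_fun A s w))"


section \<open>Kaenmaki measure, exponents, entropy and dimension\<close>

definition shift_invariant :: "(nat \<Rightarrow> nat) measure \<Rightarrow> bool" where
  "shift_invariant m \<longleftrightarrow>
     (\<forall>B\<in>sets m. measure m (left_shift -` B \<inter> space m) = measure m B)"

definition shift_ergodic :: "(nat \<Rightarrow> nat) measure \<Rightarrow> bool" where
  "shift_ergodic m \<longleftrightarrow> shift_invariant m \<and>
     (\<forall>B\<in>sets m. left_shift -` B \<inter> space m = B \<longrightarrow> measure m B = 0 \<or> measure m B = 1)"

definition kaenmaki_measure ::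
  "nat \<Rightarrow> (nat \<Rightarrow> real^2^2) \<Rightarrow> real \<Rightarrow> (nat \<Rightarrow> nat) measure \<Rightarrow> bool" where
  "kaenmaki_measure d A s m \<longleftrightarrow>
     prob_space m \<and> sets m = sets (symbol_space d) \<and> shift_ergodic m \<and>
     (\<exists>C\<ge>1. \<forall>n\<ge>1. \<forall>w\<in>words d n.
        1 / C * exp (- pressure d A s * real (length w)) * sv_fun A s w \<le> measure m (cylinder d w) \<and>
        measure m (cylinder d w) \<le> C * exp (- pressure d A s * real (length w)) * sv_fun A s w)"

text \<open>The exponents and the entropy of the projected measure are defined through the measure on the
  symbolic space and do not involve the translations.\<close>

definition chi1 :: "(nat \<Rightarrow> real^2^2) \<Rightarrow> (nat \<Rightarrow> nat) measure \<Rightarrow> real" where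
  "chi1 A m =
     (THE c. AE \<omega> in m. (\<lambda>n. - (1 / real n * ln (alpha1 A (initial_word \<omega> n)))) \<longlonglongrightarrow> c)"

definition chi2 :: "(nat \<Rightarrow> real^2^2) \<Rightarrow> (nat \<Rightarrow> nat) measure \<Rightarrow> real" where
  "chi2 A m =
     (THE c. AE \<omega> in m. (\<lambda>n. - (1 / real n * ln (alpha2 A (initial_word \<omega> n)))) \<longlonglongrightarrow> c)"

definition shift_entropy :: "nat \<Rightarrow> (nat \<Rightarrow> nat) measure \<Rightarrow> real" where
  "shift_entropy d m =
     (THE c. AE \<omega> in m.
        (\<lambda>n. - (1 / real n * ln (measure m (cylinder d (initial_word \<omega> n))))) \<longlonglongrightarrow> c)"

definition projected_measure ::
  "(nat \<Rightarrow> real^2^2) \<Rightarrow> (nat \<Rightarrow> real^2) \<Rightarrow> (nat \<Rightarrow> nat) measure \<Rightarrow> (real^2) measure" where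
  "projected_measure A t m = distr m borel (coding_map A t)"

text \<open>\<open>has_exact_dimension \<nu> \<alpha>\<close> says both that \<open>\<nu>\<close> is exact dimensional and that \<open>dim \<nu> = \<alpha>\<close>.\<close>

definition has_exact_dimension :: "(real^2) measure \<Rightarrow> real \<Rightarrow> bool" where
  "has_exact_dimension \<nu> \<alpha> \<longleftrightarrow>
     prob_space \<nu> \<and> sets \<nu> = sets borel \<and>
     (AE x in \<nu>. ((\<lambda>r. ln (measure \<nu> (cball x r)) / ln r) \<longlongrightarrow> \<alpha>) (at_right 0))"

text \<open>Lebesgue measure on the translation parameters, i.e. on the \<open>d\<close>-fold product of the plane.\<close>

definition translation_measure :: "nat \<Rightarrow> (nat \<Rightarrow> real^2) measure" where
  "translation_measure d = (\<Pi>\<^sub>M i\<in>{1..d}. lborel)"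

end

theory Submission
  imports Defs "HOL-Real_Asymp.Real_Asymp"
begin

text \<open>
The dimension is obtained from the masses of balls around typical points at exponential scales.  Every matrix of
the system keeps or exchanges the two coordinate axes, so the matrix of the prefix of length \<open>n\<close> of a
sequence \<open>\<omega>\<close> has one non-zero entry in each row; the larger entry is the first singular value, the smaller one the
second.  Kingman's theorem provides the exponents \<open>\<xi>1 \<le> \<xi>2\<close> of the singular values
(\<open>alpha1_rate\<close>, \<open>alpha2_rate\<close>), and the Gibbs bounds turn them into the entropy \<open>h\<close>
(\<open>entropy_rate\<close>).  For a typical \<open>\<omega>\<close> the larger entry stays from some time on in the same row
\<open>z\<close>, or the exponents agree; in both cases some row has rate \<open>\<xi>1\<close> (\<open>typical_regular\<close>).

Upper bounds for the mass of balls use only the coordinate \<open>z\<close>, in which the images of the cylinders around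
\<open>\<omega>\<close> are long.  If \<open>\<tau>\<close> separates from \<open>\<omega>\<close> at time \<open>k\<close>, the \<open>z\<close>-coordinates of the two
coded points differ by the entry \<open>c\<^sub>k \<approx> exp (- \<xi>1 * k)\<close> times a linear form in the translations, and the hypothesis
on \<open>u\<close> and \<open>v\<close> bounds one coefficient of this form away from \<open>0\<close> (\<open>slope_gap\<close>).  So bounded translations
for which the difference is at most \<open>r\<close> have measure of order \<open>r / c\<^sub>k\<close> (\<open>transversality\<close>), and the
expected mass of the points branching off at time \<open>k\<close> and lying within \<open>r\<close> of \<open>\<omega>\<close> in this coordinate is of
order \<open>exp (- h * k) * r * exp (\<xi>1 * k)\<close>.

If \<open>h \<le> \<xi>1\<close>, the choice \<open>r = exp (- \<xi>1 * n)\<close> and summation over \<open>k < n\<close> give the mass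
\<open>exp (- h * n)\<close> up to subexponential factors (\<open>near_global\<close>), hence the dimension \<open>h / \<xi>1\<close>.  If
\<open>\<xi>1 < h\<close>, strong separation confines a ball of radius about \<open>exp (- \<xi>2 * n)\<close> to the cylinder of order
\<open>n\<close>.  Only \<open>k \<ge> n\<close> contributes, the sum is geometric, and the mass is \<open>exp (- (h - \<xi>1 + \<xi>2) * n)\<close>
(\<open>near_local\<close>), which corresponds to the dimension \<open>1 + (h - \<xi>1) / \<xi>2\<close>.  The Borel--Cantelli lemma and
Fubini's theorem turn these expectations into statements for almost all translations and almost all sequences.

The matching lower bounds hold for all translations: for \<open>h \<le> \<xi>1\<close> because a ball contains the image of a cylinder
(\<open>ball_mass_lower_cylinder\<close>), for \<open>\<xi>1 < h\<close> by counting the grid cells that carry the measure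
(\<open>ball_mass_lower_cells\<close>).
\<close>

section \<open>The subadditive ergodic theorem for bounded processes\<close>

lemma sum_lessThan_split: "(\<Sum>k<n + (L::nat). f k) = (\<Sum>k<n. f k) + (\<Sum>k<L. f (k + n) :: real)"
  by (induction L) (auto simp: add.commute)

lemma divide_by_length:
  fixes N p q r k :: real
  assumes "0 < N" and "- N * p \<le> r * N + 3 * (N * q) + 3 * k"
  shows "- p \<le> r + 3 * q + 3 * k / N"
proof -
  have "- p \<le> (r * N + 3 * (N * q) + 3 * k) / N"
    using assms by (simp add: pos_le_divide_eq mult.commute)
  also have "\<dots> = r + 3 * q + 3 * k / N" using assms(1) by (simp add: add_divide_distrib)
  finally show ?thesis .
qed

locale ergodic_system = prob_space M for M :: "'a measure" +
  fixes T :: "'a \<Rightarrow> 'a"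
  assumes T_measurable [measurable]: "T \<in> measurable M M"
    and T_invariant: "B \<in> sets M \<Longrightarrow> measure M (T -` B \<inter> space M) = measure M B"
    and T_ergodic: "B \<in> sets M \<Longrightarrow> T -` B \<inter> space M = B \<Longrightarrow> measure M B = 0 \<or> measure M B = 1"
begin

lemma T_space: "x \<in> space M \<Longrightarrow> T x \<in> space M"
  using measurable_space[OF T_measurable] .

lemma funpow_measurable [measurable]: "(T ^^ n) \<in> measurable M M"
  by (induction n) auto

lemma funpow_space: "x \<in> space M \<Longrightarrow> (T ^^ n) x \<in> space M"
  using measurable_space[OF funpow_measurable] .

lemma funpow_invariant: "B \<in> sets M \<Longrightarrow> measure M ((T ^^ n) -` B \<inter> space M) = measure M B"
proof (induction n)
  case (Suc n)
  have "(T ^^ Suc n) -` B \<inter> space M = T -` ((T ^^ n) -` B \<inter> space M) \<inter> space M"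
    by (auto simp: funpow_swap1 T_space)
  moreover have "(T ^^ n) -` B \<inter> space M \<in> sets M" using Suc.prems by measurable
  ultimately show ?case using T_invariant Suc by metis
next
  case 0
  then show ?case using sets.sets_into_space by (auto simp: Int_absorb2)
qed

text \<open>The iterated preimages of \<open>B\<close> decrease and have equal measure, so their intersection has the
measure of \<open>B\<close>, and it is strictly invariant.\<close>

lemma sub_invariant_trivial:
  assumes B: "B \<in> sets M" and sub: "T -` B \<inter> space M \<subseteq> B"
  shows "measure M B = 0 \<or> measure M B = 1"
proof -
  define S where "S n = (T ^^ n) -` B \<inter> space M" for n
  have S_sets: "S n \<in> sets M" for n unfolding S_def using B by measurable
  have S_Suc: "S (Suc n) = T -` S n \<inter> space M" for n
    by (auto simp: S_def funpow_swap1 T_space)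
  have S_le: "S (Suc n) \<subseteq> S n" for n
    using sub by (auto simp: S_def funpow_space)
  have dec: "decseq S" using S_le by (intro decseq_SucI)
  have "(\<lambda>n. measure M (S n)) \<longlonglongrightarrow> measure M (\<Inter>n. S n)"
    using S_sets dec by (intro finite_Lim_measure_decseq) auto
  moreover have "measure M (S n) = measure M B" for n
    unfolding S_def by (rule funpow_invariant[OF B])
  ultimately have eq: "measure M (\<Inter>n. S n) = measure M B"
    by (simp add: LIMSEQ_const_iff)
  have "T -` (\<Inter>n. S n) \<inter> space M = (\<Inter>n. S (Suc n))"
    unfolding S_Suc by auto
  also have "\<dots> = (\<Inter>n. S n)"
    using S_le by (auto; blast)
  finally have "T -` (\<Inter>n. S n) \<inter> space M = (\<Inter>n. S n)" .
  moreover have "(\<Inter>n. S n) \<in> sets M" using S_sets by auto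
  ultimately show ?thesis using T_ergodic eq by metis
qed

end

locale bounded_subadditive = ergodic_system +
  fixes g :: "nat \<Rightarrow> 'a \<Rightarrow> real" and C :: real
  assumes g_measurable [measurable]: "g n \<in> borel_measurable M"
    and g_subadditive: "x \<in> space M \<Longrightarrow> g (n + k) x \<le> g n x + g k ((T ^^ n) x)"
    and g_bounded: "x \<in> space M \<Longrightarrow> \<bar>g n x\<bar> \<le> C * real n"
begin

lemma C_nonneg: "0 \<le> C"
proof -
  obtain x where "x \<in> space M" using not_empty by blast
  from g_bounded[OF this, of 1] show ?thesis by simp
qed

text \<open>The lower limit of \<open>g n x / n\<close> does not increase when \<open>T x\<close> is replaced by \<open>x\<close>, because
\<open>g (1 + n) x \<le> C + g n (T x)\<close>.  So its sublevel sets have measure \<open>0\<close> or \<open>1\<close>, and the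
constant is the level at which the measure jumps.\<close>

lemma lower_rate:
  obtains c where "\<bar>c\<bar> \<le> C"
    and "AE x in M. \<forall>e>0. (\<forall>N. \<exists>n\<ge>N. g n x < (c + e) * real n) \<and>
           (\<forall>\<^sub>F n in sequentially. (c - e) * real n \<le> g n x)"
proof -
  define B where "B q = {x \<in> space M. \<exists>j::nat. \<forall>N. \<exists>n\<ge>N. g n x < (q - 1 / real (Suc j)) * real n}" for q
  have B_sets [measurable]: "B q \<in> sets M" for q unfolding B_def by measurable
  \<comment> \<open>The two rates leave room for the constant \<open>C\<close>: moving from \<open>T x\<close> to \<open>x\<close> only halves the slack below \<open>q\<close>.\<close>
  have B_sub: "T -` B q \<inter> space M \<subseteq> B q" for q
  proof
    fix x assume "x \<in> T -` B q \<inter> space M"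
    then have x: "x \<in> space M" and "T x \<in> B q" by auto
    then obtain j where j: "\<And>N. \<exists>n\<ge>N. g n (T x) < (q - 1 / real (Suc j)) * real n"
      unfolding B_def by blast
    have "\<exists>n\<ge>N. g n x < (q - 1 / real (Suc (2 * j + 1))) * real n" for N
    proof -
      define w where "w = 1 / real (Suc (2 * j + 1))"
      have w: "w > 0" "1 / real (Suc j) = 2 * w" by (auto simp: w_def field_simps)
      obtain n where n: "n \<ge> max N (nat \<lceil>(C + \<bar>q\<bar> + w) / w\<rceil>)"
        and gn: "g n (T x) < (q - 2 * w) * real n" using j w(2) by metis
      have "(C + \<bar>q\<bar> + w) / w \<le> real n" using n by linarith
      then have nw: "C + \<bar>q\<bar> + w \<le> w * real n" using w by (simp add: field_simps)
      have "g (1 + n) x \<le> g 1 x + g n (T x)" using g_subadditive[OF x, of 1 n] by simp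
      also have "\<dots> < C + (q - 2 * w) * real n" using g_bounded[OF x, of 1] gn by simp
      also have "\<dots> \<le> (q - w) * real (1 + n)" using nw by (auto simp: algebra_simps)
      finally show ?thesis using n unfolding w_def by (intro exI[of _ "1 + n"]) auto
    qed
    then show "x \<in> B q" unfolding B_def using x by blast
  qed
  have B01: "prob (B q) = 0 \<or> prob (B q) = 1" for q
    by (rule sub_invariant_trivial[OF B_sets B_sub])
  have B_mono: "B p \<subseteq> B q" if "p \<le> q" for p q
  proof
    fix x assume "x \<in> B p"
    then obtain j where x: "x \<in> space M" and j: "\<And>N. \<exists>n\<ge>N. g n x < (p - 1 / real (Suc j)) * real n"
      unfolding B_def by blast
    have "(p - 1 / real (Suc j)) * real n \<le> (q - 1 / real (Suc j)) * real n" for n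
      using that by (intro mult_right_mono) auto
    then show "x \<in> B q" unfolding B_def using x j by (blast intro: less_le_trans)
  qed
  have B_low: "B (- C) = {}"
  proof -
    have "(- C - 1 / real (Suc j)) * real n \<le> g n x" if "x \<in> space M" for n j x
    proof -
      have "(- C - 1 / real (Suc j)) * real n \<le> - C * real n" by (intro mult_right_mono) auto
      with g_bounded[OF that, of n] show ?thesis by linarith
    qed
    then show ?thesis unfolding B_def by (auto simp: not_less intro!: exI[of _ 0])
  qed
  have B_high: "B q = space M" if q: "q > C" for q
  proof -
    obtain j where j: "1 / real (Suc j) < q - C"
      using reals_Archimedean[of "q - C"] q by (auto simp: inverse_eq_divide)
    have "\<exists>n\<ge>N. g n x < (q - 1 / real (Suc j)) * real n" if "x \<in> space M" for x N
    proof (intro exI[of _ "Suc N"] conjI)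
      have "g (Suc N) x \<le> C * real (Suc N)" using g_bounded[OF that, of "Suc N"] by linarith
      also have "\<dots> < (q - 1 / real (Suc j)) * real (Suc N)"
        using j by (intro mult_strict_right_mono) auto
      finally show "g (Suc N) x < (q - 1 / real (Suc j)) * real (Suc N)" .
    qed simp
    then show ?thesis unfolding B_def by blast
  qed
  define Z where "Z = {q. prob (B q) = 0}"
  have Z_low: "- C \<in> Z" using B_low by (simp add: Z_def)
  have Z_high: "q \<le> C" if "q \<in> Z" for q
    using that B_high[of q] prob_space by (fastforce simp: Z_def)
  have bdd: "bdd_above Z" using Z_high by (intro bdd_aboveI) auto
  define c where "c = Sup Z"
  have c_low: "- C \<le> c" unfolding c_def using Z_low bdd by (rule cSup_upper)
  have c_high: "c \<le> C" unfolding c_def using Z_low Z_high by (intro cSup_least) auto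
  have above: "prob (B q) = 1" if "q > c" for q
  proof -
    have "q \<notin> Z" using that cSup_upper[OF _ bdd, of q] by (auto simp: c_def)
    then show ?thesis using B01 by (auto simp: Z_def)
  qed
  have below: "prob (B q) = 0" if q: "q < c" for q
  proof -
    obtain p where "p \<in> Z" "q < p" using less_cSupD[of Z q] Z_low q by (auto simp: c_def)
    then have "prob (B q) \<le> 0" using finite_measure_mono[OF B_mono[of q p] B_sets] by (auto simp: Z_def)
    then show ?thesis by (simp add: measure_le_0_iff)
  qed
  have "AE x in M. \<forall>k::nat. x \<in> B (c + 1 / real (Suc k)) \<and> x \<notin> B (c - 1 / real (Suc k))"
  proof (subst AE_all_countable, intro allI AE_conjI)
    fix k :: nat
    show "AE x in M. x \<in> B (c + 1 / real (Suc k))"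
      by (intro AE_prob_1 above) auto
    have "prob (B (c - 1 / real (Suc k))) = 0" by (intro below) auto
    then show "AE x in M. x \<notin> B (c - 1 / real (Suc k))"
      by (intro AE_not_in) (auto simp: null_sets_def emeasure_eq_measure)
  qed
  then have "AE x in M. \<forall>e>0. (\<forall>N. \<exists>n\<ge>N. g n x < (c + e) * real n) \<and>
           (\<forall>\<^sub>F n in sequentially. (c - e) * real n \<le> g n x)"
  proof (eventually_elim, intro allI impI conjI)
    fix x and e :: real assume x: "\<forall>k::nat. x \<in> B (c + 1 / real (Suc k)) \<and> x \<notin> B (c - 1 / real (Suc k))"
      and e: "e > 0"
    have xs: "x \<in> space M" using x by (auto simp: B_def)
    obtain k where k: "1 / real (Suc k) < e / 2"
      using reals_Archimedean[of "e / 2"] e by (auto simp: inverse_eq_divide)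
    from x obtain j where j: "\<And>N. \<exists>n\<ge>N. g n x < (c + 1 / real (Suc k) - 1 / real (Suc j)) * real n"
      unfolding B_def by blast
    have "(c + 1 / real (Suc k) - 1 / real (Suc j)) * real n \<le> (c + e) * real n" for n
    proof -
      have "1 / real (Suc j) > 0" by simp
      then show ?thesis using k e by (intro mult_right_mono) linarith+
    qed
    then show "\<exists>n\<ge>N. g n x < (c + e) * real n" for N using j[of N] by (meson less_le_trans)
    have "x \<notin> B (c - 1 / real (Suc k))" using x by blast
    then have "\<not> (\<forall>N. \<exists>n\<ge>N. g n x < (c - 1 / real (Suc k) - 1 / real (Suc k)) * real n)"
      using xs unfolding B_def by blast
    then obtain N where N: "\<And>n. n \<ge> N \<Longrightarrow> (c - 1 / real (Suc k) - 1 / real (Suc k)) * real n \<le> g n x"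
      by (meson not_less)
    have "(c - e) * real n \<le> (c - 1 / real (Suc k) - 1 / real (Suc k)) * real n" for n
      using k by (intro mult_right_mono) linarith+
    then show "\<forall>\<^sub>F n in sequentially. (c - e) * real n \<le> g n x"
      unfolding eventually_sequentially using N by (meson order_trans)
  qed
  with c_low c_high show ?thesis by (intro that[of c]) auto
qed

text \<open>To compare \<open>g L x\<close> with the rate \<open>r\<close>, the orbit of \<open>x\<close> is cut into blocks.  From the points of
\<open>fast r K\<close> a block of at most \<open>K\<close> steps achieves the rate \<open>r\<close>; \<open>misses r K L x\<close> counts
the times before \<open>L\<close> at which the orbit is elsewhere.\<close>

definition fast :: "real \<Rightarrow> nat \<Rightarrow> 'a set" where
  "fast r K = {x \<in> space M. \<exists>n\<in>{1..K}. g n x \<le> r * real n}"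

lemma fast_sets [measurable]: "fast r K \<in> sets M"
  unfolding fast_def by measurable

definition misses :: "real \<Rightarrow> nat \<Rightarrow> nat \<Rightarrow> 'a \<Rightarrow> real" where
  "misses r K L x = (\<Sum>k<L. indicator (- fast r K) ((T ^^ k) x))"

lemma misses_add: "misses r K (n + L) x = misses r K n x + misses r K L ((T ^^ n) x)"
  unfolding misses_def by (simp add: sum_lessThan_split funpow_add)

lemma misses_nonneg: "0 \<le> misses r K L x"
  unfolding misses_def by (intro sum_nonneg) auto

text \<open>The orbit is cut greedily.  From a point of \<open>fast r K\<close> the next block is one with rate at most
\<open>r\<close>; any other step is taken alone and exceeds the rate by at most \<open>2 * C + 1\<close>.  The last summand
pays for the end of the orbit, where a block might not fit.\<close>

lemma greedy_bound:
  assumes r: "\<bar>r\<bar> \<le> C + 1" and x: "x \<in> space M"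
  shows "g L x \<le> r * real L + (2 * C + 1) * misses r K L x + (2 * C + 1) * real K"
  using x
proof (induction L arbitrary: x rule: less_induct)
  case (less L)
  have C: "C \<le> r + (2 * C + 1)" using r by linarith
  show ?case
  proof (cases "L \<le> K")
    case True
    have "g L x \<le> C * real L" using g_bounded[OF less.prems, of L] by linarith
    also have "\<dots> \<le> (r + (2 * C + 1)) * real L" using C by (intro mult_right_mono) auto
    also have "\<dots> = r * real L + (2 * C + 1) * real L" by (simp add: algebra_simps)
    also have "\<dots> \<le> r * real L + (2 * C + 1) * real K"
      using True C_nonneg by (intro add_left_mono mult_left_mono) auto
    finally show ?thesis using mult_nonneg_nonneg[OF _ misses_nonneg[of r K L x], of "2 * C + 1"] C_nonneg by linarith
  next
    case L: False
    show ?thesis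
    proof (cases "x \<in> fast r K")
      case True
      then obtain n where n: "n \<in> {1..K}" "g n x \<le> r * real n" unfolding fast_def by blast
      define k where "k = L - n"
      have k: "L = n + k" "k < L" using L n(1) by (auto simp: k_def)
      have "g L x \<le> g n x + g k ((T ^^ n) x)" unfolding k(1) by (rule g_subadditive[OF less.prems])
      also have "\<dots> \<le> r * real n + (r * real k + (2 * C + 1) * misses r K k ((T ^^ n) x) + (2 * C + 1) * real K)"
        using n(2) less.IH[OF k(2) funpow_space[OF less.prems]] by (rule add_mono)
      also have "\<dots> \<le> r * real L + (2 * C + 1) * misses r K L x + (2 * C + 1) * real K"
      proof -
        have "misses r K L x = misses r K n x + misses r K k ((T ^^ n) x)"
          unfolding k(1) by (rule misses_add)
        moreover have "0 \<le> (2 * C + 1) * misses r K n x"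
          using misses_nonneg[of r K n x] C_nonneg by simp
        ultimately show ?thesis by (simp add: k(1) algebra_simps)
      qed
      finally show ?thesis .
    next
      case False
      define k where "k = L - 1"
      have k: "L = 1 + k" "k < L" using L by (auto simp: k_def)
      have one: "misses r K 1 x = 1" using False by (simp add: misses_def)
      have "g L x \<le> g 1 x + g k (T x)" unfolding k(1) using g_subadditive[OF less.prems, of 1 k] by simp
      also have "\<dots> \<le> (r + (2 * C + 1)) + (r * real k + (2 * C + 1) * misses r K k (T x) + (2 * C + 1) * real K)"
        using g_bounded[OF less.prems, of 1] C less.IH[OF k(2) T_space[OF less.prems]]
        by (intro add_mono) auto
      also have "\<dots> = r * real L + (2 * C + 1) * misses r K L x + (2 * C + 1) * real K"
        using one misses_add[of r K 1 k x] by (simp add: k(1) algebra_simps)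
      finally show ?thesis .
    qed
  qed
qed

lemma misses_measurable [measurable]: "misses r K L \<in> borel_measurable M"
proof -
  have "(\<lambda>x. indicator (- fast r K) ((T ^^ k) x) :: real) \<in> borel_measurable M" for k
  proof -
    have "(\<lambda>x. 1 - indicator (fast r K) ((T ^^ k) x) :: real) \<in> borel_measurable M"
      by measurable
    moreover have "(\<lambda>x. 1 - indicator (fast r K) ((T ^^ k) x) :: real) = (\<lambda>x. indicator (- fast r K) ((T ^^ k) x))"
      by (auto simp: indicator_def)
    ultimately show ?thesis by simp
  qed
  then show ?thesis unfolding misses_def by measurable
qed

lemma misses_le: "misses r K L x \<le> real L"
proof -
  have "misses r K L x \<le> (\<Sum>k<L. 1)" unfolding misses_def by (intro sum_mono) (auto simp: indicator_def)
  then show ?thesis by simp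
qed

lemma expectation_misses: "(\<integral>x. misses r K L x \<partial>M) = real L * measure M (space M - fast r K)"
proof -
  have *: "integrable M (\<lambda>x. indicator ((T ^^ k) -` (space M - fast r K) \<inter> space M) x :: real)" for k
    by (intro integrable_real_indicator) (auto simp: emeasure_eq_measure)
  have "(\<integral>x. misses r K L x \<partial>M) = (\<integral>x. (\<Sum>k<L. indicator ((T ^^ k) -` (space M - fast r K) \<inter> space M) x) \<partial>M)"
    unfolding misses_def
    by (intro Bochner_Integration.integral_cong sum.cong) (auto simp: indicator_def funpow_space)
  also have "\<dots> = (\<Sum>k<L. measure M ((T ^^ k) -` (space M - fast r K) \<inter> space M))"
    using * by (subst Bochner_Integration.integral_sum) auto
  also have "\<dots> = real L * measure M (space M - fast r K)"
    by (subst funpow_invariant) auto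
  finally show ?thesis .
qed

text \<open>The sets \<open>fast r K\<close> exhaust the space up to a null set, so the frequency of misses can be made small.\<close>

lemma slow_tends_to_0:
  assumes "AE x in M. \<exists>n\<ge>1. g n x \<le> r * real n"
  shows "(\<lambda>K. measure M (space M - fast r K)) \<longlonglongrightarrow> 0"
proof -
  have "(\<lambda>K. measure M (space M - fast r K)) \<longlonglongrightarrow> measure M (\<Inter>K. space M - fast r K)"
    by (intro finite_Lim_measure_decseq) (auto simp: decseq_def fast_def)
  moreover have "measure M (\<Inter>K. space M - fast r K) = 0"
  proof -
    have "AE x in M. x \<notin> (\<Inter>K. space M - fast r K)"
      using assms
    proof eventually_elim
      fix x assume "\<exists>n\<ge>1. g n x \<le> r * real n"
      then obtain n where n: "n \<ge> 1" "g n x \<le> r * real n" by blast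
      then have "x \<in> space M \<Longrightarrow> x \<in> fast r n" by (auto simp: fast_def)
      then show "x \<notin> (\<Inter>K. space M - fast r K)" by blast
    qed
    then have "(\<Inter>K. space M - fast r K) \<in> null_sets M"
      by (subst AE_iff_null_sets) auto
    then show ?thesis by (rule measure_eq_0_null_sets)
  qed
  ultimately show ?thesis by simp
qed

end

context ergodic_system
begin

text \<open>This is one half of Birkhoff's theorem for the indicator of \<open>S\<close>.  Minus the number of visits is an
additive process \<open>V\<close>, so its lower rate is a constant \<open>c\<close>.  Integrating the greedy bound for \<open>V\<close>
gives \<open>- measure M S \<le> c\<close>, since the expected number of misses is proportional to the time.\<close>

lemma visit_frequency_le:
  assumes S [measurable]: "S \<in> sets M" and e: "e > 0"
  shows "AE x in M. \<forall>\<^sub>F n in sequentially.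
    (\<Sum>k<n. indicator S ((T ^^ k) x)) \<le> (measure M S + e) * real n"
proof -
  define V where "V n x = - (\<Sum>k<n. indicator S ((T ^^ k) x) :: real)" for n x
  have V_add: "V (n + k) x = V n x + V k ((T ^^ n) x)" for n k x
    unfolding V_def by (simp add: sum_lessThan_split funpow_add)
  have V_bd: "\<bar>V n x\<bar> \<le> 1 * real n" for n x
  proof -
    have "(\<Sum>k<n. indicator S ((T ^^ k) x) :: real) \<le> (\<Sum>k<n. 1)"
      by (intro sum_mono) (auto simp: indicator_def)
    moreover have "0 \<le> (\<Sum>k<n. indicator S ((T ^^ k) x) :: real)" by (intro sum_nonneg) auto
    ultimately show ?thesis by (simp add: V_def)
  qed
  interpret V: bounded_subadditive M T V 1
  proof unfold_locales
    show "V n \<in> borel_measurable M" for n unfolding V_def by measurable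
  qed (use V_add V_bd in auto)
  obtain c where c: "\<bar>c\<bar> \<le> 1" and ae: "AE x in M. \<forall>e>0. (\<forall>N. \<exists>n\<ge>N. V n x < (c + e) * real n) \<and>
           (\<forall>\<^sub>F n in sequentially. (c - e) * real n \<le> V n x)"
    by (rule V.lower_rate)
  have EV: "(\<integral>x. V n x \<partial>M) = - real n * measure M S" for n
  proof -
    have *: "integrable M (\<lambda>x. indicator ((T ^^ k) -` S \<inter> space M) x :: real)" for k
      by (intro integrable_real_indicator) (auto simp: emeasure_eq_measure)
    have "(\<integral>x. V n x \<partial>M) = (\<integral>x. - (\<Sum>k<n. indicator ((T ^^ k) -` S \<inter> space M) x) \<partial>M)"
      unfolding V_def
      by (intro Bochner_Integration.integral_cong arg_cong[of _ _ uminus] sum.cong) (auto simp: indicator_def)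
    also have "\<dots> = - (\<Sum>k<n. measure M ((T ^^ k) -` S \<inter> space M))"
      using * by (simp add: Bochner_Integration.integral_sum)
    also have "\<dots> = - real n * measure M S"
      by (subst funpow_invariant) auto
    finally show ?thesis .
  qed
  have "- measure M S \<le> c + d" if d: "0 < d" "d \<le> 1" for d
  proof -
    have r: "\<bar>c + d\<bar> \<le> 1 + 1" using c d by linarith
    have step: "- measure M S \<le> c + d + 3 * measure M (space M - V.fast (c + d) K)" for K
    proof -
      let ?q = "measure M (space M - V.fast (c + d) K)"
      have bound: "- measure M S \<le> c + d + 3 * ?q + 3 * real K / real (Suc n)" for n
      proof -
        have iV: "integrable M (V (Suc n))"
          using V_bd[of "Suc n"] by (intro integrable_const_bound[where B = "real (Suc n)"]) auto
        have im: "integrable M (V.misses (c + d) K (Suc n))"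
          using V.misses_nonneg V.misses_le
          by (intro integrable_const_bound[where B = "real (Suc n)"]) (auto simp: abs_of_nonneg simp del: of_nat_Suc)
        have "(\<integral>x. V (Suc n) x \<partial>M) \<le>
           (\<integral>x. (c + d) * real (Suc n) + 3 * V.misses (c + d) K (Suc n) x + 3 * real K \<partial>M)"
        proof (rule integral_mono[OF iV])
          fix x assume "x \<in> space M"
          from V.greedy_bound[OF r this, of "Suc n" K]
          show "V (Suc n) x \<le> (c + d) * real (Suc n) + 3 * V.misses (c + d) K (Suc n) x + 3 * real K"
            by simp
        qed (use im in auto)
        also have "\<dots> = (c + d) * real (Suc n) + 3 * (real (Suc n) * ?q) + 3 * real K"
          using im by (simp add: V.expectation_misses prob_space)
        finally have est: "- real (Suc n) * measure M S \<le>
            (c + d) * real (Suc n) + 3 * (real (Suc n) * ?q) + 3 * real K" unfolding EV .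
        then show ?thesis by (intro divide_by_length) auto
      qed
      have "(\<lambda>n. c + d + 3 * ?q + 3 * real K / real (Suc n)) \<longlonglongrightarrow> c + d + 3 * ?q + 0"
        by (intro tendsto_intros LIMSEQ_Suc[OF lim_const_over_n])
      then have "- measure M S \<le> c + d + 3 * ?q + 0"
        by (rule LIMSEQ_le_const) (use bound in blast)
      then show ?thesis by simp
    qed
    have "AE x in M. \<exists>n\<ge>1. V n x \<le> (c + d) * real n"
      using ae by eventually_elim (use d(1) less_imp_le in blast)
    from V.slow_tends_to_0[OF this]
    have "(\<lambda>K. c + d + 3 * measure M (space M - V.fast (c + d) K)) \<longlonglongrightarrow> c + d + 3 * 0"
      by (intro tendsto_intros)
    then have "- measure M S \<le> c + d + 3 * 0"
      by (rule LIMSEQ_le_const) (use step in blast)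
    then show ?thesis by simp
  qed
  note cd = this
  have cS: "- measure M S \<le> c"
  proof (rule field_le_epsilon)
    fix x :: real assume "x > 0"
    with cd[of "min x 1"] show "- measure M S \<le> c + x" by simp
  qed
  from ae show ?thesis
  proof eventually_elim
    fix x assume *: "\<forall>e>0. (\<forall>N. \<exists>n\<ge>N. V n x < (c + e) * real n) \<and> (\<forall>\<^sub>F n in sequentially. (c - e) * real n \<le> V n x)"
    then have "\<forall>\<^sub>F n in sequentially. (c - e) * real n \<le> V n x" using e by blast
    then show "\<forall>\<^sub>F n in sequentially. (\<Sum>k<n. indicator S ((T ^^ k) x)) \<le> (measure M S + e) * real n"
    proof eventually_elim
      case (elim n)
      have "- (measure M S + e) * real n \<le> (c - e) * real n"
        using cS by (intro mult_right_mono) auto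
      with elim show ?case by (simp add: V_def algebra_simps)
    qed
  qed
qed

end

context bounded_subadditive
begin

text \<open>Kingman's theorem.  The lower limit is the constant \<open>c\<close> by \<open>lower_rate\<close>.  For the upper limit,
the orbit reaches the rate \<open>c + e\<close> within \<open>K\<close> steps except at times of small frequency, and the greedy
bound applies.\<close>

theorem subadditive_ergodic:
  obtains c where "AE x in M. (\<lambda>n. g n x / real n) \<longlonglongrightarrow> c"
proof -
  obtain c where c: "\<bar>c\<bar> \<le> C" and ae: "AE x in M. \<forall>e>0. (\<forall>N. \<exists>n\<ge>N. g n x < (c + e) * real n) \<and>
           (\<forall>\<^sub>F n in sequentially. (c - e) * real n \<le> g n x)"
    by (rule lower_rate)
  define D where "D = 2 * C + 1"
  have D: "D > 0" using C_nonneg by (simp add: D_def)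
  have upper: "AE x in M. \<forall>\<^sub>F n in sequentially. g n x \<le> (c + 4 * e) * real n" if e: "0 < e" "e \<le> 1" for e
  proof -
    have r: "\<bar>c + e\<bar> \<le> C + 1" using c e by linarith
    have "AE x in M. \<exists>n\<ge>1. g n x \<le> (c + e) * real n"
      using ae by eventually_elim (use e(1) less_imp_le in blast)
    from slow_tends_to_0[OF this] have "\<forall>\<^sub>F K in sequentially. measure M (space M - fast (c + e) K) < e / D"
      using D e by (intro order_tendstoD) auto
    then obtain K where K: "measure M (space M - fast (c + e) K) < e / D"
      by (auto simp: eventually_sequentially)
    have "AE x in M. \<forall>\<^sub>F n in sequentially.
      (\<Sum>k<n. indicator (space M - fast (c + e) K) ((T ^^ k) x)) \<le> (measure M (space M - fast (c + e) K) + e / D) * real n"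
      using D e by (intro visit_frequency_le) auto
    then show ?thesis using AE_space
    proof eventually_elim
      case (elim x)
      have ev: "\<forall>\<^sub>F n in sequentially. real n \<ge> D * real K / e"
        by (rule eventually_ge_at_top[THEN filterlim_real_sequentially[unfolded filterlim_iff, rule_format]])
      from elim(1) ev show ?case
      proof eventually_elim
        case (elim n)
        have m: "misses (c + e) K n x = (\<Sum>k<n. indicator (space M - fast (c + e) K) ((T ^^ k) x))"
          unfolding misses_def using \<open>x \<in> space M\<close>
          by (intro sum.cong) (auto simp: indicator_def funpow_space)
        have "D * misses (c + e) K n x \<le> D * ((e / D + e / D) * real n)"
          unfolding m using elim(1) K D
          by (intro mult_left_mono order_trans[OF elim(1)] mult_right_mono) auto
        also have "\<dots> = 2 * e * real n" using D by (simp add: field_simps)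
        finally have 1: "D * misses (c + e) K n x \<le> 2 * e * real n" .
        have 2: "D * real K \<le> e * real n" using elim(2) e by (simp add: field_simps)
        have "g n x \<le> (c + e) * real n + D * misses (c + e) K n x + D * real K"
          using greedy_bound[OF r \<open>x \<in> space M\<close>, of n K] unfolding D_def .
        also have "\<dots> \<le> (c + 4 * e) * real n" using 1 2 by (simp add: algebra_simps)
        finally show ?case .
      qed
    qed
  qed
  have "AE x in M. \<forall>j::nat. \<forall>\<^sub>F n in sequentially. g n x \<le> (c + 4 * (1 / real (Suc j))) * real n"
    by (subst AE_all_countable) (intro allI upper, auto)
  with ae have "AE x in M. (\<lambda>n. g n x / real n) \<longlonglongrightarrow> c"
  proof eventually_elim
    case (elim x)
    show ?case
    proof (rule tendstoI)
      fix e :: real assume e: "e > 0"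
      obtain j where j: "1 / real (Suc j) < e / 4"
        using reals_Archimedean[of "e / 4"] e by (auto simp: inverse_eq_divide)
      have "\<forall>\<^sub>F n in sequentially. (c - e / 2) * real n \<le> g n x" using elim(1) e half_gt_zero by blast
      moreover have "\<forall>\<^sub>F n in sequentially. g n x \<le> (c + 4 * (1 / real (Suc j))) * real n" using elim(2) by blast
      moreover have "\<forall>\<^sub>F n in sequentially. n > 0" by (rule eventually_gt_at_top)
      ultimately show "\<forall>\<^sub>F n in sequentially. dist (g n x / real n) c < e"
      proof eventually_elim
        case (elim n)
        then have "c - e / 2 \<le> g n x / real n" "g n x / real n \<le> c + 4 * (1 / real (Suc j))"
          by (simp_all add: pos_le_divide_eq pos_divide_le_eq)
        then show ?case using j e by (auto simp: dist_real_def abs_if)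
      qed
    qed
  qed
  then show ?thesis by (rule that)
qed

end

section \<open>Words, axes and weights\<close>

lemma two_add_one_cases [simp]: "(z::2) + 1 + 1 = z"
proof -
  have "z = 1 \<or> z = 2" using exhaust_2 by blast
  then show ?thesis by auto
qed

lemma two_neq_succ [simp]: "(z::2) + 1 \<noteq> z" "z \<noteq> z + 1"
  by simp_all

lemma two_cases: "y = z \<or> y = z + 1" for y z :: 2
proof -
  have "z = 1 \<or> z = 2" "y = 1 \<or> y = 2" using exhaust_2 by blast+
  then show ?thesis by auto
qed

lemma initial_word_0 [simp]: "initial_word \<omega> 0 = []"
  by (simp add: initial_word_def)

lemma initial_word_Suc: "initial_word \<omega> (Suc n) = initial_word \<omega> n @ [\<omega> n]"
  by (simp add: initial_word_def)

lemma length_initial_word [simp]: "length (initial_word \<omega> n) = n"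
  by (simp add: initial_word_def)

lemma initial_word_add: "initial_word \<omega> (n + k) = initial_word \<omega> n @ initial_word (\<lambda>j. \<omega> (j + n)) k"
  by (induction k) (auto simp: initial_word_Suc add.commute)

lemma initial_word_eq_iff: "initial_word \<omega> n = initial_word \<tau> n \<longleftrightarrow> (\<forall>k<n. \<omega> k = \<tau> k)"
  by (auto simp: initial_word_def)

lemma first_difference:
  assumes "initial_word \<tau> j = initial_word \<omega> j" "initial_word \<tau> n \<noteq> initial_word \<omega> n" 
  obtains k where "j \<le> k" "k < n" "initial_word \<tau> k = initial_word \<omega> k" "\<tau> k \<noteq> \<omega> k"
proof -
  define k where "k = (LEAST k. \<tau> k \<noteq> \<omega> k)"
  obtain i where i: "i < n" "\<tau> i \<noteq> \<omega> i" using assms(2) by (auto simp: initial_word_eq_iff)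
  have k: "\<tau> k \<noteq> \<omega> k" unfolding k_def using i(2) by (rule LeastI)
  have "k \<le> i" unfolding k_def using i(2) by (rule Least_le)
  moreover have "\<tau> p = \<omega> p" if "p < k" for p using not_less_Least[of p "\<lambda>k. \<tau> k \<noteq> \<omega> k"] that by (auto simp: k_def)
  moreover have "j \<le> k" using k assms(1) by (auto simp: initial_word_eq_iff not_less[symmetric])
  ultimately show ?thesis using that[of k] k i(1) by (auto simp: initial_word_eq_iff)
qed

lemma initial_word_in_words: "\<omega> \<in> symbol_seqs d \<Longrightarrow> initial_word \<omega> n \<in> words d n"
  by (auto simp: initial_word_def words_def symbol_seqs_def)

lemma symbol_seqs_nth: "\<omega> \<in> symbol_seqs d \<Longrightarrow> \<omega> n \<in> {1..d}"
  by (fastforce simp: symbol_seqs_def)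

lemma symbol_seqs_shift: "\<omega> \<in> symbol_seqs d \<Longrightarrow> (\<lambda>k. \<omega> (k + n)) \<in> symbol_seqs d"
  by (fastforce simp: symbol_seqs_def)

lemma finite_words: "finite (words d n)"
proof -
  have "words d n = {w. set w \<subseteq> {1..d} \<and> length w = n}" by (auto simp: words_def)
  then show ?thesis by (simp add: finite_lists_length_eq)
qed

locale box_ifs =
  fixes d l :: nat and a b :: "nat \<Rightarrow> real"
  assumes l_gt_1: "1 < l" and l_le_d: "l \<le> d"
    and entries: "\<forall>i\<in>{1..d}. 0 < a i \<and> a i < 1 \<and> 0 < b i \<and> b i < 1"
begin

abbreviation A :: "nat \<Rightarrow> real^2^2" where "A \<equiv> ifs_matrix l a b"

definition entry :: "nat \<Rightarrow> 2 \<Rightarrow> real" where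
  "entry i z = (if z = 1 then a i else b i)"

definition turn :: "nat \<Rightarrow> 2 \<Rightarrow> 2" where
  "turn i z = (if i < l then z else z + 1)"

text \<open>Row \<open>z\<close> of the matrix of a word has a single non-zero entry: it is \<open>weight w z\<close>, in column
\<open>end_axis w z\<close>.  The axis is followed through the word letter by letter, and letters from \<open>l\<close> on
exchange the axes.\<close>

fun weight :: "nat list \<Rightarrow> 2 \<Rightarrow> real" where
  "weight [] z = 1"
| "weight (i # w) z = entry i z * weight w (turn i z)"

fun end_axis :: "nat list \<Rightarrow> 2 \<Rightarrow> 2" where
  "end_axis [] z = z"
| "end_axis (i # w) z = end_axis w (turn i z)"

lemma turn_succ: "turn i (z + 1) = turn i z + 1"
  by (simp add: turn_def)

lemma end_axis_succ: "end_axis w (z + 1) = end_axis w z + 1"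
  by (induction w arbitrary: z) (auto simp: turn_succ)

lemma end_axis_inj: "end_axis w y = end_axis w z \<longleftrightarrow> y = z"
  using two_cases[of y z] by (auto simp: end_axis_succ)

lemma end_axis_append: "end_axis (u @ w) z = end_axis w (end_axis u z)"
  by (induction u arbitrary: z) auto

lemma weight_append: "weight (u @ w) z = weight u z * weight w (end_axis u z)"
  by (induction u arbitrary: z) auto

lemma matrix_component: "(A i *v x) $ z = entry i z * x $ turn i z"
proof -
  have "z = 1 \<or> z = 2" using exhaust_2 by blast
  moreover have "x $ 3 = x $ 1" by (rule arg_cong[of _ _ "($) x"]) simp
  ultimately show ?thesis
    by (auto simp: ifs_matrix_def entry_def turn_def matrix_vector_mult_def sum_2)
qed

lemma word_matrix_component: "(word_matrix A w *v x) $ z = weight w z * x $ end_axis w z"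
proof (induction w arbitrary: z)
  case (Cons i w)
  have "word_matrix A (i # w) *v x = A i *v (word_matrix A w *v x)"
    by (simp add: word_matrix_def matrix_vector_mul_assoc)
  then show ?case by (simp add: matrix_component Cons)
qed (simp add: word_matrix_def)

lemma entry_bounds: "i \<in> {1..d} \<Longrightarrow> 0 < entry i z \<and> entry i z < 1"
  using entries by (auto simp: entry_def)

definition \<theta> :: real where
  "\<theta> = Max ((\<lambda>(i, z). entry i z) ` ({1..d} \<times> UNIV))"

definition \<theta>' :: real where
  "\<theta>' = Min ((\<lambda>(i, z). entry i z) ` ({1..d} \<times> UNIV))"

lemma d_ge_2: "2 \<le> d"
  using l_gt_1 l_le_d by linarith

lemma entry_range:
  shows "finite ((\<lambda>(i, z). entry i z) ` ({1..d} \<times> (UNIV :: 2 set)))"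
    and "(\<lambda>(i, z). entry i z) ` ({1..d} \<times> (UNIV :: 2 set)) \<noteq> {}"
  using d_ge_2 by auto

lemma entry_le_\<theta>: "i \<in> {1..d} \<Longrightarrow> entry i z \<le> \<theta>"
  unfolding \<theta>_def using entry_range(1) by (intro Max_ge) auto

lemma entry_ge_\<theta>': "i \<in> {1..d} \<Longrightarrow> \<theta>' \<le> entry i z"
  unfolding \<theta>'_def using entry_range(1) by (intro Min_le) auto

lemma \<theta>_less_1: "\<theta> < 1"
  unfolding \<theta>_def using entry_range entry_bounds by (subst Max_less_iff) auto

lemma \<theta>'_pos: "0 < \<theta>'"
  unfolding \<theta>'_def using entry_range entry_bounds by (subst Min_gr_iff) auto

lemma \<theta>_pos: "0 < \<theta>"
  using entry_le_\<theta>[of 1 1] entry_bounds[of 1 1] d_ge_2 by auto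

lemma weight_pos: "set w \<subseteq> {1..d} \<Longrightarrow> 0 < weight w z"
  by (induction w arbitrary: z) (auto simp: entry_bounds)

lemma weight_le: "set w \<subseteq> {1..d} \<Longrightarrow> weight w z \<le> \<theta> ^ length w"
proof (induction w arbitrary: z)
  case (Cons i w)
  then show ?case using entry_le_\<theta>[of i z] \<theta>_pos weight_pos[of w "turn i z"]
    by (auto intro!: mult_mono)
qed auto

lemma weight_ge: "set w \<subseteq> {1..d} \<Longrightarrow> \<theta>' ^ length w \<le> weight w z"
proof (induction w arbitrary: z)
  case (Cons i w)
  then show ?case using entry_ge_\<theta>'[of i z] entry_bounds[of i z] \<theta>'_pos
    by (auto intro!: mult_mono)
qed auto

lemma weight_le_1: "set w \<subseteq> {1..d} \<Longrightarrow> weight w z \<le> 1"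
  using weight_le[of w z] power_le_one[of \<theta> "length w"] \<theta>_pos \<theta>_less_1 by simp

lemma set_initial_word: "\<omega> \<in> symbol_seqs d \<Longrightarrow> set (initial_word \<omega> n) \<subseteq> {1..d}"
  by (auto simp: initial_word_def symbol_seqs_def)

text \<open>The Gram matrix of a word is diagonal with the squared weights as entries, so the singular values
are the weights.\<close>

lemma gram_component:
  "((transpose (word_matrix A w) ** word_matrix A w) *v v) $ end_axis w z
     = (weight w z)\<^sup>2 * v $ end_axis w z"
proof -
  let ?M = "word_matrix A w"
  have M: "?M $ j $ k = (if k = end_axis w j then weight w j else 0)" for j k
  proof -
    have "?M *v axis k 1 = column k ?M" by (rule matrix_vector_mult_basis)
    then have "?M $ j $ k = (?M *v axis k 1) $ j" by (simp only: column_def vec_lambda_beta)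
    also have "\<dots> = weight w j * axis k 1 $ end_axis w j" by (rule word_matrix_component)
    finally show ?thesis by (auto simp: axis_def)
  qed
  have "((transpose ?M ** ?M) *v v) $ end_axis w z = (\<Sum>j\<in>UNIV. ?M $ j $ end_axis w z * (?M *v v) $ j)"
  proof -
    have "(transpose ?M *v y) $ end_axis w z = (\<Sum>j\<in>UNIV. ?M $ j $ end_axis w z * y $ j)" for y
      by (simp add: matrix_vector_mult_def transpose_def)
    from this[of "?M *v v"] show ?thesis by (simp only: matrix_vector_mul_assoc)
  qed
  also have "\<dots> = (\<Sum>j\<in>UNIV. if j = z then weight w z * (?M *v v) $ z else 0)"
    by (intro sum.cong) (auto simp: M end_axis_inj)
  also have "\<dots> = weight w z * (?M *v v) $ z" by simp
  finally show ?thesis by (simp add: word_matrix_component power2_eq_square)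
qed

lemma singular_values_word:
  assumes w: "set w \<subseteq> {1..d}"
  shows "singular_values (word_matrix A w) = range (weight w)"
proof (intro set_eqI iffI)
  fix s assume "s \<in> singular_values (word_matrix A w)"
  then obtain e v where s: "s = sqrt e" and v: "v \<noteq> 0"
    and ev: "(transpose (word_matrix A w) ** word_matrix A w) *v v = e *\<^sub>R v"
    unfolding singular_values_def by blast
  from v obtain k where k: "v $ k \<noteq> 0" by (auto simp: vec_eq_iff)
  obtain z where z: "end_axis w z = k"
    using two_cases[of k "end_axis w 1"] end_axis_succ[of w 1] by metis
  have "e * v $ k = (weight w z)\<^sup>2 * v $ k"
    using gram_component[of w v z] unfolding ev z by (simp only: vector_scaleR_component real_scaleR_def)
  then have "e = (weight w z)\<^sup>2" using k by simp
  then show "s \<in> range (weight w)" using weight_pos[OF w, of z] s by (auto simp: real_sqrt_unique)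
next
  fix s assume "s \<in> range (weight w)"
  then obtain z where s: "s = weight w z" by auto
  define v :: "real^2" where "v = axis (end_axis w z) 1"
  have "((transpose (word_matrix A w) ** word_matrix A w) *v v) $ k = ((weight w z)\<^sup>2 *\<^sub>R v) $ k" for k
  proof -
    obtain y where y: "k = end_axis w y"
      using two_cases[of k "end_axis w 1"] end_axis_succ[of w 1] by metis
    show ?thesis unfolding y gram_component by (auto simp: v_def axis_def end_axis_inj)
  qed
  then have "(transpose (word_matrix A w) ** word_matrix A w) *v v = (weight w z)\<^sup>2 *\<^sub>R v"
    by (simp add: vec_eq_iff)
  moreover have "v \<noteq> 0" by (simp add: v_def axis_eq_0_iff)
  moreover have "s = sqrt ((weight w z)\<^sup>2)" using weight_pos[OF w, of z] s by simp
  ultimately show "s \<in> singular_values (word_matrix A w)"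
    unfolding singular_values_def by blast
qed

lemma range_weight: "range (weight w) = {weight w z, weight w (z + 1)}"
proof -
  have "UNIV = {z, z + 1}" using two_cases[of _ z] by blast
  then show ?thesis by (metis image_empty image_insert)
qed

lemma alpha1_eq: "set w \<subseteq> {1..d} \<Longrightarrow> alpha1 A w = max (weight w z) (weight w (z + 1))"
  by (simp add: alpha1_def singular_values_word range_weight[of w z])

lemma alpha2_eq: "set w \<subseteq> {1..d} \<Longrightarrow> alpha2 A w = min (weight w z) (weight w (z + 1))"
  by (simp add: alpha2_def singular_values_word range_weight[of w z])

lemma weight_le_alpha1: "set w \<subseteq> {1..d} \<Longrightarrow> weight w z \<le> alpha1 A w"
  by (simp add: alpha1_eq[of w z])

lemma alpha2_le_weight: "set w \<subseteq> {1..d} \<Longrightarrow> alpha2 A w \<le> weight w z"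
  by (simp add: alpha2_eq[of w z])

lemma alpha2_le_alpha1: "set w \<subseteq> {1..d} \<Longrightarrow> alpha2 A w \<le> alpha1 A w"
  by (simp add: alpha1_eq[of w 1] alpha2_eq[of w 1])

lemma alpha2_pos: "set w \<subseteq> {1..d} \<Longrightarrow> 0 < alpha2 A w"
  by (simp add: alpha2_eq[of w 1] weight_pos)

lemma alpha1_pos: "set w \<subseteq> {1..d} \<Longrightarrow> 0 < alpha1 A w"
  using alpha2_pos alpha2_le_alpha1 by fastforce

lemma alpha1_le: "set w \<subseteq> {1..d} \<Longrightarrow> alpha1 A w \<le> \<theta> ^ length w"
  by (simp add: alpha1_eq[of w 1] weight_le)

lemma alpha2_ge: "set w \<subseteq> {1..d} \<Longrightarrow> \<theta>' ^ length w \<le> alpha2 A w"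
  by (simp add: alpha2_eq[of w 1] weight_ge)

lemma alpha1_append: 
  assumes "set u \<subseteq> {1..d}" "set w \<subseteq> {1..d}"
  shows "alpha1 A (u @ w) \<le> alpha1 A u * alpha1 A w"
proof -
  have "weight (u @ w) z \<le> alpha1 A u * alpha1 A w" for z
    unfolding weight_append using assms
    by (intro mult_mono weight_le_alpha1 order.strict_implies_order[OF weight_pos]
        order.strict_implies_order[OF alpha1_pos])
  then show ?thesis using alpha1_eq[of "u @ w" 1] assms by simp
qed

lemma alpha2_append_mono:
  assumes "set u \<subseteq> {1..d}" "set w \<subseteq> {1..d}"
  shows "alpha2 A (u @ w) \<le> alpha2 A u"
proof -
  have "alpha2 A (u @ w) \<le> weight u z" for z
  proof -
    have "alpha2 A (u @ w) \<le> weight (u @ w) z" using assms by (intro alpha2_le_weight) auto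
    also have "\<dots> \<le> weight u z"
      unfolding weight_append using assms
      by (intro mult_left_le weight_le_1 order.strict_implies_order[OF weight_pos])
    finally show ?thesis .
  qed
  then show ?thesis using alpha2_eq[OF assms(1), of 1] by simp
qed

lemma alpha_product: 
  assumes "set u \<subseteq> {1..d}" "set w \<subseteq> {1..d}"
  shows "alpha1 A (u @ w) * alpha2 A (u @ w) = (alpha1 A u * alpha2 A u) * (alpha1 A w * alpha2 A w)"
proof -
  have *: "alpha1 A v * alpha2 A v = weight v z * weight v (z + 1)" if "set v \<subseteq> {1..d}" for v z
    using that by (simp add: alpha1_eq[of v z] alpha2_eq[of v z] max_def min_def)
  show ?thesis using assms
    by (simp add: *[of "u @ w" 1] *[of u 1] *[of w "end_axis u 1"] weight_append end_axis_succ[of u 1, simplified])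
qed

abbreviation wt :: "(nat \<Rightarrow> nat) \<Rightarrow> 2 \<Rightarrow> nat \<Rightarrow> real" where
  "wt \<omega> z k \<equiv> weight (initial_word \<omega> k) z"

abbreviation ax :: "(nat \<Rightarrow> nat) \<Rightarrow> 2 \<Rightarrow> nat \<Rightarrow> 2" where
  "ax \<omega> z k \<equiv> end_axis (initial_word \<omega> k) z"

abbreviation \<alpha>1 :: "(nat \<Rightarrow> nat) \<Rightarrow> nat \<Rightarrow> real" where
  "\<alpha>1 \<omega> k \<equiv> alpha1 A (initial_word \<omega> k)"

abbreviation \<alpha>2 :: "(nat \<Rightarrow> nat) \<Rightarrow> nat \<Rightarrow> real" where
  "\<alpha>2 \<omega> k \<equiv> alpha2 A (initial_word \<omega> k)"

lemma wt_pos: "\<omega> \<in> symbol_seqs d \<Longrightarrow> 0 < wt \<omega> z k"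
  by (intro weight_pos set_initial_word)

section \<open>The coding map\<close>

text \<open>The coordinate \<open>z\<close> of the coding map is a series that is linear in the translations: the \<open>k\<close>-th
letter contributes the component of its translation along the axis that has been reached, scaled by the weight
of the prefix.\<close>

definition code_term :: "(nat \<Rightarrow> real^2) \<Rightarrow> (nat \<Rightarrow> nat) \<Rightarrow> 2 \<Rightarrow> nat \<Rightarrow> real" where
  "code_term t \<omega> z k = wt \<omega> z k * t (\<omega> k) $ ax \<omega> z k"

definition code :: "(nat \<Rightarrow> real^2) \<Rightarrow> (nat \<Rightarrow> nat) \<Rightarrow> 2 \<Rightarrow> real" where
  "code t \<omega> z = (\<Sum>k. code_term t \<omega> z k)"

lemma word_map_Nil: "word_map A t [] x = x" and
  word_map_Cons: "word_map A t (i # w) x = A i *v word_map A t w x + t i"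
  by (simp_all add: word_map_def ifs_map_def)

lemma word_map_append: "word_map A t (u @ w) x = word_map A t u (word_map A t w x)"
  by (induction u) (auto simp: word_map_Nil word_map_Cons)

lemma word_map_component: "word_map A t w x $ z = weight w z * x $ end_axis w z + word_map A t w 0 $ z"
  by (induction w arbitrary: z) (auto simp: word_map_Nil word_map_Cons matrix_component algebra_simps)

lemma word_map_initial: "word_map A t (initial_word \<omega> n) 0 $ z = (\<Sum>k<n. code_term t \<omega> z k)"
proof (induction n)
  case (Suc n)
  have "word_map A t [\<omega> n] 0 = t (\<omega> n)" by (simp add: word_map_Nil word_map_Cons)
  then have "word_map A t (initial_word \<omega> (Suc n)) 0 $ z
      = word_map A t (initial_word \<omega> n) (t (\<omega> n)) $ z"
    by (simp add: initial_word_Suc word_map_append)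
  then show ?case using Suc word_map_component[of t "initial_word \<omega> n" "t (\<omega> n)" z]
    by (simp add: code_term_def)
qed (simp add: word_map_Nil)

lemma summable_weighted:
  assumes \<omega>: "\<omega> \<in> symbol_seqs d" and f: "\<And>k. \<bar>f k\<bar> \<le> R"
  shows "summable (\<lambda>k. wt \<omega> z k * f k)"
    and "\<bar>\<Sum>k. wt \<omega> z k * f k\<bar> \<le> R / (1 - \<theta>)"
proof -
  have R: "0 \<le> R" using f[of 0] by linarith
  have le: "norm (wt \<omega> z k * f k) \<le> R * \<theta> ^ k" for k
    using f[of k] weight_le[OF set_initial_word[OF \<omega>], of k z] wt_pos[OF \<omega>, of k z] R
    unfolding real_norm_def abs_mult by (subst mult.commute) (intro mult_mono, auto)
  have geo: "(\<lambda>k. R * \<theta> ^ k) sums (R * (1 / (1 - \<theta>)))"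
    using \<theta>_pos \<theta>_less_1 by (intro sums_mult geometric_sums) auto
  have sn: "summable (\<lambda>k. norm (wt \<omega> z k * f k))"
    using le by (intro summable_comparison_test'[OF sums_summable[OF geo], of 0]) simp
  then show "summable (\<lambda>k. wt \<omega> z k * f k)" by (rule summable_norm_cancel)
  have "\<bar>\<Sum>k. wt \<omega> z k * f k\<bar> \<le> (\<Sum>k. norm (wt \<omega> z k * f k))"
    using summable_norm[OF sn] by simp
  also have "\<dots> \<le> (\<Sum>k. R * \<theta> ^ k)" by (rule suminf_le[OF le sn sums_summable[OF geo]])
  finally show "\<bar>\<Sum>k. wt \<omega> z k * f k\<bar> \<le> R / (1 - \<theta>)" using sums_unique[OF geo] by simp
qed

definition trans_bound :: "(nat \<Rightarrow> real^2) \<Rightarrow> real" where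
  "trans_bound t = (\<Sum>i\<in>{1..d}. norm (t i))"

lemma trans_bound: "i \<in> {1..d} \<Longrightarrow> \<bar>t i $ z\<bar> \<le> trans_bound t"
proof -
  assume i: "i \<in> {1..d}"
  have "norm (t i) \<le> trans_bound t" unfolding trans_bound_def using i by (intro member_le_sum) auto
  then show ?thesis using component_le_norm_cart[of "t i" z] by linarith
qed

lemma code_term_summable: 
  assumes "\<omega> \<in> symbol_seqs d" shows "summable (code_term t \<omega> z)"
  unfolding code_term_def[abs_def]
  by (rule summable_weighted(1)[OF assms, of "\<lambda>k. t (\<omega> k) $ ax \<omega> z k" "trans_bound t"])
    (rule trans_bound[OF symbol_seqs_nth[OF assms]])

lemma code_bound:
  assumes "\<omega> \<in> symbol_seqs d" shows "\<bar>code t \<omega> z\<bar> \<le> trans_bound t / (1 - \<theta>)"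
  unfolding code_def code_term_def[abs_def]
  by (rule summable_weighted(2)[OF assms, of "\<lambda>k. t (\<omega> k) $ ax \<omega> z k" "trans_bound t"])
    (rule trans_bound[OF symbol_seqs_nth[OF assms]])

lemma word_map_initial_tendsto:
  assumes "\<omega> \<in> symbol_seqs d"
  shows "(\<lambda>n. word_map A t (initial_word \<omega> n) 0) \<longlonglongrightarrow> coding_map A t \<omega>"
proof -
  have *: "(\<lambda>n. word_map A t (initial_word \<omega> n) 0) \<longlonglongrightarrow> (\<chi> z. code t \<omega> z)"
    using code_term_summable[OF assms]
    by (intro vec_tendstoI) (simp add: word_map_initial code_def summable_LIMSEQ)
  then have "lim (\<lambda>n. word_map A t (initial_word \<omega> n) 0) = (\<chi> z. code t \<omega> z)" by (rule limI)
  with * show ?thesis unfolding coding_map_def by simp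
qed

lemma coding_map_component:
  assumes "\<omega> \<in> symbol_seqs d" shows "coding_map A t \<omega> $ z = code t \<omega> z"
proof (rule LIMSEQ_unique)
  show "(\<lambda>n. word_map A t (initial_word \<omega> n) 0 $ z) \<longlonglongrightarrow> coding_map A t \<omega> $ z"
    by (intro tendsto_vec_nth word_map_initial_tendsto assms)
  show "(\<lambda>n. word_map A t (initial_word \<omega> n) 0 $ z) \<longlonglongrightarrow> code t \<omega> z"
    using code_term_summable[OF assms] by (simp add: word_map_initial code_def summable_LIMSEQ)
qed

lemma coding_map_shift:
  assumes "\<omega> \<in> symbol_seqs d"
  shows "coding_map A t \<omega> = word_map A t (initial_word \<omega> n) (coding_map A t (\<lambda>k. \<omega> (k + n)))"
proof -
  have "code t \<omega> z = word_map A t (initial_word \<omega> n) (coding_map A t (\<lambda>k. \<omega> (k + n))) $ z" for z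
  proof -
    have "code t \<omega> z = (\<Sum>k. code_term t \<omega> z (k + n)) + word_map A t (initial_word \<omega> n) 0 $ z"
      unfolding code_def word_map_initial by (rule suminf_split_initial_segment[OF code_term_summable[OF assms]])
    also have "(\<Sum>k. code_term t \<omega> z (k + n))
        = (\<Sum>k. wt \<omega> z n * code_term t (\<lambda>k. \<omega> (k + n)) (ax \<omega> z n) k)"
      by (intro suminf_cong)
        (simp add: code_term_def add.commute[of _ n] initial_word_add weight_append end_axis_append mult_ac)
    also have "\<dots> = wt \<omega> z n * code t (\<lambda>k. \<omega> (k + n)) (ax \<omega> z n)"
      unfolding code_def by (rule suminf_mult[OF code_term_summable[OF symbol_seqs_shift[OF assms]]])
    finally show ?thesis
      by (subst word_map_component) (simp add: coding_map_component[OF symbol_seqs_shift[OF assms]])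
  qed
  then show ?thesis using assms by (simp add: vec_eq_iff coding_map_component)
qed

text \<open>A common prefix can be factored out of the difference of two codes.\<close>

lemma code_diff:
  assumes "\<omega> \<in> symbol_seqs d" "\<tau> \<in> symbol_seqs d" and eq: "initial_word \<omega> n = initial_word \<tau> n"
  shows "code t \<omega> z - code t \<tau> z = wt \<omega> z n *
    (code t (\<lambda>k. \<omega> (k + n)) (ax \<omega> z n) - code t (\<lambda>k. \<tau> (k + n)) (ax \<omega> z n))"
proof -
  have *: "code t \<omega> z = wt \<omega> z n * code t (\<lambda>k. \<omega> (k + n)) (ax \<omega> z n)
     + word_map A t (initial_word \<omega> n) 0 $ z" if "\<omega> \<in> symbol_seqs d" for \<omega>
  proof -
    have "code t \<omega> z = word_map A t (initial_word \<omega> n) (coding_map A t (\<lambda>k. \<omega> (k + n))) $ z"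
      using coding_map_component[OF that, of t z] coding_map_shift[OF that, of t n] by metis
    then show ?thesis
      by (subst (asm) word_map_component) (simp add: coding_map_component[OF symbol_seqs_shift[OF that]])
  qed
  show ?thesis using *[OF assms(1)] *[OF assms(2)] eq by (simp add: algebra_simps)
qed

lemma code_diff_le:
  assumes "\<omega> \<in> symbol_seqs d" "\<tau> \<in> symbol_seqs d" and eq: "initial_word \<omega> n = initial_word \<tau> n"
  shows "\<bar>code t \<omega> z - code t \<tau> z\<bar> \<le> wt \<omega> z n * (2 * trans_bound t / (1 - \<theta>))"
proof -
  let ?e = "ax \<omega> z n"
  have "\<bar>code t (\<lambda>k. \<omega> (k + n)) ?e - code t (\<lambda>k. \<tau> (k + n)) ?e\<bar> \<le> 2 * trans_bound t / (1 - \<theta>)"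
    using code_bound[OF symbol_seqs_shift[OF assms(1)], of t n ?e]
      code_bound[OF symbol_seqs_shift[OF assms(2)], of t n ?e] by linarith
  then show ?thesis unfolding code_diff[OF assms] abs_mult
    using wt_pos[OF assms(1), of n z] by (intro mult_mono) auto
qed

section \<open>Transversality of the coordinates of the coding map\<close>

text \<open>An excursion from the axis \<open>z\<close> to the other one begins and ends with an exchanging letter;
\<open>max_return z\<close> is the largest factor that its last letter can contribute.  Hence between two consecutive
visits of the axis \<open>z\<close> the weight shrinks at least by the factor \<open>return_rate i z\<close>, where \<open>i\<close> is the
letter that follows the first visit.\<close>

definition max_return :: "2 \<Rightarrow> real" where
  "max_return z = (if z = 1 then Max (b ` {l..d}) else Max (a ` {l..d}))"

definition return_rate :: "nat \<Rightarrow> 2 \<Rightarrow> real" where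
  "return_rate i z = (if z = 1 then u_num d l a b i else v_num d l a b i)"

lemma max_return_ge: "i \<in> {1..d} \<Longrightarrow> \<not> i < l \<Longrightarrow> entry i (z + 1) \<le> max_return z"
  using two_cases[of z 1] by (auto simp: max_return_def entry_def)

lemma max_return_bounds: "0 < max_return z \<and> max_return z < 1"
proof -
  have *: "0 < Max (f ` {l..d}) \<and> Max (f ` {l..d}) < 1" if "\<forall>i\<in>{1..d}. 0 < f i \<and> f i < 1" for f :: "nat \<Rightarrow> real"
  proof -
    have "Max (f ` {l..d}) \<in> f ` {l..d}" using l_le_d by (intro Max_in) auto
    then obtain i where "i \<in> {l..d}" "Max (f ` {l..d}) = f i" by blast
    then show ?thesis using that l_gt_1 by auto
  qed
  show ?thesis unfolding max_return_def using *[of a] *[of b] entries by presburger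
qed

lemma return_rate_eq: "return_rate i z = (if i < l then entry i z else entry i z * max_return z)"
  by (simp add: return_rate_def u_num_def v_num_def entry_def max_return_def)

lemma return_rate_bounds: "i \<in> {1..d} \<Longrightarrow> 0 < return_rate i z \<and> return_rate i z < 1"
  using entry_bounds[of i z] max_return_bounds[of z] mult_strict_mono[of "entry i z" 1 "max_return z" 1]
  by (auto simp: return_rate_eq)

definition on_axis :: "(nat \<Rightarrow> nat) \<Rightarrow> 2 \<Rightarrow> 2 \<Rightarrow> nat \<Rightarrow> real" where
  "on_axis \<omega> z y k = (if ax \<omega> z k = y then wt \<omega> z k else 0)"

text \<open>The sum telescopes: a visit of weight \<open>x\<close> followed by the letter \<open>i\<close> contributes
\<open>x * (1 - return_rate i z)\<close>, and the next visit has weight at most \<open>x * return_rate i z\<close>.  The last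
summand bounds the weight of the first visit at time \<open>n\<close> or later.\<close>

lemma return_sum_le_1:
  assumes \<omega>: "\<omega> \<in> symbol_seqs d"
  shows "(\<Sum>k<n. on_axis \<omega> z z k * (1 - return_rate (\<omega> k) z))
    + wt \<omega> z n * (if ax \<omega> z n = z then 1 else max_return z) \<le> 1"
proof (induction n)
  case (Suc n)
  let ?w = "wt \<omega> z n" and ?e = "ax \<omega> z n"
  have w: "0 < ?w" by (rule wt_pos[OF \<omega>])
  have i: "\<omega> n \<in> {1..d}" by (rule symbol_seqs_nth[OF \<omega>])
  have "on_axis \<omega> z z n * (1 - return_rate (\<omega> n) z)
     + wt \<omega> z (Suc n) * (if ax \<omega> z (Suc n) = z then 1 else max_return z)
     \<le> ?w * (if ?e = z then 1 else max_return z)"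
  proof (cases "?e = z")
    case True
    then show ?thesis
      by (auto simp: on_axis_def initial_word_Suc weight_append end_axis_append turn_def return_rate_eq algebra_simps)
  next
    case False
    then have e: "?e = z + 1" using two_cases by blast
    have "entry (\<omega> n) (z + 1) * (if \<omega> n < l then max_return z else 1) \<le> max_return z"
      using max_return_ge[OF i, of z] max_return_bounds[of z] entry_bounds[OF i, of "z + 1"]
        mult_left_le_one_le[of "max_return z" "entry (\<omega> n) (z + 1)"]
      by auto
    then have "?w * (entry (\<omega> n) (z + 1) * (if \<omega> n < l then max_return z else 1)) \<le> ?w * max_return z"
      using w by (intro mult_left_mono) auto
    then show ?thesis using e
      by (auto simp: on_axis_def initial_word_Suc weight_append end_axis_append turn_def mult_ac split: if_splits)
  qed
  with Suc show ?case by simp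
qed simp

text \<open>The coefficient of the translation component \<open>t j $ y\<close> in \<open>code t \<omega> z\<close>.\<close>

definition visits :: "(nat \<Rightarrow> nat) \<Rightarrow> 2 \<Rightarrow> 2 \<Rightarrow> nat \<Rightarrow> real" where
  "visits \<omega> z y j = (\<Sum>k. if \<omega> k = j then on_axis \<omega> z y k else 0)"

lemma visits_summable:
  assumes "\<omega> \<in> symbol_seqs d"
  shows "summable (\<lambda>k. if \<omega> k = j then on_axis \<omega> z y k else 0)"
proof -
  have "(\<lambda>k. if \<omega> k = j then on_axis \<omega> z y k else 0)
    = (\<lambda>k. wt \<omega> z k * (if \<omega> k = j \<and> ax \<omega> z k = y then 1 else 0))"
    by (auto simp: on_axis_def fun_eq_iff)
  then show ?thesis using summable_weighted(1)[OF assms, of "\<lambda>k. if \<omega> k = j \<and> ax \<omega> z k = y then 1 else 0" 1]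
    by auto
qed

lemma on_axis_nonneg: "\<omega> \<in> symbol_seqs d \<Longrightarrow> 0 \<le> on_axis \<omega> z y k"
  using weight_pos[OF set_initial_word] by (auto simp: on_axis_def less_imp_le)

lemma visits_first:
  assumes \<omega>: "\<omega> \<in> symbol_seqs d" shows "1 \<le> visits \<omega> z z (\<omega> 0)"
proof -
  have "(\<Sum>k<1. if \<omega> k = \<omega> 0 then on_axis \<omega> z z k else 0) \<le> visits \<omega> z z (\<omega> 0)"
    unfolding visits_def using on_axis_nonneg[OF \<omega>]
    by (intro sum_le_suminf visits_summable[OF \<omega>]) auto
  then show ?thesis by (simp add: on_axis_def)
qed

text \<open>The visits followed by the letter \<open>j\<close> have to share the total mass \<open>1\<close> of the telescoping sum with
the visit at time \<open>0\<close>, which is followed by another letter.\<close>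

lemma visits_other:
  assumes \<omega>: "\<omega> \<in> symbol_seqs d" and j: "j \<in> {1..d}" "j \<noteq> \<omega> 0"
  shows "visits \<omega> z z j * (1 - return_rate j z) \<le> return_rate (\<omega> 0) z"
proof -
  have rj: "0 < 1 - return_rate j z" using return_rate_bounds[OF j(1), of z] by simp
  have "(\<Sum>k<n. if \<omega> k = j then on_axis \<omega> z z k else 0) \<le> return_rate (\<omega> 0) z / (1 - return_rate j z)" for n
  proof (cases n)
    case 0
    then show ?thesis using rj return_rate_bounds[OF symbol_seqs_nth[OF \<omega>], of 0 z] by (simp add: divide_nonneg_pos)
  next
    case (Suc k')
    then have "n > 0" by simp
    have "(\<Sum>k<n. if \<omega> k = j then on_axis \<omega> z z k else 0) * (1 - return_rate j z) + (1 - return_rate (\<omega> 0) z)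
      = (\<Sum>k<n. (if \<omega> k = j then on_axis \<omega> z z k else 0) * (1 - return_rate j z)
           + (if k = 0 then 1 - return_rate (\<omega> 0) z else 0))"
      using \<open>n > 0\<close> by (simp add: sum.distrib sum_distrib_right del: sum.lessThan_Suc)
    also have "\<dots> \<le> (\<Sum>k<n. on_axis \<omega> z z k * (1 - return_rate (\<omega> k) z))"
    proof (rule sum_mono)
      fix k
      have "return_rate (\<omega> k) z < 1" using return_rate_bounds[OF symbol_seqs_nth[OF \<omega>], of k z] by simp
      then show "(if \<omega> k = j then on_axis \<omega> z z k else 0) * (1 - return_rate j z)
           + (if k = 0 then 1 - return_rate (\<omega> 0) z else 0) \<le> on_axis \<omega> z z k * (1 - return_rate (\<omega> k) z)"
        using j(2) on_axis_nonneg[OF \<omega>, of z z k] by (auto simp: on_axis_def)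
    qed
    also have "\<dots> \<le> 1"
    proof -
      have "0 \<le> wt \<omega> z n * (if ax \<omega> z n = z then 1 else max_return z)"
        using wt_pos[OF \<omega>, of n z] max_return_bounds[of z] by auto
      then show ?thesis using return_sum_le_1[OF \<omega>, where n = n and z = z] by linarith
    qed
    finally show ?thesis using rj by (simp add: field_simps)
  qed
  then have "visits \<omega> z z j \<le> return_rate (\<omega> 0) z / (1 - return_rate j z)"
    unfolding visits_def by (intro suminf_le_const visits_summable[OF \<omega>])
  then show ?thesis using rj by (simp add: field_simps)
qed

lemma code_affine:
  assumes \<omega>: "\<omega> \<in> symbol_seqs d"
  shows "code (t(j := v)) \<omega> z = code (t(j := 0)) \<omega> z + visits \<omega> z z j * v $ z + visits \<omega> z (z + 1) j * v $ (z + 1)"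
proof -
  have "code_term (t(j := v)) \<omega> z k = code_term (t(j := 0)) \<omega> z k
     + (if \<omega> k = j then on_axis \<omega> z z k else 0) * v $ z
     + (if \<omega> k = j then on_axis \<omega> z (z + 1) k else 0) * v $ (z + 1)" for k
    using two_cases[of "ax \<omega> z k" z] by (auto simp: code_term_def on_axis_def)
  moreover have "code_term (t(j := 0)) \<omega> z sums code (t(j := 0)) \<omega> z"
    unfolding code_def by (rule summable_sums[OF code_term_summable[OF \<omega>]])
  moreover have "(\<lambda>k. if \<omega> k = j then on_axis \<omega> z y k else 0) sums visits \<omega> z y j" for y
    unfolding visits_def by (rule summable_sums[OF visits_summable[OF \<omega>]])
  ultimately have "code_term (t(j := v)) \<omega> z sums
      (code (t(j := 0)) \<omega> z + visits \<omega> z z j * v $ z + visits \<omega> z (z + 1) j * v $ (z + 1))"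
    by (subst sums_cong) (auto intro!: sums_add sums_mult2)
  then show ?thesis unfolding code_def[of "t(j := v)"] by (simp add: sums_iff)
qed

end

locale transversal_box_ifs = box_ifs +
  assumes rates: "\<forall>i\<in>{1..d}. \<forall>j\<in>{1..d}. i \<noteq> j \<longrightarrow>
           u_num d l a b i + u_num d l a b j < 1 \<and> v_num d l a b i + v_num d l a b j < 1"
begin

lemma gap_exists: "\<exists>\<eta>>0. \<forall>i\<in>{1..d}. \<forall>j\<in>{1..d}. \<forall>z. i \<noteq> j \<longrightarrow> return_rate i z + return_rate j z \<le> 1 - \<eta>"
proof -
  let ?P = "{(i, j, z :: 2). i \<in> {1..d} \<and> j \<in> {1..d} \<and> i \<noteq> j}"
  let ?f = "\<lambda>(i, j, z). 1 - return_rate i z - return_rate j z"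
  have "?P \<subseteq> {1..d} \<times> {1..d} \<times> UNIV" by auto
  then have fin: "finite ?P" by (rule finite_subset) auto
  have pos: "0 < ?f p" if p_in: "p \<in> ?P" for p
  proof -
    obtain i j z where p: "p = (i, j, z)" "i \<in> {1..d}" "j \<in> {1..d}" "i \<noteq> j" using p_in by auto
    have "u_num d l a b i + u_num d l a b j < 1 \<and> v_num d l a b i + v_num d l a b j < 1"
      using rates p by blast
    then show ?thesis by (simp add: p(1) return_rate_def)
  qed
  define \<eta> where "\<eta> = Min (insert 1 (?f ` ?P))"
  have "\<eta> > 0" unfolding \<eta>_def using fin pos by (subst Min_gr_iff) auto
  moreover have "\<eta> \<le> 1 - return_rate i z - return_rate j z"
    if "i \<in> {1..d}" "j \<in> {1..d}" "i \<noteq> j" for i j z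
    unfolding \<eta>_def using fin that by (intro Min_le) (auto intro!: image_eqI[of _ _ "(i, j, z)"])
  ultimately show ?thesis by (intro exI[of _ \<eta>]) (auto simp: algebra_simps)
qed

definition \<eta> :: real where
  "\<eta> = (SOME \<eta>. \<eta> > 0 \<and> (\<forall>i\<in>{1..d}. \<forall>j\<in>{1..d}. \<forall>z. i \<noteq> j \<longrightarrow> return_rate i z + return_rate j z \<le> 1 - \<eta>))"

lemma \<eta>: "\<eta> > 0"
  "i \<in> {1..d} \<Longrightarrow> j \<in> {1..d} \<Longrightarrow> i \<noteq> j \<Longrightarrow> return_rate i z + return_rate j z \<le> 1 - \<eta>"
  using someI_ex[OF gap_exists] unfolding \<eta>_def by auto

text \<open>For \<open>j = \<tau> 0\<close> the coefficient of \<open>t j $ z\<close> is at least \<open>1\<close> in the code of \<open>\<tau>\<close>, and in the code of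
\<open>\<omega>\<close> it is at most \<open>return_rate (\<omega> 0) z / (1 - return_rate j z)\<close>.  The second number is smaller than
\<open>1\<close> because the two rates have sum less than \<open>1\<close>.\<close>

lemma slope_gap:
  assumes \<omega>: "\<omega> \<in> symbol_seqs d" and \<tau>: "\<tau> \<in> symbol_seqs d" and ne: "\<omega> 0 \<noteq> \<tau> 0"
  shows "\<eta> \<le> visits \<tau> z z (\<tau> 0) - visits \<omega> z z (\<tau> 0)"
proof -
  let ?p = "return_rate (\<tau> 0) z" and ?q = "return_rate (\<omega> 0) z"
  have i: "\<tau> 0 \<in> {1..d}" "\<omega> 0 \<in> {1..d}" using symbol_seqs_nth \<omega> \<tau> by blast+
  have p: "0 < ?p" "?p < 1" using return_rate_bounds[OF i(1)] by auto
  have le: "?p + ?q \<le> 1 - \<eta>" using \<eta>(2)[OF i, of z] ne by simp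
  have "visits \<omega> z z (\<tau> 0) * (1 - ?p) \<le> ?q" using visits_other[OF \<omega> i(1)] ne by metis
  also have "\<dots> \<le> 1 - ?p - \<eta>" using le by simp
  also have "\<dots> \<le> (1 - \<eta>) * (1 - ?p)" using p \<eta>(1) by (simp add: algebra_simps)
  finally have "visits \<omega> z z (\<tau> 0) \<le> 1 - \<eta>" by (rule mult_right_le_imp_le) (use p in simp)
  with visits_first[OF \<tau>, of z] show ?thesis by simp
qed

end

section \<open>Measurability\<close>

lemma coordinate_measurable_borel: "(\<lambda>\<omega>::nat \<Rightarrow> nat. \<omega> n) \<in> measurable borel (count_space UNIV)"
proof -
  have "open ((\<lambda>\<omega>::nat \<Rightarrow> nat. \<omega> n) -` {k})" for k
    by (rule open_vimage[OF Topological_Spaces.open_discrete continuous_on_product_coordinates])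
  then show ?thesis by (subst measurable_count_space_eq2_countable) auto
qed

lemma component_borel_measurable [measurable]: "(\<lambda>v::real^2. v $ z) \<in> borel_measurable borel"
  by (intro borel_measurable_continuous_onI continuous_intros)

locale symbolic_measure = transversal_box_ifs + prob_space m for m :: "(nat \<Rightarrow> nat) measure" +
  assumes sets_m: "sets m = sets (symbol_space d)"
begin

lemma space_m: "space m = symbol_seqs d"
  using sets_eq_imp_space_eq[OF sets_m] by (simp add: symbol_space_def space_restrict_space)

lemma coordinate_measurable [measurable]: "(\<lambda>\<omega>. \<omega> n) \<in> measurable m (count_space UNIV)"
proof -
  have "(\<lambda>\<omega>. \<omega> n) \<in> measurable (symbol_space d) (count_space UNIV)"
    unfolding symbol_space_def by (rule measurable_restrict_space1[OF coordinate_measurable_borel])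
  then show ?thesis by (simp add: measurable_cong_sets[OF sets_m refl])
qed

lemma initial_word_measurable [measurable]: "(\<lambda>\<omega>. initial_word \<omega> n) \<in> measurable m (count_space UNIV)"
proof -
  have "(\<lambda>\<omega>. initial_word \<omega> n) -` {w} \<inter> space m = {\<omega> \<in> space m. length w = n \<and> (\<forall>k\<in>{..<n}. \<omega> k = w ! k)}" for w
    by (fastforce simp: initial_word_def intro: nth_equalityI)
  moreover have "{\<omega> \<in> space m. length w = n \<and> (\<forall>k\<in>{..<n}. \<omega> k = w ! k)} \<in> sets m" for w
    by measurable
  ultimately show ?thesis by (subst measurable_count_space_eq2_countable) auto
qed

lemma cylinder_eq: "cylinder d w = {\<omega> \<in> space m. initial_word \<omega> (length w) = w}"
  by (auto simp: cylinder_def space_m)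

lemma cylinder_sets [measurable]: "cylinder d w \<in> sets m"
  unfolding cylinder_eq by measurable

lemma left_shift_measurable: "left_shift \<in> measurable m m"
proof -
  have "continuous_on UNIV left_shift"
    unfolding left_shift_def
    by (intro continuous_on_coordinatewise_then_product continuous_on_product_coordinates)
  then have "left_shift \<in> borel_measurable borel" by (rule borel_measurable_continuous_onI)
  moreover have "left_shift \<in> symbol_seqs d \<rightarrow> symbol_seqs d"
    by (fastforce simp: left_shift_def symbol_seqs_def)
  ultimately have "left_shift \<in> measurable (symbol_space d) (symbol_space d)"
    unfolding symbol_space_def by (intro measurable_restrict_space3)
  then show ?thesis by (simp add: measurable_cong_sets[OF sets_m sets_m])
qed

abbreviation TM :: "(nat \<Rightarrow> real^2) measure" where "TM \<equiv> translation_measure d"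

lemma space_TM: "space TM = {1..d} \<rightarrow>\<^sub>E UNIV"
  by (simp add: translation_measure_def space_PiM)

lemma translation_measurable: "i \<in> {1..d} \<Longrightarrow> (\<lambda>t. t i $ z) \<in> borel_measurable TM"
proof -
  assume i: "i \<in> {1..d}"
  have "(\<lambda>t. t i) \<in> measurable TM lborel"
    unfolding translation_measure_def by (rule measurable_component_singleton[OF i])
  then have "(\<lambda>t. t i) \<in> borel_measurable TM" by simp
  from measurable_compose[OF this component_borel_measurable] show ?thesis .
qed

text \<open>The code depends on the sequence only through its prefixes, which take countably many values.\<close>

lemma code_measurable [measurable (raw)]:
  assumes f: "f \<in> measurable N TM" and g: "g \<in> measurable N m"
  shows "(\<lambda>x. code (f x) (g x) z) \<in> borel_measurable N"
proof -
  have "(\<lambda>x. code_term (f x) (g x) z k) \<in> borel_measurable N" for k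
  proof -
    have "(\<lambda>x. weight (butlast w) z * f x (last w) $ end_axis (butlast w) z) \<in> borel_measurable N"
      if "w \<in> words d (Suc k)" for w
    proof -
      have "last w \<in> {1..d}" using that last_in_set[of w] by (fastforce simp: words_def)
      from measurable_compose[OF f translation_measurable[OF this]] show ?thesis by measurable
    qed
    moreover have "(\<lambda>x. initial_word (g x) (Suc k)) \<in> measurable N (count_space (words d (Suc k)))"
    proof -
      have "(\<lambda>x. initial_word (g x) (Suc k)) \<in> measurable N (count_space UNIV)"
        by (rule measurable_compose[OF g initial_word_measurable])
      moreover have "initial_word (g x) (Suc k) \<in> words d (Suc k)" if "x \<in> space N" for x
        using measurable_space[OF g that] by (intro initial_word_in_words) (simp add: space_m)
      ultimately show ?thesis
        by (auto simp: measurable_count_space_eq2_countable)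
    qed
    moreover have "countable (words d (Suc k))" by (intro countable_finite finite_words)
    ultimately have "(\<lambda>x. weight (butlast (initial_word (g x) (Suc k))) z *
        f x (last (initial_word (g x) (Suc k))) $ end_axis (butlast (initial_word (g x) (Suc k))) z) \<in> borel_measurable N"
      by (rule measurable_compose_countable'[where f = "\<lambda>w x. weight (butlast w) z * f x (last w) $ end_axis (butlast w) z"])
    then show ?thesis by (simp add: initial_word_Suc code_term_def)
  qed
  then show ?thesis unfolding code_def by (rule borel_measurable_suminf)
qed

lemma coding_map_measurable: 
  assumes "t \<in> space TM" shows "coding_map A t \<in> borel_measurable m"
proof -
  have "(\<lambda>\<omega>. code t \<omega> z) \<in> borel_measurable m" for z
    using assms by (intro code_measurable) auto
  then have "(\<lambda>\<omega>. coding_map A t \<omega> $ z) \<in> borel_measurable m" for z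
    by (rule measurable_cong[THEN iffD1, rotated]) (simp add: coding_map_component space_m)
  then show ?thesis
    by (subst borel_measurable_euclidean_space) (auto simp: Basis_vec_def inner_axis)
qed

section \<open>Slabs in the space of translations\<close>

definition cube :: "real \<Rightarrow> (real^2) set" where
  "cube R = {v. \<forall>z. \<bar>v $ z\<bar> \<le> R}"

lemma cube_eq: "cube R = cbox (\<chi> z. - R) (\<chi> z. R)"
  by (auto simp: cube_def mem_box_cart abs_le_iff minus_le_iff)

lemma cube_sets [measurable]: "cube R \<in> sets borel"
  by (simp add: cube_eq)

text \<open>Replacing the coordinate \<open>z\<close> by the linear form is a linear map of determinant \<open>\<alpha>\<close>, and it sends the
slab into a rectangle with sides \<open>2 * r\<close> and \<open>2 * R\<close>.\<close>

lemma slab_measure: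
  assumes \<alpha>: "\<alpha> \<noteq> 0" and R: "0 \<le> R" and r: "0 \<le> r"
  shows "emeasure lborel {v \<in> cube R. \<bar>\<alpha> * v $ z + \<beta> * v $ (z + 1) + \<gamma>\<bar> \<le> r} \<le> ennreal (4 * R * r / \<bar>\<alpha>\<bar>)"
proof -
  define E where "E = {v \<in> cube R. \<bar>\<alpha> * v $ z + \<beta> * v $ (z + 1) + \<gamma>\<bar> \<le> r}"
  have "closed {v :: real^2. \<bar>\<alpha> * v $ z + \<beta> * v $ (z + 1) + \<gamma>\<bar> \<le> r}"
    by (intro closed_Collect_le continuous_intros)
  then have "compact (cube R \<inter> {v. \<bar>\<alpha> * v $ z + \<beta> * v $ (z + 1) + \<gamma>\<bar> \<le> r})"
    unfolding cube_eq by (rule compact_Int_closed[OF compact_cbox])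
  moreover have "E = cube R \<inter> {v. \<bar>\<alpha> * v $ z + \<beta> * v $ (z + 1) + \<gamma>\<bar> \<le> r}" by (auto simp: E_def)
  ultimately have cE: "compact E" by simp
  define L :: "real^2 \<Rightarrow> real^2" where "L v = (\<chi> y. if y = z then \<alpha> * v $ z + \<beta> * v $ (z + 1) else v $ y)" for v
  have L: "linear L" by (rule linearI) (auto simp: L_def vec_eq_iff algebra_simps)
  have det: "det (matrix L) = \<alpha>"
  proof -
    have "z = 1 \<or> z = 2" using exhaust_2 by blast
    \<comment> \<open>The simplifier writes the successor of the index \<open>2\<close> as \<open>3\<close>, which is the index \<open>1\<close>.\<close>
    moreover have "axis (3::2) (1::real) = axis 1 1" by (rule arg_cong[of _ _ "\<lambda>i. axis i 1"]) simp
    moreover have "v $ (3::2) = v $ 1" for v :: "real^2" by (rule arg_cong[of _ _ "($) v"]) simp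
    ultimately show ?thesis
      by (auto simp: det_2 matrix_def L_def axis_def)
  qed
  define lo :: "real^2" where "lo = (\<chi> y. if y = z then - \<gamma> - r else - R)"
  define hi :: "real^2" where "hi = (\<chi> y. if y = z then - \<gamma> + r else R)"
  have img: "L ` E \<subseteq> cbox lo hi"
  proof
    fix x assume "x \<in> L ` E"
    then obtain v where v: "x = L v" "\<And>y. \<bar>v $ y\<bar> \<le> R" "\<bar>\<alpha> * v $ z + \<beta> * v $ (z + 1) + \<gamma>\<bar> \<le> r"
      by (auto simp: E_def cube_def)
    have "- R \<le> v $ y \<and> v $ y \<le> R" for y using v(2)[of y] by linarith
    then show "x \<in> cbox lo hi" using v(3) by (auto simp: v(1) L_def lo_def hi_def mem_box_cart abs_le_iff)
  qed
  have UN: "(UNIV :: 2 set) = {z, z + 1}" using two_cases[of _ z] by blast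
  have "\<bar>\<alpha>\<bar> * measure lebesgue E = measure lebesgue (L ` E)"
    using measure_linear_image[OF L lmeasurable_compact[OF cE]] by (simp add: det)
  also have "\<dots> \<le> measure lebesgue (cbox lo hi)"
    using img lmeasurable_compact[OF compact_continuous_image[OF linear_continuous_on_compose[OF continuous_on_id L] cE]]
    by (intro measure_mono_fmeasurable) auto
  also have "\<dots> = (2 * r) * (2 * R)"
  proof -
    have "measure lborel (cbox lo hi) = (\<Prod>y\<in>UNIV. hi $ y - lo $ y)"
      using R r by (intro content_cbox_cart) (auto simp: interval_ne_empty_cart lo_def hi_def)
    then show ?thesis unfolding UN by (simp add: lo_def hi_def)
  qed
  finally have "measure lebesgue E \<le> 4 * R * r / \<bar>\<alpha>\<bar>" using \<alpha> by (simp add: field_simps)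
  moreover have "emeasure lborel E = ennreal (measure lebesgue E)"
    using emeasure_compact_finite[OF cE] borel_compact[OF cE]
    by (simp add: emeasure_eq_ennreal_measure measure_completion)
  ultimately show ?thesis unfolding E_def[symmetric] by (simp add: ennreal_leI)
qed

definition Box :: "real \<Rightarrow> (nat \<Rightarrow> real^2) set" where
  "Box R = {1..d} \<rightarrow>\<^sub>E cube R"

lemma Box_sets [measurable]: "Box R \<in> sets TM"
  unfolding Box_def translation_measure_def by (intro sets_PiM_I_finite) auto

definition slab_const :: "real \<Rightarrow> real" where
  "slab_const R = 4 * R / \<eta> * measure lborel (cube R) ^ (d - 1)"

lemma slab_const_nonneg: "0 \<le> R \<Longrightarrow> 0 \<le> slab_const R"
  using \<eta>(1) by (simp add: slab_const_def)

lemma near_sets: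
  assumes \<omega>: "\<omega> \<in> symbol_seqs d" and \<tau>: "\<tau> \<in> symbol_seqs d"
  shows "{t \<in> Box R. \<bar>code t \<omega> z - code t \<tau> z\<bar> \<le> r} \<in> sets TM"
proof -
  have [measurable]: "(\<lambda>t. code t \<omega> z) \<in> borel_measurable TM" "(\<lambda>t. code t \<tau> z) \<in> borel_measurable TM"
    using \<omega> \<tau> by (auto intro!: code_measurable measurable_const simp: space_m)
  have "{t \<in> space TM. t \<in> Box R \<and> \<bar>code t \<omega> z - code t \<tau> z\<bar> \<le> r} \<in> sets TM" by measurable
  moreover have "{t \<in> Box R. \<bar>code t \<omega> z - code t \<tau> z\<bar> \<le> r}
      = {t \<in> space TM. t \<in> Box R \<and> \<bar>code t \<omega> z - code t \<tau> z\<bar> \<le> r}"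
    using sets.sets_into_space[OF Box_sets] by auto
  ultimately show ?thesis by simp
qed

text \<open>All translations except \<open>t j\<close> with \<open>j = \<tau> 0\<close> are fixed.  The difference of the codes is then an affine
function of \<open>t j\<close> whose coefficient along the axis \<open>z\<close> is at least \<open>\<eta>\<close> in modulus, so the admissible
\<open>t j\<close> lie in a slab.\<close>

lemma transversality_at_0:
  assumes \<omega>: "\<omega> \<in> symbol_seqs d" and \<tau>: "\<tau> \<in> symbol_seqs d" and ne: "\<omega> 0 \<noteq> \<tau> 0"
    and R: "0 \<le> R" and r: "0 \<le> r"
  shows "emeasure TM {t \<in> Box R. \<bar>code t \<omega> z - code t \<tau> z\<bar> \<le> r} \<le> ennreal (slab_const R * r)"
proof -
  define E where "E = {t \<in> Box R. \<bar>code t \<omega> z - code t \<tau> z\<bar> \<le> r}"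
  define j where "j = \<tau> 0"
  define I where "I = {1..d} - {j}"
  have j: "j \<in> {1..d}" unfolding j_def by (rule symbol_seqs_nth[OF \<tau>])
  have I: "finite I" "j \<notin> I" "insert j I = {1..d}" using j by (auto simp: I_def)
  have card_I: "card I = d - 1" using j by (simp add: I_def)
  have E_sets: "E \<in> sets TM" unfolding E_def by (rule near_sets[OF \<omega> \<tau>])
  define \<alpha> where "\<alpha> = visits \<omega> z z j - visits \<tau> z z j"
  define \<beta> where "\<beta> = visits \<omega> z (z + 1) j - visits \<tau> z (z + 1) j"
  have \<alpha>: "\<eta> \<le> \<bar>\<alpha>\<bar>" using slope_gap[OF \<omega> \<tau> ne, of z] by (simp add: \<alpha>_def j_def)
  define S where "S x = {v \<in> cube R. \<bar>\<alpha> * v $ z + \<beta> * v $ (z + 1) + (code (x(j := 0)) \<omega> z - code (x(j := 0)) \<tau> z)\<bar> \<le> r}" for x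
  have split: "indicator E (x(j := v)) \<le> (indicator (I \<rightarrow>\<^sub>E cube R) x * indicator (S x) v :: ennreal)"
    if x: "x \<in> space (PiM I (\<lambda>_. lborel))" for x v
  proof (cases "x(j := v) \<in> E")
    case True
    have eq: "code (x(j := v)) \<omega> z - code (x(j := v)) \<tau> z
        = \<alpha> * v $ z + \<beta> * v $ (z + 1) + (code (x(j := 0)) \<omega> z - code (x(j := 0)) \<tau> z)"
      using code_affine[OF \<omega>, of x j v z] code_affine[OF \<tau>, of x j v z]
      by (simp add: \<alpha>_def \<beta>_def algebra_simps)
    have "x(j := v) \<in> Box R" "\<bar>code (x(j := v)) \<omega> z - code (x(j := v)) \<tau> z\<bar> \<le> r" using True by (auto simp: E_def)
    then have mem: "(x(j := v)) i \<in> cube R" if "i \<in> {1..d}" for i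
      using that by (auto simp: Box_def dest: PiE_mem)
    have "v \<in> cube R" using mem[OF j] by simp
    moreover have "x i \<in> cube R" if "i \<in> I" for i using mem[of i] that by (auto simp: I_def)
    then have "x \<in> I \<rightarrow>\<^sub>E cube R" using x by (auto simp: space_PiM PiE_def extensional_def)
    ultimately show ?thesis
      using \<open>\<bar>code (x(j := v)) \<omega> z - code (x(j := v)) \<tau> z\<bar> \<le> r\<close> unfolding eq by (simp add: S_def indicator_def)
  qed simp
  interpret P: product_sigma_finite "\<lambda>_::nat. lborel :: (real^2) measure" by standard
  have "emeasure TM E = (\<integral>\<^sup>+ t. indicator E t \<partial>PiM (insert j I) (\<lambda>_. lborel))"
    using E_sets by (simp add: translation_measure_def I(3))
  also have "\<dots> = (\<integral>\<^sup>+ x. \<integral>\<^sup>+ v. indicator E (x(j := v)) \<partial>lborel \<partial>PiM I (\<lambda>_. lborel))"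
    using E_sets I by (intro P.product_nn_integral_insert) (auto simp: translation_measure_def)
  also have "\<dots> \<le> (\<integral>\<^sup>+ x. ennreal (4 * R * r / \<eta>) * indicator (I \<rightarrow>\<^sub>E cube R) x \<partial>PiM I (\<lambda>_. lborel))"
  proof (rule nn_integral_mono)
    fix x assume x: "x \<in> space (PiM I (\<lambda>_. lborel :: (real^2) measure))"
    have "closed {v :: real^2. \<bar>\<alpha> * v $ z + \<beta> * v $ (z + 1) + (code (x(j := 0)) \<omega> z - code (x(j := 0)) \<tau> z)\<bar> \<le> r}"
      by (intro closed_Collect_le continuous_intros)
    then have "cube R \<inter> {v :: real^2. \<bar>\<alpha> * v $ z + \<beta> * v $ (z + 1) + (code (x(j := 0)) \<omega> z - code (x(j := 0)) \<tau> z)\<bar> \<le> r} \<in> sets borel"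
      by (intro sets.Int cube_sets borel_closed)
    then have S_sets: "S x \<in> sets borel" by (simp add: S_def Int_def)
    have "(\<integral>\<^sup>+ v. indicator E (x(j := v)) \<partial>lborel) \<le> (\<integral>\<^sup>+ v. indicator (I \<rightarrow>\<^sub>E cube R) x * indicator (S x) v \<partial>lborel)"
      by (intro nn_integral_mono split x)
    also have "\<dots> = indicator (I \<rightarrow>\<^sub>E cube R) x * emeasure lborel (S x)"
      using S_sets by (subst nn_integral_cmult) auto
    also have "\<dots> \<le> indicator (I \<rightarrow>\<^sub>E cube R) x * ennreal (4 * R * r / \<eta>)"
    proof (rule mult_left_mono)
      have "emeasure lborel (S x) \<le> ennreal (4 * R * r / \<bar>\<alpha>\<bar>)"
        unfolding S_def using \<alpha> \<eta>(1) R r by (intro slab_measure) auto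
      also have "\<dots> \<le> ennreal (4 * R * r / \<eta>)"
        using \<alpha> \<eta>(1) R r by (intro ennreal_leI divide_left_mono mult_pos_pos mult_nonneg_nonneg) auto
      finally show "emeasure lborel (S x) \<le> ennreal (4 * R * r / \<eta>)" .
    qed simp
    finally show "(\<integral>\<^sup>+ v. indicator E (x(j := v)) \<partial>lborel) \<le> ennreal (4 * R * r / \<eta>) * indicator (I \<rightarrow>\<^sub>E cube R) x"
      by (simp only: mult.commute)
  qed
  also have "\<dots> = ennreal (4 * R * r / \<eta>) * emeasure (PiM I (\<lambda>_. lborel)) (I \<rightarrow>\<^sub>E cube R)"
    using I(1) by (subst nn_integral_cmult_indicator) (auto intro!: sets_PiM_I_finite)
  also have "emeasure (PiM I (\<lambda>_. lborel)) (I \<rightarrow>\<^sub>E cube R) = emeasure lborel (cube R) ^ (d - 1)"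
    using I(1) by (subst P.emeasure_PiM) (auto simp: card_I)
  also have "emeasure lborel (cube R) = ennreal (measure lborel (cube R))"
    unfolding cube_eq
    by (rule emeasure_eq_ennreal_measure) (metis emeasure_lborel_cbox_finite infinity_ennreal_def less_irrefl)
  also have "ennreal (4 * R * r / \<eta>) * ennreal (measure lborel (cube R)) ^ (d - 1) = ennreal (slab_const R * r)"
    using R r \<eta>(1) by (simp add: slab_const_def ennreal_power ennreal_mult[symmetric] mult_ac)
  finally show ?thesis by (simp add: E_def)
qed

lemma transversality:
  assumes \<omega>: "\<omega> \<in> symbol_seqs d" and \<tau>: "\<tau> \<in> symbol_seqs d"
    and eq: "initial_word \<omega> k = initial_word \<tau> k" and ne: "\<omega> k \<noteq> \<tau> k"
    and R: "0 \<le> R" and r: "0 \<le> r"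
  shows "emeasure TM {t \<in> Box R. \<bar>code t \<omega> z - code t \<tau> z\<bar> \<le> r}
    \<le> ennreal (slab_const R * (r / wt \<omega> z k))"
proof -
  let ?w = "wt \<omega> z k" and ?e = "ax \<omega> z k"
  have w: "0 < ?w" by (rule wt_pos[OF \<omega>])
  have "\<bar>code t \<omega> z - code t \<tau> z\<bar> \<le> r \<longleftrightarrow>
      \<bar>code t (\<lambda>i. \<omega> (i + k)) ?e - code t (\<lambda>i. \<tau> (i + k)) ?e\<bar> \<le> r / ?w" for t
    using w by (simp add: code_diff[OF \<omega> \<tau> eq] abs_mult pos_le_divide_eq mult.commute)
  then show ?thesis
    using transversality_at_0[OF symbol_seqs_shift[OF \<omega>] symbol_seqs_shift[OF \<tau>], of k k R "r / ?w" ?e] ne R r w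
    by simp
qed

sublocale param: sigma_finite_measure TM
proof -
  interpret P: product_sigma_finite "\<lambda>_::nat. lborel :: (real^2) measure" by standard
  interpret F: finite_product_sigma_finite "\<lambda>_::nat. lborel :: (real^2) measure" "{1..d}" by standard auto
  show "sigma_finite_measure TM" unfolding translation_measure_def by (rule F.sigma_finite_measure_axioms)
qed

sublocale TM_m: pair_sigma_finite TM m ..

text \<open>The sequences that separate from \<open>\<omega>\<close> exactly at time \<open>k\<close> and whose codes differ by at most \<open>r\<close> in the
coordinate \<open>z\<close>.\<close>

definition branch :: "(nat \<Rightarrow> nat) \<Rightarrow> 2 \<Rightarrow> nat \<Rightarrow> real \<Rightarrow> (nat \<Rightarrow> real^2) \<Rightarrow> (nat \<Rightarrow> nat) set" where
  "branch \<omega> z k r t = {\<tau> \<in> space m. initial_word \<tau> k = initial_word \<omega> k \<and> \<tau> k \<noteq> \<omega> k \<and> \<bar>code t \<omega> z - code t \<tau> z\<bar> \<le> r}"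

lemma branch_measure_measurable:
  assumes \<omega>: "\<omega> \<in> symbol_seqs d"
  shows "(\<lambda>t. emeasure m (branch \<omega> z k r t)) \<in> borel_measurable TM"
proof -
  have [measurable]: "\<omega> \<in> space m" using \<omega> by (simp add: space_m)
  show ?thesis unfolding branch_def by measurable
qed

text \<open>By Fubini the expectation is an integral over the sequences branching off at time \<open>k\<close>, and transversality
bounds the integrand uniformly.\<close>

lemma expected_branch_measure:
  assumes \<omega>: "\<omega> \<in> symbol_seqs d" and R: "0 \<le> R" and r: "0 \<le> r"
  shows "(\<integral>\<^sup>+ t. indicator (Box R) t * emeasure m (branch \<omega> z k r t) \<partial>TM)
    \<le> ennreal (slab_const R * r * (measure m (cylinder d (initial_word \<omega> k)) / wt \<omega> z k))"
proof -
  let ?w = "wt \<omega> z k"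
  have w: "0 < ?w" by (rule wt_pos[OF \<omega>])
  define f :: "(nat \<Rightarrow> real^2) \<Rightarrow> (nat \<Rightarrow> nat) \<Rightarrow> ennreal"
    where "f t \<tau> = indicator {(t, \<tau>). t \<in> Box R \<and> \<tau> \<in> branch \<omega> z k r t} (t, \<tau>)" for t \<tau>
  have [measurable]: "\<omega> \<in> space m" using \<omega> by (simp add: space_m)
  have "{x \<in> space (TM \<Otimes>\<^sub>M m). fst x \<in> Box R \<and> initial_word (snd x) k = initial_word \<omega> k
      \<and> snd x k \<noteq> \<omega> k \<and> \<bar>code (fst x) \<omega> z - code (fst x) (snd x) z\<bar> \<le> r} \<in> sets (TM \<Otimes>\<^sub>M m)"
    by measurable
  moreover have "{(t, \<tau>). t \<in> Box R \<and> \<tau> \<in> branch \<omega> z k r t} =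
    {x \<in> space (TM \<Otimes>\<^sub>M m). fst x \<in> Box R \<and> initial_word (snd x) k = initial_word \<omega> k
      \<and> snd x k \<noteq> \<omega> k \<and> \<bar>code (fst x) \<omega> z - code (fst x) (snd x) z\<bar> \<le> r}"
    using sets.sets_into_space[OF Box_sets] by (auto simp: branch_def space_pair_measure)
  ultimately have f_meas: "case_prod f \<in> borel_measurable (TM \<Otimes>\<^sub>M m)"
    by (simp add: f_def case_prod_beta')
  have b_sets: "branch \<omega> z k r t \<in> sets m" if [measurable]: "t \<in> space TM" for t
    unfolding branch_def by measurable
  have "(\<integral>\<^sup>+ t. indicator (Box R) t * emeasure m (branch \<omega> z k r t) \<partial>TM) = (\<integral>\<^sup>+ t. \<integral>\<^sup>+ \<tau>. f t \<tau> \<partial>m \<partial>TM)"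
  proof (rule nn_integral_cong)
    fix t assume t: "t \<in> space TM"
    have "(\<integral>\<^sup>+ \<tau>. f t \<tau> \<partial>m) = (\<integral>\<^sup>+ \<tau>. indicator (Box R) t * indicator (branch \<omega> z k r t) \<tau> \<partial>m)"
      by (intro nn_integral_cong) (auto simp: f_def indicator_def)
    then show "indicator (Box R) t * emeasure m (branch \<omega> z k r t) = (\<integral>\<^sup>+ \<tau>. f t \<tau> \<partial>m)"
      using b_sets[OF t] by (simp add: nn_integral_cmult)
  qed
  also have "\<dots> = (\<integral>\<^sup>+ \<tau>. \<integral>\<^sup>+ t. f t \<tau> \<partial>TM \<partial>m)"
    by (rule TM_m.Fubini'[OF f_meas, symmetric])
  also have "\<dots> \<le> (\<integral>\<^sup>+ \<tau>. ennreal (slab_const R * (r / ?w)) * indicator (cylinder d (initial_word \<omega> k)) \<tau> \<partial>m)"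
  proof (rule nn_integral_mono)
    fix \<tau> assume \<tau>: "\<tau> \<in> space m"
    show "(\<integral>\<^sup>+ t. f t \<tau> \<partial>TM) \<le> ennreal (slab_const R * (r / ?w)) * indicator (cylinder d (initial_word \<omega> k)) \<tau>"
    proof (cases "initial_word \<tau> k = initial_word \<omega> k \<and> \<tau> k \<noteq> \<omega> k")
      case True
      have "(\<integral>\<^sup>+ t. f t \<tau> \<partial>TM) \<le> (\<integral>\<^sup>+ t. indicator {t \<in> Box R. \<bar>code t \<omega> z - code t \<tau> z\<bar> \<le> r} t \<partial>TM)"
        by (intro nn_integral_mono) (auto simp: f_def branch_def indicator_def)
      also have "\<dots> \<le> emeasure TM {t \<in> Box R. \<bar>code t \<omega> z - code t \<tau> z\<bar> \<le> r}"
        using near_sets[OF \<omega>, of \<tau>] \<tau> by (simp add: space_m)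
      also have "\<dots> \<le> ennreal (slab_const R * (r / ?w))"
        using True \<tau> by (intro transversality \<omega> R r) (auto simp: space_m)
      finally show ?thesis using True \<tau> by (simp add: cylinder_eq)
    next
      case False
      then show ?thesis by (auto simp: f_def branch_def)
    qed
  qed
  also have "\<dots> = ennreal (slab_const R * (r / ?w)) * ennreal (measure m (cylinder d (initial_word \<omega> k)))"
    by (simp add: nn_integral_cmult_indicator emeasure_eq_measure)
  also have "\<dots> = ennreal (slab_const R * r * (measure m (cylinder d (initial_word \<omega> k)) / ?w))"
    using slab_const_nonneg[OF R] r w by (simp add: ennreal_mult[symmetric])
  finally show ?thesis .
qed

end

section \<open>Exponential rates\<close>

abbreviation has_rate :: "(nat \<Rightarrow> real) \<Rightarrow> real \<Rightarrow> bool" where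
  "has_rate x c \<equiv> (\<lambda>n. - (1 / real n * ln (x n))) \<longlonglongrightarrow> c"

lemma rate_bounds:
  assumes lim: "has_rate x c" and pos: "\<And>n. 0 < x n" and e: "0 < e"
  shows "\<forall>\<^sub>F n in sequentially. exp (- (c + e) * real n) \<le> x n \<and> x n \<le> exp (- (c - e) * real n)"
proof -
  have "\<forall>\<^sub>F n in sequentially. dist (- (1 / real n * ln (x n))) c < e" using lim e by (rule tendstoD)
  then show ?thesis using eventually_gt_at_top[of 0]
  proof eventually_elim
    case (elim n)
    then have "c - e < - (1 / real n * ln (x n))" "- (1 / real n * ln (x n)) < c + e"
      by (auto simp: dist_real_def abs_less_iff)
    then have "- (c + e) * real n \<le> ln (x n)" "ln (x n) \<le> - (c - e) * real n"
      using \<open>0 < n\<close> by (auto simp: field_simps)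
    then show ?case using pos[of n] by (metis exp_le_cancel_iff exp_ln)
  qed
qed

lemma pred_tendsto:
  fixes f :: "nat \<Rightarrow> 'a \<Rightarrow> real"
  assumes [measurable]: "\<And>n. f n \<in> borel_measurable M"
  shows "Measurable.pred M (\<lambda>x. (\<lambda>n. f n x) \<longlonglongrightarrow> c)"
proof -
  have "(\<lambda>n. f n x) \<longlonglongrightarrow> c \<longleftrightarrow> (\<forall>j. \<exists>N. \<forall>n\<ge>N. \<bar>f n x - c\<bar> < 1 / real (Suc j))" for x
  proof
    show "(\<lambda>n. f n x) \<longlonglongrightarrow> c \<Longrightarrow> (\<forall>j. \<exists>N. \<forall>n\<ge>N. \<bar>f n x - c\<bar> < 1 / real (Suc j))"
      by (force simp: LIMSEQ_iff)
    assume *: "\<forall>j. \<exists>N. \<forall>n\<ge>N. \<bar>f n x - c\<bar> < 1 / real (Suc j)"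
    show "(\<lambda>n. f n x) \<longlonglongrightarrow> c"
    proof (rule LIMSEQ_I)
      fix r :: real assume "0 < r"
      then obtain j where "1 / real (Suc j) < r" using reals_Archimedean[of r] by (auto simp: inverse_eq_divide)
      with * show "\<exists>N. \<forall>n\<ge>N. norm (f n x - c) < r" by (metis less_trans real_norm_def)
    qed
  qed
  then show ?thesis by simp
qed

lemma eventually_exp_absorb:
  fixes B e :: real
  assumes "0 < e"
  shows "\<forall>\<^sub>F n in sequentially. B * (real n + 1) \<le> exp (e * real n)"
proof -
  have "((\<lambda>n. (real n + 1) / exp (e * real n)) \<longlongrightarrow> 0) sequentially"
    using assms by real_asymp
  then have "((\<lambda>n. B * ((real n + 1) / exp (e * real n))) \<longlongrightarrow> B * 0) sequentially"
    by (intro tendsto_intros)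
  then have "\<forall>\<^sub>F n in sequentially. B * ((real n + 1) / exp (e * real n)) < 1"
    by (intro order_tendstoD(2)) auto
  then show ?thesis by eventually_elim (simp add: field_simps)
qed

lemma eventually_exp_absorb_const:
  fixes B e :: real
  assumes "0 < e"
  shows "\<forall>\<^sub>F n in sequentially. B \<le> exp (e * real n)"
  using eventually_exp_absorb[OF assms, of "\<bar>B\<bar>"]
proof eventually_elim
  case (elim n)
  have "B \<le> \<bar>B\<bar> * 1" by simp
  also have "\<dots> \<le> \<bar>B\<bar> * (real n + 1)" by (intro mult_left_mono) auto
  finally show ?case using elim by simp
qed

lemma eventual_exp_bound_uniform:
  assumes "\<forall>\<^sub>F n in sequentially. q n \<le> exp (c * real n)"
  obtains B where "0 < B" "\<And>n. q n \<le> B * exp (c * real n)"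
proof -
  obtain N where N: "\<And>n. n \<ge> N \<Longrightarrow> q n \<le> exp (c * real n)"
    using assms by (auto simp: eventually_sequentially)
  define B where "B = Max (insert 1 ((\<lambda>n. q n / exp (c * real n)) ` {..<N}))"
  have "1 \<le> B" unfolding B_def by (intro Max_ge) auto
  moreover have "q n \<le> B * exp (c * real n)" for n
  proof (cases "n < N")
    case True
    then have "q n / exp (c * real n) \<le> B" unfolding B_def by (intro Max_ge) auto
    then show ?thesis by (simp add: field_simps)
  next
    case False
    have "q n \<le> 1 * exp (c * real n)" using N False by simp
    also have "\<dots> \<le> B * exp (c * real n)" using \<open>1 \<le> B\<close> by (intro mult_right_mono) auto
    finally show ?thesis .
  qed
  ultimately show ?thesis by (intro that[of B]) auto
qed

text \<open>Markov's inequality bounds the measure of the exceptional sets by a geometric sequence, and the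
Borel--Cantelli lemma applies.\<close>

lemma AE_eventually_exp_small:
  fixes f :: "nat \<Rightarrow> 'a \<Rightarrow> ennreal"
  assumes f [measurable]: "\<And>n. f n \<in> borel_measurable M"
    and int: "\<forall>\<^sub>F n in sequentially. (\<integral>\<^sup>+ x. f n x \<partial>M) \<le> ennreal (exp (- c * real n))"
    and c': "c' < c"
  shows "AE x in M. \<forall>\<^sub>F n in sequentially. f n x \<le> ennreal (exp (- c' * real n))"
proof -
  obtain N where N: "\<And>n. n \<ge> N \<Longrightarrow> (\<integral>\<^sup>+ x. f n x \<partial>M) \<le> ennreal (exp (- c * real n))"
    using int by (auto simp: eventually_sequentially)
  define S where "S n = {x \<in> space M. 1 \<le> ennreal (exp (c' * real n)) * f n x \<and> N \<le> n}" for n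
  have S_sets [measurable]: "S n \<in> sets M" for n unfolding S_def by measurable
  have S_le: "emeasure M (S n) \<le> ennreal (exp (- (c - c')) ^ n)" for n
  proof (cases "N \<le> n")
    case True
    have "emeasure M (S n) = emeasure M {x \<in> space M. 1 \<le> ennreal (exp (c' * real n)) * f n x}"
      using True by (simp add: S_def)
    also have "\<dots> \<le> ennreal (exp (c' * real n)) * (\<integral>\<^sup>+ x. f n x * indicator (space M) x \<partial>M)"
      by (rule nn_integral_Markov_inequality) auto
    also have "(\<integral>\<^sup>+ x. f n x * indicator (space M) x \<partial>M) = (\<integral>\<^sup>+ x. f n x \<partial>M)"
      by (intro nn_integral_cong) auto
    also have "ennreal (exp (c' * real n)) * \<dots> \<le> ennreal (exp (c' * real n)) * ennreal (exp (- c * real n))"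
      by (intro mult_left_mono N True) auto
    also have "\<dots> = ennreal (exp (- (c - c')) ^ n)"
      by (simp add: ennreal_mult[symmetric] mult_exp_exp exp_of_nat_mult[symmetric] algebra_simps)
    finally show ?thesis .
  qed (simp add: S_def)
  have fin: "emeasure M (S n) < \<infinity>" for n using le_less_trans[OF S_le ennreal_less_top] by simp
  have meas: "measure M (S n) \<le> exp (- (c - c')) ^ n" for n
    using S_le[of n] fin[of n] by (simp add: emeasure_eq_ennreal_measure less_top)
  have "summable (\<lambda>n. measure M (S n))"
    using meas c' by (intro summable_comparison_test'[OF summable_geometric[of "exp (- (c - c'))"], of 0]) auto
  then have "AE x in M. \<forall>\<^sub>F n in sequentially. x \<in> space M - S n"
    by (intro borel_cantelli_AE1 fin S_sets)
  then show ?thesis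
  proof eventually_elim
    case (elim x)
    then show ?case using eventually_ge_at_top[of N]
    proof eventually_elim
      case (elim n)
      then have "ennreal (exp (c' * real n)) * f n x \<le> 1" by (auto simp: S_def not_le)
      then have "ennreal (exp (- c' * real n)) * (ennreal (exp (c' * real n)) * f n x) \<le> ennreal (exp (- c' * real n)) * 1"
        by (intro mult_left_mono) auto
      moreover have "ennreal (exp (- c' * real n)) * (ennreal (exp (c' * real n)) * f n x) = f n x"
        by (simp add: mult.assoc[symmetric] ennreal_mult[symmetric] mult_exp_exp)
      ultimately show ?case by simp
    qed
  qed
qed

section \<open>Mass near a typical point for almost all translations\<close>

context symbolic_measure
begin

definition cyl_measure :: "(nat \<Rightarrow> nat) \<Rightarrow> nat \<Rightarrow> real" where
  "cyl_measure \<omega> n = measure m (cylinder d (initial_word \<omega> n))"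

definition branch_sum :: "(nat \<Rightarrow> nat) \<Rightarrow> 2 \<Rightarrow> nat set \<Rightarrow> real \<Rightarrow> (nat \<Rightarrow> real^2) \<Rightarrow> ennreal" where
  "branch_sum \<omega> z I r t = (\<Sum>k. if k \<in> I then emeasure m (branch \<omega> z k r t) else 0)"

lemma branch_sum_measurable:
  assumes "\<omega> \<in> symbol_seqs d" shows "branch_sum \<omega> z I r \<in> borel_measurable TM"
proof -
  note [measurable] = branch_measure_measurable[OF assms]
  have [measurable]: "(\<lambda>t. if k \<in> I then emeasure m (branch \<omega> z k r t) else 0) \<in> borel_measurable TM" for k
    by (cases "k \<in> I") simp_all
  show ?thesis unfolding branch_sum_def[abs_def] by measurable
qed

lemma expected_branch_sum:
  assumes \<omega>: "\<omega> \<in> symbol_seqs d" and R: "0 \<le> R" and r: "0 \<le> r"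
    and S: "(\<lambda>k. if k \<in> I then cyl_measure \<omega> k / wt \<omega> z k else 0) sums S"
  shows "(\<integral>\<^sup>+ t. indicator (Box R) t * branch_sum \<omega> z I r t \<partial>TM) \<le> ennreal (slab_const R * r * S)"
proof -
  note [measurable] = branch_measure_measurable[OF \<omega>]
  let ?f = "\<lambda>k t. indicator (Box R) t * (if k \<in> I then emeasure m (branch \<omega> z k r t) else 0)"
  let ?q = "\<lambda>k. slab_const R * r * (if k \<in> I then cyl_measure \<omega> k / wt \<omega> z k else 0)"
  have "(\<integral>\<^sup>+ t. indicator (Box R) t * branch_sum \<omega> z I r t \<partial>TM) = (\<integral>\<^sup>+ t. (\<Sum>k. ?f k t) \<partial>TM)"
    by (simp add: branch_sum_def)
  also have "\<dots> = (\<Sum>k. \<integral>\<^sup>+ t. ?f k t \<partial>TM)"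
  proof (rule nn_integral_suminf)
    show "?f k \<in> borel_measurable TM" for k by (cases "k \<in> I") simp_all
  qed
  also have "\<dots> \<le> (\<Sum>k. ennreal (?q k))"
  proof (rule suminf_le)
    show "(\<integral>\<^sup>+ t. ?f k t \<partial>TM) \<le> ennreal (?q k)" for k
      using expected_branch_measure[OF \<omega> R r, where z = z and k = k] by (auto simp: cyl_measure_def)
  qed auto
  also have "\<dots> = ennreal (slab_const R * r * S)"
  proof (rule suminf_ennreal_eq)
    show "0 \<le> ?q k" for k
      using slab_const_nonneg[OF R] r wt_pos[OF \<omega>, of k z] by (auto simp: cyl_measure_def)
    show "?q sums (slab_const R * r * S)" by (intro sums_mult S)
  qed
  finally show ?thesis .
qed

lemma AE_branch_sum_small:
  assumes \<omega>: "\<omega> \<in> symbol_seqs d" and R: "0 \<le> R"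
    and S: "\<And>n. (\<lambda>k. if k \<in> I n then cyl_measure \<omega> k / wt \<omega> z k else 0) sums S n"
    and S_le: "\<forall>\<^sub>F n in sequentially. S n \<le> exp (- \<sigma> * real n)" and \<gamma>: "\<gamma> < \<kappa> + \<sigma>"
  shows "AE t in TM. t \<in> Box R \<longrightarrow> (\<forall>\<^sub>F n in sequentially.
    branch_sum \<omega> z (I n) (exp (- \<kappa> * real n)) t \<le> ennreal (exp (- \<gamma> * real n)))"
proof -
  define e where "e = (\<kappa> + \<sigma> - \<gamma>) / 2"
  have e: "0 < e" using \<gamma> by (simp add: e_def)
  define f where "f n t = indicator (Box R) t * branch_sum \<omega> z (I n) (exp (- \<kappa> * real n)) t" for n t
  note [measurable] = branch_sum_measurable[OF \<omega>]
  have f_meas: "f n \<in> borel_measurable TM" for n unfolding f_def by measurable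
  have int: "\<forall>\<^sub>F n in sequentially. (\<integral>\<^sup>+ t. f n t \<partial>TM) \<le> ennreal (exp (- (\<kappa> + \<sigma> - e) * real n))"
    using S_le eventually_exp_absorb_const[OF e, of "slab_const R"]
  proof eventually_elim
    case (elim n)
    have "(\<integral>\<^sup>+ t. f n t \<partial>TM) \<le> ennreal (slab_const R * exp (- \<kappa> * real n) * S n)"
      unfolding f_def by (intro expected_branch_sum \<omega> R S) auto
    also have "\<dots> \<le> ennreal (exp (e * real n) * exp (- \<kappa> * real n) * exp (- \<sigma> * real n))"
    proof (intro ennreal_leI mult_mono)
      show "0 \<le> S n"
        by (rule sums_le[OF _ sums_zero S[of n]])
          (use wt_pos[OF \<omega>] in \<open>auto simp: cyl_measure_def less_imp_le\<close>)
    qed (use elim in auto)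
    also have "\<dots> = ennreal (exp (- (\<kappa> + \<sigma> - e) * real n))"
      by (simp add: mult_exp_exp algebra_simps)
    finally show ?case by simp
  qed
  have "\<gamma> < \<kappa> + \<sigma> - e" using \<gamma> by (simp add: e_def field_simps)
  from AE_eventually_exp_small[OF f_meas int this] show ?thesis by eventually_elim (auto simp: f_def)
qed

text \<open>For the smaller Lyapunov exponent \<open>\<xi>\<close> this says that the images of the cylinders around \<open>\<omega>\<close> are
asymptotically longest along the axis \<open>z\<close>.\<close>

definition regular :: "real \<Rightarrow> real \<Rightarrow> 2 \<Rightarrow> (nat \<Rightarrow> nat) \<Rightarrow> bool" where
  "regular h \<xi> z \<omega> \<longleftrightarrow> (\<forall>n. 0 < cyl_measure \<omega> n) \<and>
     has_rate (cyl_measure \<omega>) h \<and>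
     has_rate (wt \<omega> z) \<xi>"

lemma quotient_rate:
  assumes \<omega>: "\<omega> \<in> symbol_seqs d" and reg: "regular h \<xi> z \<omega>" and e: "0 < e"
  obtains B where "0 < B" "\<And>k. cyl_measure \<omega> k / wt \<omega> z k \<le> B * exp (- (h - \<xi> - e) * real k)"
proof -
  have w: "0 < wt \<omega> z k" for k by (rule wt_pos[OF \<omega>])
  have "\<forall>\<^sub>F k in sequentially. cyl_measure \<omega> k \<le> exp (- (h - e / 2) * real k)"
    using rate_bounds[of "cyl_measure \<omega>" h "e / 2"] reg e by (auto simp: regular_def elim: eventually_mono)
  moreover have "\<forall>\<^sub>F k in sequentially. exp (- (\<xi> + e / 2) * real k) \<le> wt \<omega> z k"
    using rate_bounds[of "\<lambda>k. wt \<omega> z k" \<xi> "e / 2"] reg e w by (auto simp: regular_def elim: eventually_mono)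
  ultimately have "\<forall>\<^sub>F k in sequentially. cyl_measure \<omega> k / wt \<omega> z k \<le> exp (- (h - \<xi> - e) * real k)"
  proof eventually_elim
    case (elim k)
    have "cyl_measure \<omega> k / wt \<omega> z k \<le> exp (- (h - e / 2) * real k) / exp (- (\<xi> + e / 2) * real k)"
      using elim by (intro frac_le) auto
    also have "\<dots> = exp (- (h - \<xi> - e) * real k)"
      by (simp add: exp_diff[symmetric] algebra_simps)
    finally show ?case .
  qed
  then show ?thesis by (rule eventual_exp_bound_uniform) (rule that)
qed

text \<open>Closeness at the scale \<open>exp (- \<kappa> * n)\<close> is measured along one axis.  The flag \<open>c\<close> tells whether only the
cylinder of \<open>\<omega>\<close> of order \<open>n\<close> is considered.\<close>

definition near :: "bool \<Rightarrow> real \<Rightarrow> 2 \<Rightarrow> nat \<Rightarrow> (nat \<Rightarrow> real^2) \<Rightarrow> (nat \<Rightarrow> nat) \<Rightarrow> (nat \<Rightarrow> nat) set" where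
  "near c \<kappa> z n t \<omega> = {\<tau> \<in> space m. (c \<longrightarrow> initial_word \<tau> n = initial_word \<omega> n) \<and>
      \<bar>code t \<omega> z - code t \<tau> z\<bar> \<le> exp (- \<kappa> * real n)}"

lemma branch_sets:
  assumes [measurable]: "t \<in> space TM" "\<omega> \<in> space m"
  shows "branch \<omega> z k r t \<in> sets m"
  unfolding branch_def by measurable

lemma near_le_branch_sum:
  assumes t: "t \<in> space TM" and \<omega>: "\<omega> \<in> space m" and P: "P \<in> sets m"
    and sub: "near c \<kappa> z n t \<omega> \<subseteq> P \<union> (\<Union>k\<in>I. branch \<omega> z k (exp (- \<kappa> * real n)) t)"
  shows "emeasure m (near c \<kappa> z n t \<omega>) \<le> emeasure m P + branch_sum \<omega> z I (exp (- \<kappa> * real n)) t"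
proof -
  let ?b = "\<lambda>k. if k \<in> I then branch \<omega> z k (exp (- \<kappa> * real n)) t else {}"
  have b: "?b k \<in> sets m" for k using branch_sets[OF t \<omega>] by auto
  have U: "(\<Union>k. ?b k) \<in> sets m" by (rule sets.countable_UN) (use b in blast)
  have "near c \<kappa> z n t \<omega> \<subseteq> P \<union> (\<Union>k. ?b k)" using sub by fastforce
  then have "emeasure m (near c \<kappa> z n t \<omega>) \<le> emeasure m (P \<union> (\<Union>k. ?b k))"
    by (rule emeasure_mono[OF _ sets.Un[OF P U]])
  also have "\<dots> \<le> emeasure m P + emeasure m (\<Union>k. ?b k)" by (rule emeasure_subadditive[OF P U])
  also have "\<dots> \<le> emeasure m P + (\<Sum>k. emeasure m (?b k))"
    by (intro add_mono order_refl emeasure_subadditive_countably) (use b in blast)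
  also have "(\<Sum>k. emeasure m (?b k)) = branch_sum \<omega> z I (exp (- \<kappa> * real n)) t"
    by (simp add: branch_sum_def if_distrib[of "emeasure m"] cong: if_cong)
  finally show ?thesis .
qed

text \<open>A sequence that is close to \<open>\<omega>\<close> either lies in the cylinder of order \<open>n\<close>, of measure about
\<open>exp (- h * n)\<close>, or branches off at a time \<open>k < n\<close>.  The expected mass of the branch at time \<open>k\<close> is of
order \<open>exp (- \<xi> * n) * exp ((\<xi> - h) * k)\<close>.  Since \<open>h \<le> \<xi>\<close>, the last branches dominate, and they too
have mass about \<open>exp (- h * n)\<close>.\<close>

lemma near_global:
  assumes \<omega>: "\<omega> \<in> symbol_seqs d" and reg: "regular h \<xi> z \<omega>" and le: "h \<le> \<xi>"
    and R: "0 \<le> R" and e: "0 < e"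
  shows "AE t in TM. t \<in> Box R \<longrightarrow> (\<forall>\<^sub>F n in sequentially. measure m (near False \<xi> z n t \<omega>) \<le> exp (- (h - e) * real n))"
    (is "AE t in TM. _ \<longrightarrow> ?G t")
proof -
  have e4: "0 < e / 4" using e by simp
  define q where "q k = cyl_measure \<omega> k / wt \<omega> z k" for k
  have q_nonneg: "0 \<le> q k" for k
    using wt_pos[OF \<omega>, of k z] by (simp add: q_def cyl_measure_def)
  obtain B where B: "0 < B" "\<And>k. q k \<le> B * exp (- (h - \<xi> - e / 4) * real k)"
    using quotient_rate[OF \<omega> reg, of "e / 4"] e unfolding q_def by auto
  have S: "(\<lambda>k. if k \<in> {..<n} then q k else 0) sums (\<Sum>k<n. q k)" for n
    by (rule sums_If_finite_set) simp
  have S_le: "\<forall>\<^sub>F n in sequentially. (\<Sum>k<n. q k) \<le> exp (- (h - \<xi> - e / 2) * real n)"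
    using eventually_exp_absorb[OF e4, of B]
  proof eventually_elim
    case (elim n)
    have "(\<Sum>k<n. q k) \<le> (\<Sum>k<n. B * exp (- (h - \<xi> - e / 4) * real n))"
    proof (rule sum_mono)
      fix k assume "k \<in> {..<n}"
      then have "- (h - \<xi> - e / 4) * real k \<le> - (h - \<xi> - e / 4) * real n"
        using le e by (intro mult_left_mono) auto
      then show "q k \<le> B * exp (- (h - \<xi> - e / 4) * real n)"
        using B(1) by (intro order_trans[OF B(2)]) simp
    qed
    also have "\<dots> = (B * real n) * exp (- (h - \<xi> - e / 4) * real n)" by simp
    also have "\<dots> \<le> exp (e / 4 * real n) * exp (- (h - \<xi> - e / 4) * real n)"
      using elim B(1) by (intro mult_right_mono) (auto simp: algebra_simps)
    also have "\<dots> = exp (- (h - \<xi> - e / 2) * real n)" by (simp add: mult_exp_exp algebra_simps)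
    finally show ?case by simp
  qed
  have cyl: "\<forall>\<^sub>F n in sequentially. cyl_measure \<omega> n \<le> exp (- (h - e / 2) * real n)"
    using rate_bounds[of "cyl_measure \<omega>" h "e / 2"] reg e by (auto simp: regular_def elim: eventually_mono)
  have ev: "\<forall>\<^sub>F n in sequentially. 2 \<le> exp (e / 4 * real n)"
    using e by (intro eventually_exp_absorb_const) auto
  have "AE t in TM. t \<in> Box R \<longrightarrow> (\<forall>\<^sub>F n in sequentially.
      branch_sum \<omega> z {..<n} (exp (- \<xi> * real n)) t \<le> ennreal (exp (- (h - 3 * e / 4) * real n)))"
    by (rule AE_branch_sum_small[OF \<omega> R S[unfolded q_def] S_le[unfolded q_def]]) (use e in simp)
  then show ?thesis using AE_space
  proof eventually_elim
    case (elim t)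
    show ?case
    proof
      assume "t \<in> Box R"
      from mp[OF elim(1) this] cyl ev show "?G t"
      proof eventually_elim
        case (elim n)
        have sub: "near False \<xi> z n t \<omega> \<subseteq> cylinder d (initial_word \<omega> n) \<union> (\<Union>k\<in>{..<n}. branch \<omega> z k (exp (- \<xi> * real n)) t)"
        proof
          fix \<tau> assume \<tau>: "\<tau> \<in> near False \<xi> z n t \<omega>"
          show "\<tau> \<in> cylinder d (initial_word \<omega> n) \<union> (\<Union>k\<in>{..<n}. branch \<omega> z k (exp (- \<xi> * real n)) t)"
          proof (cases "initial_word \<tau> n = initial_word \<omega> n")
            case True
            then show ?thesis using \<tau> by (simp add: near_def cylinder_eq)
          next
            case False
            moreover have "initial_word \<tau> 0 = initial_word \<omega> 0" by simp
            ultimately obtain k where "k < n" "initial_word \<tau> k = initial_word \<omega> k" "\<tau> k \<noteq> \<omega> k"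
              by (metis first_difference)
            then show ?thesis using \<tau> by (auto simp: near_def branch_def)
          qed
        qed
        have "emeasure m (near False \<xi> z n t \<omega>) \<le> emeasure m (cylinder d (initial_word \<omega> n)) + branch_sum \<omega> z {..<n} (exp (- \<xi> * real n)) t"
          using \<omega> by (intro near_le_branch_sum[OF \<open>t \<in> space TM\<close> _ cylinder_sets sub]) (simp add: space_m)
        also have "\<dots> \<le> ennreal (exp (- (h - e / 2) * real n)) + ennreal (exp (- (h - 3 * e / 4) * real n))"
          using elim by (intro add_mono) (simp_all add: cyl_measure_def emeasure_eq_measure ennreal_leI)
        also have "\<dots> = ennreal (exp (- (h - e / 2) * real n) + exp (- (h - 3 * e / 4) * real n))"
          by (simp add: ennreal_plus)
        finally have "measure m (near False \<xi> z n t \<omega>) \<le> exp (- (h - e / 2) * real n) + exp (- (h - 3 * e / 4) * real n)"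
          by (simp add: emeasure_eq_measure ennreal_le_iff add_nonneg_nonneg del: ennreal_plus)
        also have "\<dots> \<le> 2 * exp (- (h - 3 * e / 4) * real n)"
        proof -
          have "- (h - e / 2) * real n \<le> - (h - 3 * e / 4) * real n" using e by (intro mult_right_mono) auto
          then show ?thesis by simp
        qed
        also have "\<dots> \<le> exp (e / 4 * real n) * exp (- (h - 3 * e / 4) * real n)"
          using elim by (intro mult_right_mono) auto
        also have "\<dots> = exp (- (h - e) * real n)" by (simp add: mult_exp_exp algebra_simps)
        finally show ?case .
      qed
    qed
  qed
qed

text \<open>Within the cylinder of order \<open>n\<close> only the branches at times \<open>k \<ge> n\<close> occur.  The expected mass of the
branch at time \<open>k\<close> is of order \<open>exp (- \<kappa> * n) * exp (- (h - \<xi>) * k)\<close>.  Since \<open>\<xi> < h\<close>, these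
masses form a convergent series, dominated by its first term.\<close>

lemma near_local:
  assumes \<omega>: "\<omega> \<in> symbol_seqs d" and reg: "regular h \<xi> z \<omega>" and less: "\<xi> < h" and h: "0 < h"
    and R: "0 \<le> R" and e: "0 < e"
  shows "AE t in TM. t \<in> Box R \<longrightarrow> (\<forall>\<^sub>F n in sequentially. measure m (near True \<kappa> z n t \<omega>) \<le> exp (- (\<kappa> + h - \<xi> - e) * real n))"
    (is "AE t in TM. _ \<longrightarrow> ?G t")
proof -
  have e4: "0 < e / 4" using e by simp
  define q where "q k = cyl_measure \<omega> k / wt \<omega> z k" for k
  have q_nonneg: "0 \<le> q k" for k
    using wt_pos[OF \<omega>, of k z] by (simp add: q_def cyl_measure_def)
  \<comment> \<open>The loss \<open>e1\<close> must also stay below \<open>h - \<xi>\<close>, so that the series still converges.\<close>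
  define e1 where "e1 = min (e / 4) ((h - \<xi>) / 2)"
  have e1: "0 < e1" "e1 \<le> e / 4" "e1 < h - \<xi>" using e less by (auto simp: e1_def min_def)
  obtain B where B: "0 < B" "\<And>k. q k \<le> B * exp (- (h - \<xi> - e1) * real k)"
    using quotient_rate[OF \<omega> reg e1(1)] unfolding q_def by auto
  define p where "p = exp (- (h - \<xi> - e1))"
  have p: "0 < p" "p < 1" using e1 by (auto simp: p_def)
  have pk: "exp (- (h - \<xi> - e1) * real k) = p ^ k" for k by (simp add: p_def exp_of_nat2_mult)
  have sq: "summable q"
    using B q_nonneg p unfolding pk
    by (intro summable_comparison_test'[OF summable_mult[OF summable_geometric[of p]], of 0 q B]) auto
  have S: "(\<lambda>k. if k \<in> {n..} then q k else 0) sums (\<Sum>k. q (k + n))" for n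
  proof -
    have "(\<lambda>k. q (k + n)) sums (\<Sum>k. q (k + n))"
      using sq by (intro summable_sums) (simp add: summable_iff_shift)
    then have "(\<lambda>k. (if k + n \<in> {n..} then q (k + n) else 0)) sums (\<Sum>k. q (k + n))" by simp
    then have "(\<lambda>k. if k \<in> {n..} then q k else 0) sums ((\<Sum>k. q (k + n)) + (\<Sum>k<n. if k \<in> {n..} then q k else 0))"
      by (rule sums_iff_shift[THEN iffD1])
    then show ?thesis by simp
  qed
  have S_le: "\<forall>\<^sub>F n in sequentially. (\<Sum>k. q (k + n)) \<le> exp (- (h - \<xi> - e / 2) * real n)"
    using eventually_exp_absorb_const[OF e4, of "B / (1 - p)"]
  proof eventually_elim
    case (elim n)
    have geo: "(\<lambda>k. B * p ^ n * p ^ k) sums (B * p ^ n * (1 / (1 - p)))"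
      using p by (intro sums_mult geometric_sums) auto
    have "q (k + n) \<le> B * p ^ n * p ^ k" for k
      using B(2)[of "k + n"] unfolding pk by (simp add: power_add mult_ac)
    then have "(\<Sum>k. q (k + n)) \<le> (\<Sum>k. B * p ^ n * p ^ k)"
      using sq sums_summable[OF geo] by (intro suminf_le) (auto simp: summable_iff_shift)
    also have "\<dots> = B / (1 - p) * p ^ n" using sums_unique[OF geo] by simp
    also have "\<dots> \<le> exp (e / 4 * real n) * p ^ n" using elim p by (intro mult_right_mono) auto
    also have "\<dots> = exp ((e / 4 - (h - \<xi> - e1)) * real n)" unfolding pk[symmetric] by (simp add: mult_exp_exp algebra_simps)
    also have "\<dots> \<le> exp (- (h - \<xi> - e / 2) * real n)" unfolding exp_le_cancel_iff using e1 by (intro mult_right_mono) auto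
    finally show ?case by simp
  qed
  define P where "P = (\<Inter>k. cylinder d (initial_word \<omega> k))"
  have P_sets: "P \<in> sets m" unfolding P_def by auto
  have P_null: "emeasure m P = 0"
  proof -
    have "\<forall>\<^sub>F k in sequentially. cyl_measure \<omega> k \<le> exp (- (h - h / 2) * real k)"
      using rate_bounds[of "cyl_measure \<omega>" h "h / 2"] reg h by (auto simp: regular_def elim: eventually_mono)
    then have "\<forall>\<^sub>F k in sequentially. measure m P \<le> exp (- (h - h / 2) * real k)"
    proof eventually_elim
      case (elim k)
      have "measure m P \<le> cyl_measure \<omega> k"
        unfolding cyl_measure_def P_def by (intro finite_measure_mono) auto
      with elim show ?case by simp
    qed
    moreover have "(\<lambda>k. exp (- (h - h / 2) * real k)) \<longlonglongrightarrow> 0" using h by real_asymp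
    ultimately have "measure m P \<le> 0" by (intro tendsto_lowerbound[of _ 0 sequentially]) auto
    then show ?thesis by (simp add: emeasure_eq_measure measure_le_0_iff)
  qed
  have "AE t in TM. t \<in> Box R \<longrightarrow> (\<forall>\<^sub>F n in sequentially.
      branch_sum \<omega> z {n..} (exp (- \<kappa> * real n)) t \<le> ennreal (exp (- (\<kappa> + h - \<xi> - e) * real n)))"
    by (rule AE_branch_sum_small[OF \<omega> R S[unfolded q_def] S_le[unfolded q_def]]) (use e in simp)
  then show ?thesis using AE_space
  proof eventually_elim
    case (elim t)
    show ?case
    proof
      assume "t \<in> Box R"
      from mp[OF elim(1) this] show "?G t"
      proof eventually_elim
        case (elim n)
        have sub: "near True \<kappa> z n t \<omega> \<subseteq> P \<union> (\<Union>k\<in>{n..}. branch \<omega> z k (exp (- \<kappa> * real n)) t)"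
        proof
          fix \<tau> assume \<tau>: "\<tau> \<in> near True \<kappa> z n t \<omega>"
          show "\<tau> \<in> P \<union> (\<Union>k\<in>{n..}. branch \<omega> z k (exp (- \<kappa> * real n)) t)"
          proof (cases "\<forall>p. initial_word \<tau> p = initial_word \<omega> p")
            case True
            then show ?thesis using \<tau> by (simp add: near_def P_def cylinder_eq)
          next
            case False
            then obtain p where "initial_word \<tau> p \<noteq> initial_word \<omega> p" by blast
            moreover have "initial_word \<tau> n = initial_word \<omega> n" using \<tau> by (simp add: near_def)
            ultimately obtain k where "n \<le> k" "initial_word \<tau> k = initial_word \<omega> k" "\<tau> k \<noteq> \<omega> k"
              by (metis first_difference)
            then show ?thesis using \<tau> by (auto simp: near_def branch_def)
          qed
        qed
        have "emeasure m (near True \<kappa> z n t \<omega>) \<le> emeasure m P + branch_sum \<omega> z {n..} (exp (- \<kappa> * real n)) t"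
          using \<omega> by (intro near_le_branch_sum[OF \<open>t \<in> space TM\<close> _ P_sets sub]) (simp add: space_m)
        also have "\<dots> \<le> ennreal (exp (- (\<kappa> + h - \<xi> - e) * real n))" using elim by (simp add: P_null)
        finally show ?case by (simp add: emeasure_eq_measure)
      qed
    qed
  qed
qed

definition near_decays :: "real \<Rightarrow> real \<Rightarrow> bool \<Rightarrow> real \<Rightarrow> real \<Rightarrow> (nat \<Rightarrow> real^2) \<Rightarrow> (nat \<Rightarrow> nat) \<Rightarrow> bool" where
  "near_decays h \<xi> c \<kappa> \<gamma> t \<omega> \<longleftrightarrow> (\<forall>z. regular h \<xi> z \<omega> \<longrightarrow>
    (\<forall>e>0. \<forall>\<^sub>F n in sequentially. measure m (near c \<kappa> z n t \<omega>) \<le> exp (- (\<gamma> - e) * real n)))"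

text \<open>Fubini's theorem exchanges the two almost everywhere quantifiers.  The positive numbers \<open>R\<close> and \<open>e\<close> are
first restricted to sequences, so that only countably many null sets occur.\<close>

lemma AE_near_decays:
  assumes pointwise: "\<And>\<omega> z R e. \<omega> \<in> symbol_seqs d \<Longrightarrow> regular h \<xi> z \<omega> \<Longrightarrow> 0 \<le> R \<Longrightarrow> 0 < e \<Longrightarrow>
    AE t in TM. t \<in> Box R \<longrightarrow> (\<forall>\<^sub>F n in sequentially. measure m (near c \<kappa> z n t \<omega>) \<le> exp (- (\<gamma> - e) * real n))"
  shows "AE t in TM. AE \<omega> in m. near_decays h \<xi> c \<kappa> \<gamma> t \<omega>"
proof -
  let ?G = "\<lambda>z j t \<omega>. \<forall>\<^sub>F n in sequentially. measure m (near c \<kappa> z n t \<omega>) \<le> exp (- (\<gamma> - 1 / real (Suc j)) * real n)"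
  have one: "AE t in TM. AE \<omega> in m. regular h \<xi> z \<omega> \<longrightarrow> t \<in> Box (real R) \<longrightarrow> ?G z j t \<omega>" for z :: 2 and R j :: nat
  proof (subst TM_m.AE_commute)
    have cyl_meas [measurable]: "(\<lambda>\<omega>. cyl_measure \<omega> n) \<in> borel_measurable m" for n
      unfolding cyl_measure_def by measurable
    have w_meas [measurable]: "(\<lambda>\<omega>. wt \<omega> z n) \<in> borel_measurable m" for n
      by measurable
    have reg_meas [measurable]: "Measurable.pred m (\<lambda>\<omega>. regular h \<xi> z \<omega>)"
      unfolding regular_def by (intro pred_intros_logic pred_intros_countable pred_tendsto) measurable
    have [measurable]: "(\<lambda>x. measure m (near c \<kappa> z n (fst x) (snd x))) \<in> borel_measurable (TM \<Otimes>\<^sub>M m)" for n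
      unfolding near_def by measurable
    show "{x \<in> space (TM \<Otimes>\<^sub>M m). regular h \<xi> z (snd x) \<longrightarrow> fst x \<in> Box (real R) \<longrightarrow> ?G z j (fst x) (snd x)}
      \<in> sets (TM \<Otimes>\<^sub>M m)"
      by measurable
    show "AE \<omega> in m. AE t in TM. regular h \<xi> z \<omega> \<longrightarrow> t \<in> Box (real R) \<longrightarrow> ?G z j t \<omega>"
    proof (rule AE_I2)
      fix \<omega> assume "\<omega> \<in> space m"
      then show "AE t in TM. regular h \<xi> z \<omega> \<longrightarrow> t \<in> Box (real R) \<longrightarrow> ?G z j t \<omega>"
        using pointwise[of \<omega> z "real R" "1 / real (Suc j)"]
        by (cases "regular h \<xi> z \<omega>") (auto simp: space_m)
    qed
  qed
  have "AE t in TM. \<forall>z (R::nat) (j::nat). AE \<omega> in m. regular h \<xi> z \<omega> \<longrightarrow> t \<in> Box (real R) \<longrightarrow> ?G z j t \<omega>"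
    using one by (simp add: AE_all_countable)
  then show ?thesis using AE_space
  proof eventually_elim
    case (elim t)
    obtain R :: nat where bound: "trans_bound t \<le> real R" using real_arch_simple by blast
    have R: "t \<in> Box (real R)"
      using elim(2) order_trans[OF trans_bound bound] by (auto simp: Box_def space_TM cube_def PiE_iff)
    have "AE \<omega> in m. \<forall>z (j::nat). regular h \<xi> z \<omega> \<longrightarrow> t \<in> Box (real R) \<longrightarrow> ?G z j t \<omega>"
      unfolding AE_all_countable using elim(1) by blast
    then show ?case
      unfolding near_decays_def
    proof (eventually_elim, intro allI impI)
      fix \<omega> z and e :: real
      assume *: "\<forall>z (j::nat). regular h \<xi> z \<omega> \<longrightarrow> t \<in> Box (real R) \<longrightarrow> ?G z j t \<omega>"
        and reg: "regular h \<xi> z \<omega>" and e: "0 < e"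
      obtain j where j: "1 / real (Suc j) < e" using reals_Archimedean[OF e] by (auto simp: inverse_eq_divide)
      have "?G z j t \<omega>" using * reg R by blast
      then show "\<forall>\<^sub>F n in sequentially. measure m (near c \<kappa> z n t \<omega>) \<le> exp (- (\<gamma> - e) * real n)"
      proof eventually_elim
        case (elim n)
        have "- (\<gamma> - 1 / real (Suc j)) * real n \<le> - (\<gamma> - e) * real n" using j by (intro mult_right_mono) auto
        then show ?case using elim by (meson exp_le_cancel_iff order_trans)
      qed
    qed
  qed
qed

end

section \<open>Lyapunov exponents and entropy\<close>

lemma (in prob_space) THE_AE_limit:
  fixes f :: "nat \<Rightarrow> 'a \<Rightarrow> real"
  assumes "AE x in M. (\<lambda>n. f n x) \<longlonglongrightarrow> c"
  shows "(THE c. AE x in M. (\<lambda>n. f n x) \<longlonglongrightarrow> c) = c"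
proof (rule the_equality)
  show "AE x in M. (\<lambda>n. f n x) \<longlonglongrightarrow> c" by (rule assms)
next
  fix c' assume "AE x in M. (\<lambda>n. f n x) \<longlonglongrightarrow> c'"
  with assms have "AE x in M. c' = c" by eventually_elim (rule LIMSEQ_unique)
  then show "c' = c" by simp
qed

locale gibbs_measure = symbolic_measure +
  fixes s P C :: real
  assumes C_ge: "1 \<le> C"
    and ergodic: "shift_ergodic m"
    and gibbs: "1 \<le> n \<Longrightarrow> w \<in> words d n \<Longrightarrow>
        1 / C * exp (- P * real (length w)) * sv_fun A s w \<le> measure m (cylinder d w) \<and>
        measure m (cylinder d w) \<le> C * exp (- P * real (length w)) * sv_fun A s w"
begin

sublocale shift: ergodic_system m left_shift
proof
  show "left_shift \<in> measurable m m" by (rule left_shift_measurable)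
qed (use ergodic in \<open>auto simp: shift_ergodic_def shift_invariant_def\<close>)

lemma left_shift_funpow: "(left_shift ^^ n) \<omega> = (\<lambda>k. \<omega> (k + n))"
  by (induction n arbitrary: \<omega>) (auto simp: left_shift_def)

lemma initial_word_shift:
  "initial_word \<omega> (n + k) = initial_word \<omega> n @ initial_word ((left_shift ^^ n) \<omega>) k"
  by (simp add: left_shift_funpow initial_word_add)

lemma set_initial: "\<omega> \<in> space m \<Longrightarrow> set (initial_word \<omega> n) \<subseteq> {1..d}"
  unfolding space_m by (rule set_initial_word)

lemma ln_alpha_bounds:
  assumes "\<omega> \<in> space m"
  shows "ln \<theta>' * real n \<le> ln (\<alpha>2 \<omega> n)"
    and "ln (\<alpha>2 \<omega> n) \<le> ln (\<alpha>1 \<omega> n)"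
    and "ln (\<alpha>1 \<omega> n) \<le> ln \<theta> * real n"
proof -
  note w = set_initial[OF assms, of n]
  have "ln (\<theta>' ^ n) \<le> ln (\<alpha>2 \<omega> n)"
    using alpha2_ge[OF w] \<theta>'_pos by (simp add: alpha2_pos[OF w])
  then show "ln \<theta>' * real n \<le> ln (\<alpha>2 \<omega> n)"
    using \<theta>'_pos by (simp add: ln_realpow mult.commute)
  show "ln (\<alpha>2 \<omega> n) \<le> ln (\<alpha>1 \<omega> n)"
    using alpha2_le_alpha1[OF w] alpha2_pos[OF w] by simp
  have "ln (\<alpha>1 \<omega> n) \<le> ln (\<theta> ^ n)"
    using alpha1_le[OF w] alpha1_pos[OF w] by simp
  then show "ln (\<alpha>1 \<omega> n) \<le> ln \<theta> * real n"
    using \<theta>_pos by (simp add: ln_realpow mult.commute)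
qed

lemma ln_\<theta>_neg: "ln \<theta> < 0"
  using \<theta>_pos \<theta>_less_1 by simp

text \<open>The norm of a product of matrices is submultiplicative.\<close>

lemma alpha1_limit:
  obtains c where "AE \<omega> in m. (\<lambda>n. ln (\<alpha>1 \<omega> n) / real n) \<longlonglongrightarrow> c"
proof -
  interpret bounded_subadditive m left_shift "\<lambda>n \<omega>. ln (\<alpha>1 \<omega> n)" "- ln \<theta>'"
  proof
    show "(\<lambda>\<omega>. ln (\<alpha>1 \<omega> n)) \<in> borel_measurable m" for n by measurable
    show "ln (\<alpha>1 \<omega> (n + k)) \<le> ln (\<alpha>1 \<omega> n) +
        ln (alpha1 A (initial_word ((left_shift ^^ n) \<omega>) k))" if \<omega>: "\<omega> \<in> space m" for \<omega> n k
    proof -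
      note w = set_initial[OF \<omega>, of n] set_initial[OF shift.funpow_space[OF \<omega>, of n], of k]
      have w': "set (initial_word \<omega> n @ initial_word ((left_shift ^^ n) \<omega>) k) \<subseteq> {1..d}" using w by simp
      show ?thesis unfolding initial_word_shift
        using alpha1_append[OF w] alpha1_pos[OF w(1)] alpha1_pos[OF w(2)] alpha1_pos[OF w']
        by (subst ln_mult_pos[symmetric]) auto
    qed
    show "\<bar>ln (\<alpha>1 \<omega> n)\<bar> \<le> - ln \<theta>' * real n" if "\<omega> \<in> space m" for \<omega> n
    proof -
      have "ln \<theta> * real n \<le> 0" using ln_\<theta>_neg by (simp add: mult_nonpos_nonneg)
      then show ?thesis using ln_alpha_bounds[OF that, of n] by (auto simp: abs_le_iff)
    qed
  qed
  show ?thesis by (rule subadditive_ergodic) (rule that)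
qed

text \<open>The product of the two singular values is the modulus of the determinant, so its logarithm is additive.\<close>

lemma alpha_product_limit:
  obtains c where "AE \<omega> in m. (\<lambda>n. ln (\<alpha>1 \<omega> n * \<alpha>2 \<omega> n) / real n) \<longlonglongrightarrow> c"
proof -
  interpret bounded_subadditive m left_shift
    "\<lambda>n \<omega>. ln (\<alpha>1 \<omega> n * \<alpha>2 \<omega> n)" "2 * - ln \<theta>'"
  proof
    show "(\<lambda>\<omega>. ln (\<alpha>1 \<omega> n * \<alpha>2 \<omega> n)) \<in> borel_measurable m" for n by measurable
    show "ln (\<alpha>1 \<omega> (n + k) * \<alpha>2 \<omega> (n + k)) \<le>
        ln (\<alpha>1 \<omega> n * \<alpha>2 \<omega> n) +
        ln (alpha1 A (initial_word ((left_shift ^^ n) \<omega>) k) * alpha2 A (initial_word ((left_shift ^^ n) \<omega>) k))"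
      if \<omega>: "\<omega> \<in> space m" for \<omega> n k
    proof -
      note w = set_initial[OF \<omega>, of n] set_initial[OF shift.funpow_space[OF \<omega>, of n], of k]
      show ?thesis unfolding initial_word_shift alpha_product[OF w]
        using alpha1_pos[OF w(1)] alpha1_pos[OF w(2)] alpha2_pos[OF w(1)] alpha2_pos[OF w(2)]
        by (subst ln_mult_pos[of "\<alpha>1 \<omega> n * \<alpha>2 \<omega> n"]) auto
    qed
    show "\<bar>ln (\<alpha>1 \<omega> n * \<alpha>2 \<omega> n)\<bar> \<le> 2 * - ln \<theta>' * real n" if \<omega>: "\<omega> \<in> space m" for \<omega> n
    proof -
      note w = set_initial[OF \<omega>, of n]
      have "ln \<theta> * real n \<le> 0" using ln_\<theta>_neg by (simp add: mult_nonpos_nonneg)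
      moreover have "ln (\<alpha>1 \<omega> n * \<alpha>2 \<omega> n)
          = ln (\<alpha>1 \<omega> n) + ln (\<alpha>2 \<omega> n)"
        using alpha1_pos[OF w] alpha2_pos[OF w] by (rule ln_mult_pos)
      ultimately show ?thesis using ln_alpha_bounds[OF \<omega>, of n] by (auto simp: abs_le_iff)
    qed
  qed
  show ?thesis by (rule subadditive_ergodic) (rule that)
qed

definition \<xi>1 :: real where "\<xi>1 = chi1 A m"
definition \<xi>2 :: real where "\<xi>2 = chi2 A m"
definition h :: real where "h = shift_entropy d m"

lemma alpha1_rate: "AE \<omega> in m. has_rate (\<alpha>1 \<omega>) (\<xi>1)"
proof -
  obtain c where "AE \<omega> in m. (\<lambda>n. ln (\<alpha>1 \<omega> n) / real n) \<longlonglongrightarrow> c" by (rule alpha1_limit)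
  then have *: "AE \<omega> in m. has_rate (\<alpha>1 \<omega>) (- c)"
    by eventually_elim (auto dest: tendsto_minus)
  then show ?thesis using THE_AE_limit[OF *] by (simp add: \<xi>1_def chi1_def)
qed

lemma alpha2_rate: "AE \<omega> in m. has_rate (\<alpha>2 \<omega>) (\<xi>2)"
proof -
  obtain c where "AE \<omega> in m. (\<lambda>n. ln (\<alpha>1 \<omega> n * \<alpha>2 \<omega> n) / real n) \<longlonglongrightarrow> c"
    by (rule alpha_product_limit)
  with alpha1_rate AE_space have *: "AE \<omega> in m. has_rate (\<alpha>2 \<omega>) (- c - \<xi>1)"
  proof eventually_elim
    case (elim \<omega>)
    have "- (1 / real n * ln (\<alpha>2 \<omega> n))
      = - (ln (\<alpha>1 \<omega> n * \<alpha>2 \<omega> n) / real n) - (- (1 / real n * ln (\<alpha>1 \<omega> n)))" for n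
      using ln_mult_pos[OF alpha1_pos[OF set_initial[OF elim(2), of n]] alpha2_pos[OF set_initial[OF elim(2), of n]]]
      by (cases "n = 0") (simp_all add: field_simps)
    then show ?case using tendsto_diff[OF tendsto_minus[OF elim(3)] elim(1)] by simp
  qed
  then show ?thesis using THE_AE_limit[OF *] by (simp add: \<xi>2_def chi2_def)
qed

lemma sv_fun_pos: "set w \<subseteq> {1..d} \<Longrightarrow> 0 < sv_fun A s w"
  using alpha1_pos[of w] alpha2_pos[of w] by (simp add: sv_fun_def)

lemma cyl_measure_pos: 
  assumes "\<omega> \<in> space m" shows "0 < cyl_measure \<omega> n"
proof (cases "n = 0")
  case True
  have "cylinder d [] = space m" by (simp add: cylinder_eq)
  then show ?thesis using True prob_space by (simp add: cyl_measure_def)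
next
  case False
  have "0 < 1 / C * exp (- P * real n) * sv_fun A s (initial_word \<omega> n)"
    using C_ge sv_fun_pos[OF set_initial[OF assms, of n]] by simp
  also have "\<dots> \<le> cyl_measure \<omega> n"
    using gibbs[of n "initial_word \<omega> n"] False initial_word_in_words[of \<omega> d n] assms
    by (simp add: cyl_measure_def space_m)
  finally show ?thesis .
qed

lemma cyl_measure_rate_aux:
  assumes \<omega>: "\<omega> \<in> space m" and n: "0 < n"
  shows "\<bar>ln (cyl_measure \<omega> n) + P * real n - ln (sv_fun A s (initial_word \<omega> n))\<bar> \<le> ln C"
proof -
  let ?w = "initial_word \<omega> n"
  have C: "0 < C" using C_ge by simp
  have sv: "0 < sv_fun A s ?w" by (rule sv_fun_pos[OF set_initial[OF \<omega>]])
  have b: "1 / C * exp (- P * real n) * sv_fun A s ?w \<le> cyl_measure \<omega> n"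
    "cyl_measure \<omega> n \<le> C * exp (- P * real n) * sv_fun A s ?w"
    using gibbs[of n ?w] n initial_word_in_words[of \<omega> d n] \<omega> by (auto simp: cyl_measure_def space_m)
  have "ln (1 / C * exp (- P * real n) * sv_fun A s ?w) \<le> ln (cyl_measure \<omega> n)"
    using b(1) C sv by (intro ln_mono) auto
  moreover have "ln (1 / C * exp (- P * real n) * sv_fun A s ?w) = - ln C - P * real n + ln (sv_fun A s ?w)"
    using C sv by (simp add: ln_mult_pos ln_div)
  moreover have "ln (cyl_measure \<omega> n) \<le> ln (C * exp (- P * real n) * sv_fun A s ?w)"
    using b(2) cyl_measure_pos[OF \<omega>, of n] by (intro ln_mono) auto
  moreover have "ln (C * exp (- P * real n) * sv_fun A s ?w) = ln C - P * real n + ln (sv_fun A s ?w)"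
    using C sv by (simp add: ln_mult_pos)
  ultimately show ?thesis by (simp add: abs_le_iff)
qed

text \<open>By the Gibbs bounds the logarithm of the measure of a cylinder differs by a bounded amount from an affine
combination of its length and of the logarithms of its singular values.\<close>

lemma entropy_rate: "AE \<omega> in m. has_rate (cyl_measure \<omega>) h"
proof -
  define h' where "h' = P + (if s < 1 then s * \<xi>1 else \<xi>1 + (s - 1) * \<xi>2)"
  have *: "AE \<omega> in m. has_rate (cyl_measure \<omega>) h'"
    using alpha1_rate alpha2_rate AE_space
  proof eventually_elim
    case (elim \<omega>)
    let ?w = "initial_word \<omega>"
    have sv: "- (1 / real n * ln (sv_fun A s (?w n))) =
       (if s < 1 then s * - (1 / real n * ln (alpha1 A (?w n)))
        else - (1 / real n * ln (alpha1 A (?w n))) + (s - 1) * - (1 / real n * ln (alpha2 A (?w n))))" for n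
      using alpha1_pos[OF set_initial[OF elim(3), of n]] alpha2_pos[OF set_initial[OF elim(3), of n]]
      by (simp add: sv_fun_def ln_mult_pos ln_powr algebra_simps add_divide_distrib diff_divide_distrib)
    have "(\<lambda>n. P + - (1 / real n * ln (sv_fun A s (?w n)))) \<longlonglongrightarrow> h'"
    proof (cases "s < 1")
      case True
      have "(\<lambda>n. P + s * - (1 / real n * ln (alpha1 A (?w n)))) \<longlonglongrightarrow> P + s * \<xi>1"
        by (intro tendsto_add tendsto_mult tendsto_const elim(1))
      then show ?thesis unfolding sv h'_def by (simp only: True if_True)
    next
      case False
      have "(\<lambda>n. P + (- (1 / real n * ln (alpha1 A (?w n))) + (s - 1) * - (1 / real n * ln (alpha2 A (?w n)))))
          \<longlonglongrightarrow> P + (\<xi>1 + (s - 1) * \<xi>2)"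
        by (intro tendsto_add tendsto_mult tendsto_const elim(1,2))
      then show ?thesis unfolding sv h'_def by (simp only: False if_False)
    qed
    moreover have "(\<lambda>n. - (1 / real n * ln (cyl_measure \<omega> n)) - (P + - (1 / real n * ln (sv_fun A s (?w n))))) \<longlonglongrightarrow> 0"
    proof (rule tendsto_rabs_zero_cancel, rule tendsto_sandwich[where f = "\<lambda>_. 0" and h = "\<lambda>n. ln C / real n"])
      show "\<forall>\<^sub>F n in sequentially. \<bar>- (1 / real n * ln (cyl_measure \<omega> n)) - (P + - (1 / real n * ln (sv_fun A s (?w n))))\<bar> \<le> ln C / real n"
        using eventually_gt_at_top[of 0]
      proof eventually_elim
        case (elim n)
        have "- (1 / real n * ln (cyl_measure \<omega> n)) - (P + - (1 / real n * ln (sv_fun A s (?w n))))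
          = - ((ln (cyl_measure \<omega> n) + P * real n - ln (sv_fun A s (?w n))) / real n)"
          using elim by (simp add: field_simps)
        also have "\<bar>\<dots>\<bar> = \<bar>ln (cyl_measure \<omega> n) + P * real n - ln (sv_fun A s (?w n))\<bar> / real n" by simp
        also have "\<dots> \<le> ln C / real n"
          by (intro divide_right_mono cyl_measure_rate_aux \<open>\<omega> \<in> space m\<close> elim) simp
        finally show ?case .
      qed
      show "(\<lambda>n. ln C / real n) \<longlonglongrightarrow> 0" by (rule lim_const_over_n)
    qed auto
    ultimately show ?case using tendsto_add by fastforce
  qed
  then show ?thesis
    using THE_AE_limit[OF *] by (simp add: h_def shift_entropy_def cyl_measure_def)
qed

definition typical :: "(nat \<Rightarrow> nat) \<Rightarrow> bool" where
  "typical \<omega> \<longleftrightarrow> \<omega> \<in> symbol_seqs d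
    \<and> has_rate (\<alpha>1 \<omega>) (\<xi>1)
    \<and> has_rate (\<alpha>2 \<omega>) (\<xi>2)
    \<and> has_rate (cyl_measure \<omega>) h"

lemma AE_typical: "AE \<omega> in m. typical \<omega>"
  using alpha1_rate alpha2_rate entropy_rate AE_space
  by eventually_elim (simp add: typical_def space_m)

lemma typical_exists: "\<exists>\<omega>. typical \<omega>"
proof (rule ccontr)
  assume "\<nexists>\<omega>. typical \<omega>"
  with AE_typical have "AE \<omega> in m. False" by simp
  then show False by simp
qed

lemma typical_bounds:
  assumes "typical \<omega>" and e: "0 < e"
  shows "\<forall>\<^sub>F n in sequentially.
    exp (- (\<xi>1 + e) * real n) \<le> \<alpha>1 \<omega> n \<and> \<alpha>1 \<omega> n \<le> exp (- (\<xi>1 - e) * real n) \<and>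
    exp (- (\<xi>2 + e) * real n) \<le> \<alpha>2 \<omega> n \<and> \<alpha>2 \<omega> n \<le> exp (- (\<xi>2 - e) * real n) \<and>
    exp (- (h + e) * real n) \<le> cyl_measure \<omega> n"
proof -
  have \<omega>: "\<omega> \<in> space m" using assms(1) by (simp add: typical_def space_m)
  have "has_rate (\<alpha>1 \<omega>) \<xi>1" "has_rate (\<alpha>2 \<omega>) \<xi>2" "has_rate (cyl_measure \<omega>) h"
    using assms(1) by (auto simp: typical_def)
  from rate_bounds[OF this(1) alpha1_pos[OF set_initial[OF \<omega>]] e]
    rate_bounds[OF this(2) alpha2_pos[OF set_initial[OF \<omega>]] e]
    rate_bounds[OF this(3) cyl_measure_pos[OF \<omega>] e]
  show ?thesis by eventually_elim blast
qed

lemma exponents: "0 < \<xi>1" "\<xi>1 \<le> \<xi>2" "0 \<le> h"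
proof -
  obtain \<omega> where \<omega>: "typical \<omega>" using typical_exists by blast
  then have sp: "\<omega> \<in> space m" by (simp add: typical_def space_m)
  have "- ln \<theta> \<le> \<xi>1"
  proof (rule tendsto_lowerbound)
    show "has_rate (\<alpha>1 \<omega>) (\<xi>1)" using \<omega> by (simp add: typical_def)
    show "\<forall>\<^sub>F n in sequentially. - ln \<theta> \<le> - (1 / real n * ln (\<alpha>1 \<omega> n))"
      using eventually_gt_at_top[of 0]
      by eventually_elim (use ln_alpha_bounds(3)[OF sp] in \<open>simp add: field_simps\<close>)
  qed simp
  then show "0 < \<xi>1" using ln_\<theta>_neg by simp
  show "\<xi>1 \<le> \<xi>2"
  proof (rule tendsto_le)
    show "has_rate (\<alpha>1 \<omega>) (\<xi>1)"
      "has_rate (\<alpha>2 \<omega>) (\<xi>2)" using \<omega> by (auto simp: typical_def)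
    show "\<forall>\<^sub>F n in sequentially. - (1 / real n * ln (\<alpha>1 \<omega> n)) \<le> - (1 / real n * ln (\<alpha>2 \<omega> n))"
      using ln_alpha_bounds(2)[OF sp] by (auto intro!: always_eventually divide_right_mono)
  qed simp
  show "0 \<le> h"
  proof (rule tendsto_lowerbound)
    show "has_rate (cyl_measure \<omega>) h" using \<omega> by (simp add: typical_def)
    have "ln (cyl_measure \<omega> n) \<le> 0" for n
      using cyl_measure_pos[OF sp, of n] by (simp add: cyl_measure_def)
    then show "\<forall>\<^sub>F n in sequentially. 0 \<le> - (1 / real n * ln (cyl_measure \<omega> n))"
      by (auto intro!: always_eventually divide_nonpos_nonneg)
  qed simp
qed

text \<open>If the two exponents agree, then every weight has the common rate, as it lies between the singular
values.  If they differ, the larger weight eventually exceeds the smaller one by a factor that no single letter can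
overcome, so that from some time on the same axis carries the larger weight.\<close>

lemma typical_regular:
  assumes \<omega>: "typical \<omega>"
  shows "\<exists>z. regular h \<xi>1 z \<omega>"
proof -
  have sp: "\<omega> \<in> space m" and seq: "\<omega> \<in> symbol_seqs d" using \<omega> by (auto simp: typical_def space_m)
  let ?a1 = "\<lambda>n. \<alpha>1 \<omega> n" and ?a2 = "\<lambda>n. \<alpha>2 \<omega> n"
  let ?w = "\<lambda>z n. wt \<omega> z n"
  have r1: "has_rate (?a1) \<xi>1" and r2: "has_rate (?a2) \<xi>2"
    using \<omega> by (auto simp: typical_def)
  have wpos: "0 < ?w z n" for z n by (rule weight_pos[OF set_initial[OF sp]])
  have "\<exists>z. has_rate (?w z) \<xi>1"
  proof (cases "\<xi>1 = \<xi>2")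
    case True
    have "has_rate (?w 1) \<xi>1"
    proof (rule tendsto_sandwich[OF _ _ r1])
      show "has_rate (?a2) \<xi>1" using r2 True by simp
      have "ln (?w 1 n) \<le> ln (?a1 n)" "ln (?a2 n) \<le> ln (?w 1 n)" for n
        using weight_le_alpha1[OF set_initial[OF sp], of n 1] alpha2_le_weight[OF set_initial[OF sp], of n 1]
          wpos[of n 1] alpha2_pos[OF set_initial[OF sp], of n] by (auto intro: ln_mono)
      then show "\<forall>\<^sub>F n in sequentially. - (1 / real n * ln (?a1 n)) \<le> - (1 / real n * ln (?w 1 n))"
        "\<forall>\<^sub>F n in sequentially. - (1 / real n * ln (?w 1 n)) \<le> - (1 / real n * ln (?a2 n))"
        by (auto intro!: always_eventually divide_right_mono)
    qed
    then show ?thesis ..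
  next
    case False
    then have gap: "\<xi>1 < \<xi>2" using exponents(2) by simp
    define e where "e = (\<xi>2 - \<xi>1) / 3"
    have e: "0 < e" using gap by (simp add: e_def)
    have "\<forall>\<^sub>F n in sequentially. ?a2 n < \<theta>' * ?a1 n"
      using typical_bounds[OF \<omega> e]
        eventually_exp_absorb_const[OF e, of "2 / \<theta>'"]
    proof eventually_elim
      case (elim n)
      have "?a2 n \<le> exp (- (\<xi>2 - e) * real n)" using elim by simp
      also have "- (\<xi>2 - e) * real n = - (e * real n) + - (\<xi>1 + e) * real n"
        by (simp add: e_def field_simps)
      also have "exp \<dots> = exp (- (e * real n)) * exp (- (\<xi>1 + e) * real n)" by (simp only: exp_add)
      also have "\<dots> \<le> exp (- (e * real n)) * ?a1 n" using elim by (intro mult_left_mono) auto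
      also have "exp (- (e * real n)) \<le> \<theta>' / 2"
        using elim(2) \<theta>'_pos by (simp add: exp_minus field_simps)
      also have "\<theta>' / 2 * ?a1 n < \<theta>' * ?a1 n" using \<theta>'_pos alpha1_pos[OF set_initial[OF sp], of n] by simp
      finally show ?case using alpha1_pos[OF set_initial[OF sp], of n] by simp
    qed
    then obtain N where N: "\<And>n. n \<ge> N \<Longrightarrow> ?a2 n < \<theta>' * ?a1 n" by (auto simp: eventually_sequentially)
    obtain z where z: "?w (z + 1) N \<le> ?w z N"
    proof (cases "?w (1 + 1) N \<le> ?w 1 N")
      case False
      then show ?thesis using that[of "1 + 1"] by (simp only: two_add_one_cases)
    qed (use that in blast)
    \<comment> \<open>One more letter keeps at least the proportion \<open>\<theta>'\<close> of the larger weight.\<close>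
    have dom: "?w (z + 1) n \<le> ?w z n" if "n \<ge> N" for n
      using that
    proof (induction n rule: dec_induct)
      case (step n)
      have wn: "?w z n = ?a1 n" "?w (z + 1) n = ?a2 n"
        using step.IH alpha1_eq[OF set_initial[OF sp], of n z] alpha2_eq[OF set_initial[OF sp], of n z] by auto
      have en: "\<omega> n \<in> {1..d}" by (rule symbol_seqs_nth[OF seq])
      have "?w (z + 1) (Suc n) \<le> ?a2 n"
        unfolding initial_word_Suc weight_append wn(2)
        using entry_bounds[OF en] alpha2_pos[OF set_initial[OF sp], of n]
        by (simp add: mult_left_le order.strict_implies_order)
      also have "\<dots> \<le> \<theta>' * ?a1 n" using N[of n] step.hyps by simp
      also have "\<dots> \<le> ?w z (Suc n)"
        unfolding initial_word_Suc weight_append wn(1)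
        using entry_ge_\<theta>'[OF en] alpha1_pos[OF set_initial[OF sp], of n] by simp
      finally show ?case .
    qed (rule z)
    have "\<forall>\<^sub>F n in sequentially. - (1 / real n * ln (?a1 n)) = - (1 / real n * ln (?w z n))"
      unfolding eventually_sequentially
      using dom alpha1_eq[OF set_initial[OF sp], of _ z] by (intro exI[of _ N]) auto
    then have "has_rate (?w z) \<xi>1" using r1 by (rule Lim_transform_eventually[rotated])
    then show ?thesis ..
  qed
  then show ?thesis using \<omega> cyl_measure_pos[OF sp] by (auto simp: regular_def typical_def)
qed

end

context box_ifs
begin

section \<open>The attractor and the separation of its first-level pieces\<close>

lemma compact_symbol_seqs: "compact (symbol_seqs d)"
proof -
  have "symbol_seqs d = PiE UNIV (\<lambda>_. {1..d})"
    by (auto simp: symbol_seqs_def PiE_def Pi_def) (metis atLeastAtMost_iff rangeI subset_iff)+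
  moreover have "compactin (product_topology (\<lambda>_::nat. euclidean :: nat topology) UNIV) (PiE UNIV (\<lambda>_. {1..d}))"
    unfolding compactin_PiE compactin_euclidean_iff by (simp add: finite_imp_compact)
  ultimately show ?thesis by (simp add: euclidean_product_topology)
qed

lemma open_same_initial_word: "open {\<tau>. initial_word \<tau> n = initial_word \<omega> n}"
proof -
  have "{\<tau>. initial_word \<tau> n = initial_word \<omega> n} = (\<Inter>k\<in>{..<n}. (\<lambda>\<tau>. \<tau> k) -` {\<omega> k})"
    by (auto simp: initial_word_eq_iff)
  moreover have "open ((\<lambda>\<tau>::nat \<Rightarrow> nat. \<tau> k) -` {\<omega> k})" for k
    by (rule open_vimage[OF Topological_Spaces.open_discrete continuous_on_product_coordinates])
  ultimately show ?thesis by (simp add: open_INT)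
qed

definition spread :: "(nat \<Rightarrow> real^2) \<Rightarrow> real" where
  "spread t = 4 * trans_bound t / (1 - \<theta>)"

lemma trans_bound_nonneg: "0 \<le> trans_bound t"
  unfolding trans_bound_def by (intro sum_nonneg) auto

lemma spread_nonneg: "0 \<le> spread t"
  using trans_bound_nonneg[of t] \<theta>_less_1 by (simp add: spread_def)

lemma dist_le_components: "dist x y \<le> \<bar>x $ 1 - y $ 1\<bar> + \<bar>x $ 2 - y $ 2\<bar>" for x y :: "real^2"
  using norm_le_l1_cart[of "x - y"] by (simp add: dist_norm sum_2)

lemma component_le_dist: "\<bar>x $ z - y $ z\<bar> \<le> dist x y" for x y :: "real^2"
  using component_le_norm_cart[of "x - y" z] by (simp add: dist_norm)

lemma coding_map_dist_le:
  assumes "\<omega> \<in> symbol_seqs d" "\<tau> \<in> symbol_seqs d" and eq: "initial_word \<omega> n = initial_word \<tau> n"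
  shows "dist (coding_map A t \<omega>) (coding_map A t \<tau>) \<le> spread t * \<alpha>1 \<omega> n"
proof -
  have "\<bar>code t \<omega> z - code t \<tau> z\<bar> \<le> \<alpha>1 \<omega> n * (spread t / 2)" for z
  proof -
    have "\<bar>code t \<omega> z - code t \<tau> z\<bar> \<le> wt \<omega> z n * (2 * trans_bound t / (1 - \<theta>))"
      by (rule code_diff_le[OF assms])
    also have "\<dots> \<le> \<alpha>1 \<omega> n * (2 * trans_bound t / (1 - \<theta>))"
      using weight_le_alpha1[OF set_initial_word[OF assms(1)]] trans_bound_nonneg \<theta>_less_1
      by (intro mult_right_mono) auto
    also have "2 * trans_bound t / (1 - \<theta>) = spread t / 2"
      using \<theta>_less_1 by (simp add: spread_def field_simps)
    finally show ?thesis .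
  qed
  from this[of 1] this[of 2] show ?thesis
    using dist_le_components[of "coding_map A t \<omega>" "coding_map A t \<tau>"] assms(1,2)
    by (simp add: coding_map_component mult.commute)
qed

lemma coding_map_continuous: "continuous_on (symbol_seqs d) (coding_map A t)"
  unfolding continuous_on_topological
proof (intro ballI allI impI)
  fix \<omega> U assume \<omega>: "\<omega> \<in> symbol_seqs d" and U: "open U" "coding_map A t \<omega> \<in> U"
  obtain e where e: "0 < e" "\<And>y. dist y (coding_map A t \<omega>) < e \<Longrightarrow> y \<in> U"
    using U by (auto simp: open_dist)
  have "(\<lambda>n. spread t * \<theta> ^ n) \<longlonglongrightarrow> spread t * 0"
    using \<theta>_pos \<theta>_less_1 by (intro tendsto_intros) auto
  then have "\<forall>\<^sub>F n in sequentially. spread t * \<theta> ^ n < e" using e(1) by (intro order_tendstoD(2)) auto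
  then obtain n where n: "spread t * \<theta> ^ n < e" by (auto simp: eventually_sequentially)
  have "coding_map A t \<tau> \<in> U" if \<tau>: "\<tau> \<in> symbol_seqs d" "initial_word \<tau> n = initial_word \<omega> n" for \<tau>
  proof (rule e(2))
    have "dist (coding_map A t \<tau>) (coding_map A t \<omega>) \<le> spread t * \<alpha>1 \<tau> n"
      using \<tau> \<omega> by (intro coding_map_dist_le)
    also have "\<dots> \<le> spread t * \<theta> ^ n"
      using alpha1_le[OF set_initial_word[OF \<tau>(1)], of n] by (intro mult_left_mono spread_nonneg) auto
    finally show "dist (coding_map A t \<tau>) (coding_map A t \<omega>) < e" using n by linarith
  qed
  then show "\<exists>V. open V \<and> \<omega> \<in> V \<and> (\<forall>y\<in>symbol_seqs d. y \<in> V \<longrightarrow> coding_map A t y \<in> U)"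
    using open_same_initial_word[of n \<omega>] by (intro exI[of _ "{\<tau>. initial_word \<tau> n = initial_word \<omega> n}"]) auto
qed

lemma coding_map_first:
  assumes "\<omega> \<in> symbol_seqs d"
  shows "coding_map A t \<omega> = ifs_map A t (\<omega> 0) (coding_map A t (\<lambda>k. \<omega> (Suc k)))"
  using coding_map_shift[OF assms, of t 1] by (simp add: initial_word_def word_map_def)

lemma word_map_bounded_tendsto:
  assumes \<omega>: "\<omega> \<in> symbol_seqs d" and K: "\<And>n. norm (y n) \<le> K"
  shows "(\<lambda>n. word_map A t (initial_word \<omega> n) (y n)) \<longlonglongrightarrow> coding_map A t \<omega>"
proof (rule vec_tendstoI)
  fix z
  have "(\<lambda>n. wt \<omega> z n * y n $ ax \<omega> z n) \<longlonglongrightarrow> 0"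
  proof (rule Lim_null_comparison)
    show "\<forall>\<^sub>F n in sequentially. norm (wt \<omega> z n * y n $ ax \<omega> z n) \<le> \<theta> ^ n * K"
    proof (intro always_eventually allI)
      fix n
      have "\<bar>y n $ ax \<omega> z n\<bar> \<le> K" using component_le_norm_cart K order_trans by blast
      moreover have "\<bar>wt \<omega> z n\<bar> \<le> \<theta> ^ n"
        using weight_le[OF set_initial_word[OF \<omega>], of n z] wt_pos[OF \<omega>, of n z] by simp
      ultimately show "norm (wt \<omega> z n * y n $ ax \<omega> z n) \<le> \<theta> ^ n * K"
        unfolding real_norm_def abs_mult using \<theta>_pos by (intro mult_mono) auto
    qed
    show "(\<lambda>n. \<theta> ^ n * K) \<longlonglongrightarrow> 0"
      using \<theta>_pos \<theta>_less_1 by (intro tendsto_mult_left_zero LIMSEQ_realpow_zero) auto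
  qed
  from tendsto_add[OF this tendsto_vec_nth[OF word_map_initial_tendsto[OF \<omega>, of t], of z]]
  show "(\<lambda>n. word_map A t (initial_word \<omega> n) (y n) $ z) \<longlonglongrightarrow> coding_map A t \<omega> $ z"
    by (subst word_map_component) simp
qed

text \<open>The image of the coding map is compact and invariant.  Conversely, a point of a compact invariant set can be
pulled back indefinitely inside the set, which yields a sequence coding it; and the images of any fixed point of
the set under the maps of the prefixes converge to the coded point.\<close>

lemma attractor_eq: "attractor d A t = coding_map A t ` symbol_seqs d"
  unfolding attractor_def
proof (rule the_equality, intro conjI)
  let ?\<Sigma> = "symbol_seqs d" and ?\<Pi> = "coding_map A t"
  have ne: "(\<lambda>_. 1) \<in> ?\<Sigma>" using d_ge_2 by (auto simp: symbol_seqs_def)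
  then show "?\<Pi> ` ?\<Sigma> \<noteq> {}" by blast
  show "compact (?\<Pi> ` ?\<Sigma>)"
    by (rule compact_continuous_image[OF coding_map_continuous compact_symbol_seqs])
  show "?\<Pi> ` ?\<Sigma> = (\<Union>i\<in>{1..d}. ifs_map A t i ` ?\<Pi> ` ?\<Sigma>)"
  proof (intro equalityI subsetI)
    fix x assume "x \<in> ?\<Pi> ` ?\<Sigma>"
    then obtain \<omega> where \<omega>: "\<omega> \<in> ?\<Sigma>" "x = ?\<Pi> \<omega>" by blast
    have "(\<lambda>k. \<omega> (Suc k)) \<in> ?\<Sigma>" using symbol_seqs_shift[OF \<omega>(1), of 1] by simp
    then show "x \<in> (\<Union>i\<in>{1..d}. ifs_map A t i ` ?\<Pi> ` ?\<Sigma>)"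
      using coding_map_first[OF \<omega>(1), of t] symbol_seqs_nth[OF \<omega>(1), of 0] \<omega>(2) by blast
  next
    fix x assume "x \<in> (\<Union>i\<in>{1..d}. ifs_map A t i ` ?\<Pi> ` ?\<Sigma>)"
    then obtain i \<tau> where i: "i \<in> {1..d}" and \<tau>: "\<tau> \<in> ?\<Sigma>" and x: "x = ifs_map A t i (?\<Pi> \<tau>)" by blast
    define \<omega> where "\<omega> = case_nat i \<tau>"
    have "\<omega> k \<in> {1..d}" for k using i symbol_seqs_nth[OF \<tau>] by (cases k) (auto simp: \<omega>_def)
    then have \<omega>: "\<omega> \<in> ?\<Sigma>" by (auto simp: symbol_seqs_def)
    show "x \<in> ?\<Pi> ` ?\<Sigma>"
    proof (rule image_eqI[OF _ \<omega>])
      show "x = ?\<Pi> \<omega>" using coding_map_first[OF \<omega>, of t] by (simp add: x \<omega>_def)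
    qed
  qed
  fix F assume F: "F \<noteq> {} \<and> compact F \<and> F = (\<Union>i\<in>{1..d}. ifs_map A t i ` F)"
  then obtain K where K: "\<And>y. y \<in> F \<Longrightarrow> norm y \<le> K" using compact_imp_bounded bounded_iff by metis
  show "F = ?\<Pi> ` ?\<Sigma>"
  proof (intro equalityI subsetI)
    fix x assume x: "x \<in> F"
    have "\<forall>y\<in>F. \<exists>i y'. i \<in> {1..d} \<and> y' \<in> F \<and> y = ifs_map A t i y'" using F by blast
    then obtain I N where IN: "\<And>y. y \<in> F \<Longrightarrow> I y \<in> {1..d} \<and> N y \<in> F \<and> y = ifs_map A t (I y) (N y)"
      by metis
    define \<omega> where "\<omega> k = I ((N ^^ k) x)" for k
    have in_F: "(N ^^ k) x \<in> F" for k by (induction k) (use x IN in auto)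
    have \<omega>: "\<omega> \<in> ?\<Sigma>" using IN[OF in_F] by (auto simp: \<omega>_def symbol_seqs_def)
    have "x = word_map A t (initial_word \<omega> n) ((N ^^ n) x)" for n
    proof (induction n)
      case (Suc n)
      have "(N ^^ n) x = ifs_map A t (\<omega> n) ((N ^^ Suc n) x)" using IN[OF in_F[of n]] by (simp add: \<omega>_def)
      then have "(N ^^ n) x = word_map A t [\<omega> n] ((N ^^ Suc n) x)" by (simp add: word_map_def)
      then show ?case using Suc by (simp only: initial_word_Suc word_map_append)
    qed (simp add: word_map_def)
    then have "(\<lambda>n. x) \<longlonglongrightarrow> ?\<Pi> \<omega>"
      using word_map_bounded_tendsto[OF \<omega>, of "\<lambda>n. (N ^^ n) x" K t] K[OF in_F] by simp
    then have "x = ?\<Pi> \<omega>" by (simp add: LIMSEQ_const_iff)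
    then show "x \<in> ?\<Pi> ` ?\<Sigma>" using \<omega> by blast
  next
    fix x assume "x \<in> ?\<Pi> ` ?\<Sigma>"
    then obtain \<omega> where \<omega>: "\<omega> \<in> ?\<Sigma>" "x = ?\<Pi> \<omega>" by blast
    obtain g where g: "g \<in> F" using F by blast
    have inv: "word_map A t w y \<in> F" if "set w \<subseteq> {1..d}" "y \<in> F" for w y
      using that(1)
    proof (induction w)
      case (Cons i w)
      then have "word_map A t w y \<in> F" "i \<in> {1..d}" by auto
      then have "ifs_map A t i (word_map A t w y) \<in> F" using F by blast
      then show ?case by (simp add: word_map_def)
    qed (simp add: word_map_def that(2))
    have "(\<lambda>n. word_map A t (initial_word \<omega> n) g) \<longlonglongrightarrow> ?\<Pi> \<omega>"
      by (rule word_map_bounded_tendsto[OF \<omega>(1), of "\<lambda>_. g" "norm g"]) simp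
    moreover have "word_map A t (initial_word \<omega> n) g \<in> F" for n
      by (rule inv[OF set_initial_word[OF \<omega>(1)] g])
    moreover have "closed F" using F compact_imp_closed by blast
    ultimately show "x \<in> F" unfolding \<omega>(2) by (metis closed_sequentially)
  qed
qed

lemma separation_gap:
  assumes "strong_separation d A t"
  obtains \<delta> where "0 < \<delta>"
    "\<And>\<omega> \<tau>. \<omega> \<in> symbol_seqs d \<Longrightarrow> \<tau> \<in> symbol_seqs d \<Longrightarrow> \<omega> 0 \<noteq> \<tau> 0 \<Longrightarrow> \<delta> \<le> dist (coding_map A t \<omega>) (coding_map A t \<tau>)"
proof -
  let ?X = "\<lambda>i. ifs_map A t i ` attractor d A t"
  have compact: "compact (?X i)" for i
  proof (rule compact_continuous_image)
    show "compact (attractor d A t)" unfolding attractor_eq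
      by (rule compact_continuous_image[OF coding_map_continuous compact_symbol_seqs])
    show "continuous_on (attractor d A t) (ifs_map A t i)"
      unfolding ifs_map_def by (intro continuous_intros matrix_vector_mult_linear_continuous_on)
  qed
  have "\<exists>\<delta>>0. \<forall>x\<in>?X i. \<forall>y\<in>?X j. \<delta> \<le> dist x y"
    if "i \<in> {1..d}" "j \<in> {1..d}" "i \<noteq> j" for i j
  proof (rule separate_compact_closed[OF compact compact_imp_closed[OF compact]])
    show "?X i \<inter> ?X j = {}" using assms that unfolding strong_separation_def by meson
  qed
  then have "\<forall>i j. \<exists>\<delta>. i \<in> {1..d} \<longrightarrow> j \<in> {1..d} \<longrightarrow> i \<noteq> j \<longrightarrow>
      0 < \<delta> \<and> (\<forall>x\<in>?X i. \<forall>y\<in>?X j. \<delta> \<le> dist x y)"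
    by meson
  then obtain \<delta>' where "\<forall>i j. i \<in> {1..d} \<longrightarrow> j \<in> {1..d} \<longrightarrow> i \<noteq> j \<longrightarrow>
      0 < \<delta>' i j \<and> (\<forall>x\<in>?X i. \<forall>y\<in>?X j. \<delta>' i j \<le> dist x y)"
    by (auto simp only: choice_iff)
  then have \<delta>: "0 < \<delta>' i j \<and> (\<forall>x\<in>?X i. \<forall>y\<in>?X j. \<delta>' i j \<le> dist x y)"
    if "i \<in> {1..d}" "j \<in> {1..d}" "i \<noteq> j" for i j using that by meson
  let ?P = "{p \<in> {1..d} \<times> {1..d}. fst p \<noteq> snd p}"
  have fin: "finite ?P" by simp
  define \<delta>0 where "\<delta>0 = Min (insert 1 ((\<lambda>p. \<delta>' (fst p) (snd p)) ` ?P))"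
  have "0 < \<delta>0" unfolding \<delta>0_def using fin \<delta> by (subst Min_gr_iff) auto
  moreover have "\<delta>0 \<le> dist (coding_map A t \<omega>) (coding_map A t \<tau>)"
    if \<omega>: "\<omega> \<in> symbol_seqs d" and \<tau>: "\<tau> \<in> symbol_seqs d" and ne: "\<omega> 0 \<noteq> \<tau> 0" for \<omega> \<tau>
  proof -
    have "\<delta>0 \<le> \<delta>' (\<omega> 0) (\<tau> 0)"
      unfolding \<delta>0_def using fin symbol_seqs_nth[OF \<omega>, of 0] symbol_seqs_nth[OF \<tau>, of 0] ne
      by (intro Min_le) (auto intro!: image_eqI[of _ _ "(\<omega> 0, \<tau> 0)"])
    moreover have in_piece: "coding_map A t \<omega> \<in> ?X (\<omega> 0)" if "\<omega> \<in> symbol_seqs d" for \<omega>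
    proof (rule image_eqI)
      show "coding_map A t \<omega> = ifs_map A t (\<omega> 0) (coding_map A t (\<lambda>k. \<omega> (Suc k)))"
        by (rule coding_map_first[OF that])
      show "coding_map A t (\<lambda>k. \<omega> (Suc k)) \<in> attractor d A t"
        using symbol_seqs_shift[OF that, of 1] by (simp add: attractor_eq)
    qed
    moreover have "\<delta>' (\<omega> 0) (\<tau> 0) \<le> dist (coding_map A t \<omega>) (coding_map A t \<tau>)"
      using \<delta>[OF symbol_seqs_nth[OF \<omega>] symbol_seqs_nth[OF \<tau>] ne] in_piece[OF \<omega>] in_piece[OF \<tau>] by blast
    ultimately show ?thesis by linarith
  qed
  ultimately show ?thesis by (rule that)
qed

text \<open>If the sequences separate at a time \<open>k < n\<close>, the shifted sequences are coded at distance at least \<open>\<delta>\<close>,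
hence differ by \<open>\<delta> / 2\<close> in one coordinate.  Undoing the shift multiplies this difference by a weight of
the prefix of length \<open>k\<close>, which is not smaller than the second singular value at time \<open>n\<close>.\<close>

lemma same_cylinder_if_close:
  assumes gap: "\<And>\<omega> \<tau>. \<omega> \<in> symbol_seqs d \<Longrightarrow> \<tau> \<in> symbol_seqs d \<Longrightarrow> \<omega> 0 \<noteq> \<tau> 0 \<Longrightarrow>
      \<delta> \<le> dist (coding_map A t \<omega>) (coding_map A t \<tau>)"
    and \<delta>: "0 < \<delta>" and \<omega>: "\<omega> \<in> symbol_seqs d" and \<tau>: "\<tau> \<in> symbol_seqs d"
    and close: "dist (coding_map A t \<omega>) (coding_map A t \<tau>) < \<delta> / 2 * \<alpha>2 \<omega> n"
  shows "initial_word \<tau> n = initial_word \<omega> n"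
proof (rule ccontr)
  assume "initial_word \<tau> n \<noteq> initial_word \<omega> n"
  moreover have "initial_word \<tau> 0 = initial_word \<omega> 0" by simp
  ultimately obtain k where k: "k < n" "initial_word \<tau> k = initial_word \<omega> k" "\<tau> k \<noteq> \<omega> k"
    by (metis first_difference)
  let ?\<omega> = "\<lambda>i. \<omega> (i + k)" and ?\<tau> = "\<lambda>i. \<tau> (i + k)"
  have shifts: "?\<omega> \<in> symbol_seqs d" "?\<tau> \<in> symbol_seqs d" by (intro symbol_seqs_shift \<omega> \<tau>)+
  have "\<delta> \<le> dist (coding_map A t ?\<omega>) (coding_map A t ?\<tau>)" using k(3) by (intro gap shifts) auto
  also have "\<dots> \<le> \<bar>code t ?\<omega> 1 - code t ?\<tau> 1\<bar> + \<bar>code t ?\<omega> 2 - code t ?\<tau> 2\<bar>"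
    using dist_le_components[of "coding_map A t ?\<omega>" "coding_map A t ?\<tau>"] shifts by (simp add: coding_map_component)
  finally have "\<exists>y. \<delta> / 2 \<le> \<bar>code t ?\<omega> y - code t ?\<tau> y\<bar>" 
    by (cases "\<delta> / 2 \<le> \<bar>code t ?\<omega> 1 - code t ?\<tau> 1\<bar>") (auto intro: exI[of _ 1] exI[of _ 2])
  then obtain y where y: "\<delta> / 2 \<le> \<bar>code t ?\<omega> y - code t ?\<tau> y\<bar>" ..
  obtain z where z: "ax \<omega> z k = y"
    using two_cases[of y "ax \<omega> 1 k"] end_axis_succ[of "initial_word \<omega> k" 1] by metis
  have "\<alpha>2 \<omega> n \<le> \<alpha>2 \<omega> k"
  proof -
    have "n = k + (n - k)" using k(1) by simp
    then have "initial_word \<omega> n = initial_word \<omega> k @ initial_word ?\<omega> (n - k)" using initial_word_add by metis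
    then show ?thesis
      using alpha2_append_mono[OF set_initial_word[OF \<omega>] set_initial_word[OF shifts(1)]] by metis
  qed
  also have "\<dots> \<le> wt \<omega> z k" by (rule alpha2_le_weight[OF set_initial_word[OF \<omega>]])
  finally have "\<delta> / 2 * \<alpha>2 \<omega> n \<le> \<bar>code t ?\<omega> y - code t ?\<tau> y\<bar> * wt \<omega> z k"
    using y \<delta> alpha2_pos[OF set_initial_word[OF \<omega>], of n] by (intro mult_mono) auto
  also have "\<dots> = \<bar>code t \<omega> z - code t \<tau> z\<bar>"
    using wt_pos[OF \<omega>, of k z]
    by (simp add: code_diff[OF \<omega> \<tau> k(2)[symmetric]] z abs_mult mult.commute)
  also have "\<dots> \<le> dist (coding_map A t \<omega>) (coding_map A t \<tau>)"
    using component_le_dist[of "coding_map A t \<omega>" z "coding_map A t \<tau>"] \<omega> \<tau> by (simp add: coding_map_component)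
  finally show False using close by simp
qed

end

section \<open>From exponential scales to local dimensions\<close>

lemma eventually_neg_ln_ge: "\<forall>\<^sub>F r in at_right (0::real). K \<le> - ln r"
proof -
  have "LIM r at_right (0::real). - ln r :> at_top"
    using ln_at_0 by (simp add: filterlim_uminus_at_top)
  then show ?thesis by (simp add: filterlim_at_top)
qed

lemma eventually_large_ln:
  assumes k: "0 < k" and e: "0 < e"
  shows "\<forall>\<^sub>F r in at_right (0::real). 0 < r \<and> K \<le> - ln r / k \<and> g \<le> e * - ln r \<and> 0 < - ln r"
proof -
  have "\<forall>\<^sub>F r in at_right (0::real). 0 < r" by (simp add: eventually_at_filter)
  with eventually_neg_ln_ge[of "K * k"] eventually_neg_ln_ge[of "g / e"] eventually_neg_ln_ge[of 1]
  show ?thesis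
  proof eventually_elim
    case (elim r)
    then have "K \<le> - ln r / k" "g \<le> - ln r * e"
      using k e by (simp_all only: pos_le_divide_eq pos_divide_le_eq)
    moreover have "0 < - ln r" using elim by linarith
    ultimately show ?case using elim by (simp only: mult.commute[of e])
  qed
qed

lemma rounding_error: "\<bar>x - n\<bar> \<le> 1 \<Longrightarrow> \<bar>g * x - g * n\<bar> \<le> \<bar>g\<bar>" for g x n :: real
  by (simp add: right_diff_distrib[symmetric] abs_mult mult_left_le)

text \<open>The radius \<open>r\<close> is rounded up to a scale \<open>exp (- k * n)\<close>.  The rounding changes \<open>n\<close> by at most \<open>1\<close>,
which is negligible after division by \<open>ln r\<close>.\<close>

lemma local_dimension_lower:
  fixes F :: "real \<Rightarrow> real"
  assumes mono: "\<And>r r'. r \<le> r' \<Longrightarrow> F r \<le> F r'" and pos: "\<And>r. 0 < r \<Longrightarrow> 0 < F r" and k: "0 < k"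
    and scales: "\<forall>\<^sub>F n in sequentially. F (exp (- k * real n)) \<le> exp (- g * real n)" and e: "0 < e"
  shows "\<forall>\<^sub>F r in at_right 0. g / k - e \<le> ln (F r) / ln r"
proof -
  obtain N where N: "\<And>n. n \<ge> N \<Longrightarrow> F (exp (- k * real n)) \<le> exp (- g * real n)"
    using scales by (auto simp: eventually_sequentially)
  from eventually_large_ln[OF k e, of "real N + 1" "\<bar>g\<bar>"] show ?thesis
  proof eventually_elim
    case (elim r)
    define L where "L = - ln r"
    have r: "0 < r" "r = exp (- L)" and L: "real N + 1 \<le> L / k" "\<bar>g\<bar> \<le> e * L" "0 < L" using elim by (auto simp: L_def)
    define n where "n = nat \<lfloor>L / k\<rfloor>"
    have n: "\<bar>L / k - real n\<bar> \<le> 1" "N \<le> n" and nL: "real n \<le> L / k"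
      unfolding n_def using L(1) by linarith+
    have "r \<le> exp (- k * real n)" using nL k by (simp add: r(2) field_simps)
    then have "F r \<le> exp (- g * real n)" using mono N[OF n(2)] by (meson order_trans)
    then have "ln (F r) \<le> - g * real n" using pos[OF r(1)] by (metis exp_ln exp_le_cancel_iff)
    then have "g * (L / k) - \<bar>g\<bar> \<le> - ln (F r)" using rounding_error[OF n(1), of g] by (simp add: abs_le_iff)
    then have "(g / k - e) * L \<le> - ln (F r)" using L(2) by (simp add: algebra_simps)
    then have "g / k - e \<le> - ln (F r) / L" using L(3) by (simp only: pos_le_divide_eq)
    then show ?case by (simp add: L_def)
  qed
qed

lemma local_dimension_upper:
  fixes F :: "real \<Rightarrow> real"
  assumes mono: "\<And>r r'. r \<le> r' \<Longrightarrow> F r \<le> F r'" and k: "0 < k"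
    and scales: "\<forall>\<^sub>F n in sequentially. exp (- g * real n) \<le> F (exp (- k * real n))" and e: "0 < e"
  shows "\<forall>\<^sub>F r in at_right 0. ln (F r) / ln r \<le> g / k + e"
proof -
  obtain N where N: "\<And>n. n \<ge> N \<Longrightarrow> exp (- g * real n) \<le> F (exp (- k * real n))"
    using scales by (auto simp: eventually_sequentially)
  from eventually_large_ln[OF k e, of "real N + 1" "\<bar>g\<bar>"] show ?thesis
  proof eventually_elim
    case (elim r)
    define L where "L = - ln r"
    have r: "0 < r" "r = exp (- L)" and L: "real N + 1 \<le> L / k" "\<bar>g\<bar> \<le> e * L" "0 < L" using elim by (auto simp: L_def)
    define n where "n = nat \<lceil>L / k\<rceil>"
    have n: "\<bar>L / k - real n\<bar> \<le> 1" "N \<le> n" and nL: "L / k \<le> real n"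
      unfolding n_def using L(1) by linarith+
    have "exp (- k * real n) \<le> r" using nL k by (simp add: r(2) field_simps)
    then have le: "exp (- g * real n) \<le> F r" using mono N[OF n(2)] by (meson order_trans)
    then have "0 < F r" by (meson exp_gt_zero less_le_trans)
    with le have "- g * real n \<le> ln (F r)" by (metis exp_ln exp_le_cancel_iff)
    then have "- ln (F r) \<le> g * (L / k) + \<bar>g\<bar>" using rounding_error[OF n(1), of g] by (simp add: abs_le_iff)
    then have "- ln (F r) \<le> (g / k + e) * L" using L(2) by (simp add: algebra_simps)
    then have "- ln (F r) / L \<le> g / k + e" using L(3) by (simp only: pos_divide_le_eq)
    then show ?case by (simp add: L_def)
  qed
qed

lemma local_dimension_of_scales:
  fixes F :: "real \<Rightarrow> real"
  assumes mono: "\<And>r r'. r \<le> r' \<Longrightarrow> F r \<le> F r'" and k: "0 < k"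
    and up: "\<And>j::nat. \<forall>\<^sub>F n in sequentially. F (exp (- (k + 1 / real (Suc j)) * real n)) \<le> exp (- (g - 1 / real (Suc j)) * real n)"
    and low: "\<And>j::nat. \<forall>\<^sub>F n in sequentially. exp (- (g + 1 / real (Suc j)) * real n) \<le> F (exp (- (k - 1 / real (Suc j)) * real n))"
  shows "((\<lambda>r. ln (F r) / ln r) \<longlongrightarrow> g / k) (at_right 0)"
proof -
  have inv: "(\<lambda>j. 1 / real (Suc j)) \<longlonglongrightarrow> 0" using LIMSEQ_inverse_real_of_nat by (simp add: inverse_eq_divide)
  obtain j0 where j0: "1 / real (Suc j0) < k" using reals_Archimedean[OF k] by (auto simp: inverse_eq_divide)
  have pos: "0 < F r" if r: "0 < r" for r
  proof -
    have "(\<lambda>n. exp (- (k - 1 / real (Suc j0)) * real n)) \<longlonglongrightarrow> 0" using j0 by real_asymp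
    then have "\<forall>\<^sub>F n in sequentially. exp (- (k - 1 / real (Suc j0)) * real n) < r" using r by (rule order_tendstoD)
    with low[of j0] have "\<forall>\<^sub>F n in sequentially. 0 < F r"
    proof eventually_elim
      case (elim n)
      then have "exp (- (g + 1 / real (Suc j0)) * real n) \<le> F r" using mono by (meson less_imp_le order_trans)
      then show ?case by (meson exp_gt_zero less_le_trans)
    qed
    then show ?thesis by simp
  qed
  show ?thesis
  proof (rule tendstoI)
    fix e :: real assume e: "0 < e"
    have "(\<lambda>j. (g - 1 / real (Suc j)) / (k + 1 / real (Suc j))) \<longlonglongrightarrow> (g - 0) / (k + 0)"
      using k by (intro tendsto_intros inv) auto
    then have 1: "\<forall>\<^sub>F j in sequentially. g / k - e / 2 < (g - 1 / real (Suc j)) / (k + 1 / real (Suc j))"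
      using e by (intro order_tendstoD(1)) auto
    have "(\<lambda>j. (g + 1 / real (Suc j)) / (k - 1 / real (Suc j))) \<longlonglongrightarrow> (g + 0) / (k - 0)"
      using k by (intro tendsto_intros inv) auto
    then have 2: "\<forall>\<^sub>F j in sequentially. (g + 1 / real (Suc j)) / (k - 1 / real (Suc j)) < g / k + e / 2"
      using e by (intro order_tendstoD(2)) auto
    have 3: "\<forall>\<^sub>F j in sequentially. 1 / real (Suc j) < k" using inv k by (rule order_tendstoD)
    obtain j where j: "g / k - e / 2 < (g - 1 / real (Suc j)) / (k + 1 / real (Suc j))"
      "(g + 1 / real (Suc j)) / (k - 1 / real (Suc j)) < g / k + e / 2" "1 / real (Suc j) < k"
      using eventually_happens[OF eventually_conj[OF 1 eventually_conj[OF 2 3]]] by auto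
    have "\<forall>\<^sub>F r in at_right 0. (g - 1 / real (Suc j)) / (k + 1 / real (Suc j)) - e / 2 \<le> ln (F r) / ln r"
      using k e by (intro local_dimension_lower mono pos up) (auto simp: add_pos_pos)
    moreover have "\<forall>\<^sub>F r in at_right 0. ln (F r) / ln r \<le> (g + 1 / real (Suc j)) / (k - 1 / real (Suc j)) + e / 2"
      using j(3) e by (intro local_dimension_upper mono low) auto
    ultimately show "\<forall>\<^sub>F r in at_right 0. dist (ln (F r) / ln r) (g / k) < e"
    proof eventually_elim
      case (elim r)
      then show ?case using j(1,2) unfolding dist_real_def by linarith
    qed
  qed
qed

lemma card_floor_image:
  fixes f :: "'a \<Rightarrow> real"
  assumes "\<And>x y. x \<in> X \<Longrightarrow> y \<in> X \<Longrightarrow> \<bar>f x - f y\<bar> \<le> L" and L: "0 \<le> L"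
  shows "finite ((\<lambda>x. \<lfloor>f x\<rfloor>) ` X)" "real (card ((\<lambda>x. \<lfloor>f x\<rfloor>) ` X)) \<le> 2 * L + 2"
proof -
  have "finite ((\<lambda>x. \<lfloor>f x\<rfloor>) ` X) \<and> real (card ((\<lambda>x. \<lfloor>f x\<rfloor>) ` X)) \<le> 2 * L + 2"
  proof (cases "X = {}")
    case False
    then obtain x0 where x0: "x0 \<in> X" by blast
    have sub: "(\<lambda>x. \<lfloor>f x\<rfloor>) ` X \<subseteq> {\<lfloor>f x0 - L\<rfloor>..\<lfloor>f x0 + L\<rfloor>}"
    proof (rule image_subsetI)
      fix x assume "x \<in> X"
      then have "f x0 - L \<le> f x" "f x \<le> f x0 + L" using assms(1)[OF x0, of x] by (auto simp: abs_le_iff)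
      then show "\<lfloor>f x\<rfloor> \<in> {\<lfloor>f x0 - L\<rfloor>..\<lfloor>f x0 + L\<rfloor>}" by (auto intro: floor_mono)
    qed
    have "\<lfloor>f x0 - L\<rfloor> \<le> \<lfloor>f x0 + L\<rfloor>" using L by (intro floor_mono) auto
    then have "real (card {\<lfloor>f x0 - L\<rfloor>..\<lfloor>f x0 + L\<rfloor>}) = of_int (\<lfloor>f x0 + L\<rfloor> - \<lfloor>f x0 - L\<rfloor> + 1)" by simp
    also have "\<dots> \<le> 2 * L + 2" by linarith
    finally have "real (card {\<lfloor>f x0 - L\<rfloor>..\<lfloor>f x0 + L\<rfloor>}) \<le> 2 * L + 2" .
    moreover have "card ((\<lambda>x. \<lfloor>f x\<rfloor>) ` X) \<le> card {\<lfloor>f x0 - L\<rfloor>..\<lfloor>f x0 + L\<rfloor>}" using sub by (intro card_mono) auto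
    ultimately show ?thesis using finite_subset[OF sub] by auto
  qed (use L in auto)
  then show "finite ((\<lambda>x. \<lfloor>f x\<rfloor>) ` X)" "real (card ((\<lambda>x. \<lfloor>f x\<rfloor>) ` X)) \<le> 2 * L + 2" by auto
qed

text \<open>The points of light cells among the cells listed in \<open>V n\<close> have total measure at most the number of cells
times the threshold, which is summable; almost every point lies in such a cell only finitely often.\<close>

lemma (in prob_space) AE_cell_mass:
  assumes cell: "\<And>n v. {x \<in> space M. q n x = v} \<in> sets M" and V: "\<And>n. finite (V n)"
    and card: "\<And>n::nat. real (card (V n)) \<le> K * exp (g * real n)" and f: "0 < f"
  shows "AE x in M. \<forall>\<^sub>F n in sequentially. q n x \<in> V n \<longrightarrow>
    exp (- (g + f) * real n) \<le> measure M {y \<in> space M. q n y = q n x}"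
proof -
  let ?cell = "\<lambda>n v. {x \<in> space M. q n x = v}"
  define L where "L n = {v \<in> V n. measure M (?cell n v) < exp (- (g + f) * real n)}" for n
  define Bad where "Bad n = (\<Union>v\<in>L n. ?cell n v)" for n
  have fin_L: "finite (L n)" for n using V by (simp add: L_def)
  have Bad_sets: "Bad n \<in> sets M" for n unfolding Bad_def using fin_L by (intro sets.finite_UN cell) auto
  have Bad_le: "measure M (Bad n) \<le> K * exp (- f) ^ n" for n
  proof -
    have "measure M (Bad n) \<le> (\<Sum>v\<in>L n. measure M (?cell n v))"
      unfolding Bad_def using fin_L cell by (intro finite_measure_subadditive_finite) auto
    also have "\<dots> \<le> (\<Sum>v\<in>L n. exp (- (g + f) * real n))" by (intro sum_mono) (auto simp: L_def)
    also have "\<dots> \<le> (\<Sum>v\<in>V n. exp (- (g + f) * real n))" using V by (intro sum_mono2) (auto simp: L_def)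
    also have "\<dots> = real (card (V n)) * exp (- (g + f) * real n)" by simp
    also have "\<dots> \<le> K * exp (g * real n) * exp (- (g + f) * real n)" by (intro mult_right_mono card) auto
    also have "\<dots> = K * exp (- f) ^ n"
      by (simp add: mult.assoc mult_exp_exp exp_of_nat_mult[symmetric] algebra_simps)
    finally show ?thesis .
  qed
  have "summable (\<lambda>n. measure M (Bad n))"
    using Bad_le f by (intro summable_comparison_test'[OF summable_mult[OF summable_geometric[of "exp (- f)"]], of 0 _ K]) auto
  then have "AE x in M. \<forall>\<^sub>F n in sequentially. x \<in> space M - Bad n"
    by (intro borel_cantelli_AE1 Bad_sets) (auto simp: emeasure_eq_measure)
  then show ?thesis
  proof eventually_elim
    case (elim x)
    then show ?case by eventually_elim (auto simp: Bad_def L_def not_less)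
  qed
qed

section \<open>Masses of balls around typical points\<close>

context gibbs_measure
begin

definition ball_mass :: "(nat \<Rightarrow> real^2) \<Rightarrow> real^2 \<Rightarrow> real \<Rightarrow> real" where
  "ball_mass t x r = measure m {\<tau> \<in> space m. dist x (coding_map A t \<tau>) \<le> r}"

lemma ball_sets:
  assumes "t \<in> space TM" shows "{\<tau> \<in> space m. dist x (coding_map A t \<tau>) \<le> r} \<in> sets m"
proof -
  note [measurable] = coding_map_measurable[OF assms]
  show ?thesis by measurable
qed

lemma ball_mass_mono: "t \<in> space TM \<Longrightarrow> r \<le> r' \<Longrightarrow> ball_mass t x r \<le> ball_mass t x r'"
  unfolding ball_mass_def by (intro finite_measure_mono ball_sets) auto

text \<open>A ball around a typical point of radius about \<open>exp (- scale_exp * n)\<close> will turn out to have mass about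
\<open>exp (- mass_exp * n)\<close>.  If \<open>h \<le> \<xi>1\<close>, the images of cylinders of order \<open>n\<close> serve as such balls.
Otherwise a ball of the size of the shorter side of such an image cuts out of its mass \<open>exp (- h * n)\<close> the
proportion of the two side lengths.\<close>

definition scale_exp :: real where "scale_exp = (if h \<le> \<xi>1 then \<xi>1 else \<xi>2)"

definition mass_exp :: real where "mass_exp = (if h \<le> \<xi>1 then h else h + \<xi>2 - \<xi>1)"

definition mass_at_most :: "(nat \<Rightarrow> real^2) \<Rightarrow> real^2 \<Rightarrow> bool" where
  "mass_at_most t x \<longleftrightarrow> (\<forall>j::nat. \<forall>\<^sub>F n in sequentially. ball_mass t x (exp (- (scale_exp + 1 / real (Suc j)) * real n))
     \<le> exp (- (mass_exp - 1 / real (Suc j)) * real n))"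

definition mass_at_least :: "(nat \<Rightarrow> real^2) \<Rightarrow> real^2 \<Rightarrow> bool" where
  "mass_at_least t x \<longleftrightarrow> (\<forall>j::nat. \<forall>\<^sub>F n in sequentially. exp (- (mass_exp + 1 / real (Suc j)) * real n)
     \<le> ball_mass t x (exp (- (scale_exp - 1 / real (Suc j)) * real n)))"

lemma ball_mass_le_near:
  assumes t [measurable]: "t \<in> space TM" and \<omega> [measurable]: "\<omega> \<in> space m" and r: "r \<le> exp (- \<kappa> * real n)"
    and same: "\<And>\<tau>. c \<Longrightarrow> \<tau> \<in> symbol_seqs d \<Longrightarrow> dist (coding_map A t \<omega>) (coding_map A t \<tau>) \<le> r \<Longrightarrow>
      initial_word \<tau> n = initial_word \<omega> n"
  shows "ball_mass t (coding_map A t \<omega>) r \<le> measure m (near c \<kappa> z n t \<omega>)"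
  unfolding ball_mass_def
proof (rule finite_measure_mono[OF subsetI])
  show "near c \<kappa> z n t \<omega> \<in> sets m" unfolding near_def by measurable
  fix \<tau> assume "\<tau> \<in> {\<tau> \<in> space m. dist (coding_map A t \<omega>) (coding_map A t \<tau>) \<le> r}"
  then have \<tau>: "\<tau> \<in> symbol_seqs d" "dist (coding_map A t \<omega>) (coding_map A t \<tau>) \<le> r" by (auto simp: space_m)
  have "\<bar>code t \<omega> z - code t \<tau> z\<bar> \<le> dist (coding_map A t \<omega>) (coding_map A t \<tau>)"
    using component_le_dist[of "coding_map A t \<omega>" z "coding_map A t \<tau>"] \<omega> \<tau>(1)
    by (simp add: coding_map_component space_m)
  then show "\<tau> \<in> near c \<kappa> z n t \<omega>" using \<tau> r same by (simp add: near_def space_m)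
qed

lemma mass_at_most_global:
  assumes le: "h \<le> \<xi>1" and t: "t \<in> space TM" and \<omega>: "typical \<omega>" and near: "near_decays h \<xi>1 False \<xi>1 h t \<omega>"
  shows "mass_at_most t (coding_map A t \<omega>)"
  unfolding mass_at_most_def
proof
  fix j :: nat
  have sp: "\<omega> \<in> space m" using \<omega> by (simp add: typical_def space_m)
  define e where "e = 1 / real (Suc j)"
  have e: "0 < e" by (simp add: e_def)
  obtain z where "regular h \<xi>1 z \<omega>" using typical_regular[OF \<omega>] by blast
  then have "\<forall>\<^sub>F n in sequentially. measure m (near False \<xi>1 z n t \<omega>) \<le> exp (- (h - e) * real n)"
    using near e by (simp add: near_decays_def)
  then show "\<forall>\<^sub>F n in sequentially. ball_mass t (coding_map A t \<omega>) (exp (- (scale_exp + 1 / real (Suc j)) * real n))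
      \<le> exp (- (mass_exp - 1 / real (Suc j)) * real n)"
    unfolding e_def[symmetric]
  proof eventually_elim
    case (elim n)
    have "exp (- (scale_exp + e) * real n) \<le> exp (- \<xi>1 * real n)"
      unfolding exp_le_cancel_iff using le e by (intro mult_right_mono) (auto simp: scale_exp_def)
    from ball_mass_le_near[OF t sp this, of False z] show ?case using elim le by (simp add: mass_exp_def)
  qed
qed

text \<open>A ball of radius slightly below the second singular value stays inside one cylinder, by strong separation.\<close>

lemma mass_at_most_local:
  assumes gt: "\<xi>1 < h" and t: "t \<in> space TM" and sep: "strong_separation d A t" and \<omega>: "typical \<omega>"
    and near: "\<And>j::nat. near_decays h \<xi>1 True (\<xi>2 + 1 / real (Suc j)) (\<xi>2 + 1 / real (Suc j) + h - \<xi>1) t \<omega>"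
  shows "mass_at_most t (coding_map A t \<omega>)"
  unfolding mass_at_most_def
proof
  fix j :: nat
  have sp: "\<omega> \<in> space m" and seq: "\<omega> \<in> symbol_seqs d" using \<omega> by (auto simp: typical_def space_m)
  define e where "e = 1 / real (Suc j)"
  have e: "0 < e" by (simp add: e_def)
  obtain \<delta> where \<delta>: "0 < \<delta>" and gap: "\<And>\<omega> \<tau>. \<omega> \<in> symbol_seqs d \<Longrightarrow> \<tau> \<in> symbol_seqs d \<Longrightarrow> \<omega> 0 \<noteq> \<tau> 0 \<Longrightarrow>
      \<delta> \<le> dist (coding_map A t \<omega>) (coding_map A t \<tau>)"
    using separation_gap[OF sep] by blast
  obtain z where "regular h \<xi>1 z \<omega>" using typical_regular[OF \<omega>] by blast
  then have 1: "\<forall>\<^sub>F n in sequentially. measure m (near True (\<xi>2 + e) z n t \<omega>) \<le> exp (- (\<xi>2 + e + h - \<xi>1 - e) * real n)"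
    using near[of j] e unfolding e_def[symmetric] by (simp only: near_decays_def)
  note 2 = typical_bounds[OF \<omega> half_gt_zero[OF e]]
  \<comment> \<open>The radius is \<open>exp (- (\<xi>2 + e) * n)\<close>: half of the loss \<open>e\<close> covers the deviation of \<open>\<alpha>2\<close> from its rate, the other half the constant \<open>\<delta> / 2\<close>.\<close>
  have 3: "\<forall>\<^sub>F n in sequentially. 4 / \<delta> \<le> exp (e / 2 * real n)"
    using e by (intro eventually_exp_absorb_const) auto
  from 1 2 3 show "\<forall>\<^sub>F n in sequentially. ball_mass t (coding_map A t \<omega>) (exp (- (scale_exp + 1 / real (Suc j)) * real n))
      \<le> exp (- (mass_exp - 1 / real (Suc j)) * real n)"
    unfolding e_def[symmetric]
  proof eventually_elim
    case (elim n)
    have "exp (- (\<xi>2 + e) * real n) * (4 / \<delta>) \<le> exp (- (\<xi>2 + e) * real n) * exp (e / 2 * real n)"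
      using elim(3) by (intro mult_left_mono) auto
    also have "\<dots> = exp (- (\<xi>2 + e / 2) * real n)" by (simp add: mult_exp_exp algebra_simps)
    also have "\<dots> \<le> \<alpha>2 \<omega> n" using elim(2) by simp
    finally have "exp (- (\<xi>2 + e) * real n) \<le> \<delta> / 4 * \<alpha>2 \<omega> n"
      using \<delta> by (simp add: field_simps)
    also have "\<dots> < \<delta> / 2 * \<alpha>2 \<omega> n"
      using \<delta> alpha2_pos[OF set_initial[OF sp], of n] by simp
    finally have small: "exp (- (\<xi>2 + e) * real n) < \<delta> / 2 * \<alpha>2 \<omega> n" .
    have "ball_mass t (coding_map A t \<omega>) (exp (- (\<xi>2 + e) * real n)) \<le> measure m (near True (\<xi>2 + e) z n t \<omega>)"
    proof (rule ball_mass_le_near[OF t sp order_refl])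
      fix \<tau> assume "\<tau> \<in> symbol_seqs d" "dist (coding_map A t \<omega>) (coding_map A t \<tau>) \<le> exp (- (\<xi>2 + e) * real n)"
      then show "initial_word \<tau> n = initial_word \<omega> n"
        using small by (intro same_cylinder_if_close[OF gap \<delta> seq]) auto
    qed
    also have "\<dots> \<le> exp (- (\<xi>2 + e + h - \<xi>1 - e) * real n)" by (rule elim(1))
    also have "\<dots> \<le> exp (- (h + \<xi>2 - \<xi>1 - e) * real n)"
      unfolding exp_le_cancel_iff using e by (intro mult_right_mono) auto
    finally show ?case using gt by (simp add: scale_exp_def mass_exp_def)
  qed
qed

lemma AE_mass_at_most:
  "AE t in TM. strong_separation d A t \<longrightarrow> (AE \<omega> in m. mass_at_most t (coding_map A t \<omega>))"
proof (cases "h \<le> \<xi>1")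
  case True
  have "AE t in TM. AE \<omega> in m. near_decays h \<xi>1 False \<xi>1 h t \<omega>"
    by (rule AE_near_decays) (rule near_global[OF _ _ True])
  then show ?thesis using AE_space
  proof eventually_elim
    case (elim t)
    from elim(1) AE_typical have "AE \<omega> in m. mass_at_most t (coding_map A t \<omega>)"
      by eventually_elim (rule mass_at_most_global[OF True elim(2)])
    then show ?case by simp
  qed
next
  case False
  then have gt: "\<xi>1 < h" by simp
  let ?N = "\<lambda>j t \<omega>. near_decays h \<xi>1 True (\<xi>2 + 1 / real (Suc j)) (\<xi>2 + 1 / real (Suc j) + h - \<xi>1) t \<omega>"
  have "AE t in TM. AE \<omega> in m. ?N j t \<omega>" for j
    by (rule AE_near_decays) (rule near_local[OF _ _ gt], use gt exponents(1) in auto)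
  then have "AE t in TM. \<forall>j. AE \<omega> in m. ?N j t \<omega>"
    by (intro AE_all_countable[THEN iffD2] allI)
  then show ?thesis using AE_space
  proof (eventually_elim, intro impI)
    fix t assume t: "t \<in> space TM" "strong_separation d A t" and "\<forall>j. AE \<omega> in m. ?N j t \<omega>"
    then have "AE \<omega> in m. \<forall>j. ?N j t \<omega>" by (intro AE_all_countable[THEN iffD2])
    with AE_typical show "AE \<omega> in m. mass_at_most t (coding_map A t \<omega>)"
      by eventually_elim (use mass_at_most_local[OF gt t] in blast)
  qed
qed

text \<open>The ball contains the image of the cylinder of order \<open>n\<close>.\<close>

lemma ball_mass_lower_cylinder:
  assumes t: "t \<in> space TM" and typ_\<omega>: "typical \<omega>" and e: "0 < e"
  shows "\<forall>\<^sub>F n in sequentially. exp (- (h + e) * real n) \<le> ball_mass t (coding_map A t \<omega>) (exp (- (\<xi>1 - e) * real n))"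
proof -
  have \<omega>: "\<omega> \<in> space m" "\<omega> \<in> symbol_seqs d" using typ_\<omega> by (auto simp: typical_def space_m)
  have 3: "\<forall>\<^sub>F n in sequentially. spread t \<le> exp (e / 2 * real n)"
    using e by (intro eventually_exp_absorb_const) auto
  from 3 typical_bounds[OF typ_\<omega> e] typical_bounds[OF typ_\<omega> half_gt_zero[OF e]] show ?thesis
  proof eventually_elim
    case (elim n)
    have "cyl_measure \<omega> n \<le> ball_mass t (coding_map A t \<omega>) (exp (- (\<xi>1 - e) * real n))"
      unfolding cyl_measure_def ball_mass_def
    proof (intro finite_measure_mono ball_sets t subsetI)
      fix \<tau> assume "\<tau> \<in> cylinder d (initial_word \<omega> n)"
      then have \<tau>: "\<tau> \<in> space m" "initial_word \<omega> n = initial_word \<tau> n" by (auto simp: cylinder_eq)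
      have "dist (coding_map A t \<omega>) (coding_map A t \<tau>) \<le> spread t * \<alpha>1 \<omega> n"
        using \<tau> \<omega> by (intro coding_map_dist_le) (auto simp: space_m)
      also have "\<dots> \<le> exp (e / 2 * real n) * exp (- (\<xi>1 - e / 2) * real n)"
        using elim spread_nonneg[of t] alpha1_pos[OF set_initial[OF \<omega>(1)], of n] by (intro mult_mono) auto
      also have "\<dots> = exp (- (\<xi>1 - e) * real n)" by (simp add: mult_exp_exp algebra_simps)
      finally show "\<tau> \<in> {\<tau> \<in> space m. dist (coding_map A t \<omega>) (coding_map A t \<tau>) \<le> exp (- (\<xi>1 - e) * real n)}"
        using \<tau>(1) by simp
    qed
    with elim(2) show ?case by linarith
  qed
qed

text \<open>For \<open>\<xi>1 < h\<close> the lower bound for the mass of balls comes from a count.  The measure is essentially carried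
by the typical words; a square grid whose mesh is the shorter side of the images cuts each of them into about
\<open>exp ((\<xi>2 - \<xi>1) * n)\<close> cells.  So about \<open>exp ((h + \<xi>2 - \<xi>1) * n)\<close> cells suffice, and a typical point
cannot lie in a cell that is much lighter than the average.\<close>

definition typical_words :: "real \<Rightarrow> nat \<Rightarrow> nat list set" where
  "typical_words e n = {w \<in> words d n. exp (- (h + e) * real n) \<le> measure m (cylinder d w) \<and>
      alpha1 A w \<le> exp (- (\<xi>1 - e) * real n) \<and> alpha2 A w \<le> exp (- (\<xi>2 - e) * real n)}"

lemma finite_typical_words: "finite (typical_words e n)"
  using finite_subset[OF _ finite_words[of d n]] by (auto simp: typical_words_def)

lemma card_typical_words: "real (card (typical_words e n)) \<le> exp ((h + e) * real n)"
proof -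
  let ?W = "typical_words e n"
  have disj: "disjoint_family_on (cylinder d) ?W"
    by (auto simp: disjoint_family_on_def cylinder_eq typical_words_def words_def)
  have "real (card ?W) * exp (- (h + e) * real n) = (\<Sum>w\<in>?W. exp (- (h + e) * real n))" by simp
  also have "\<dots> \<le> (\<Sum>w\<in>?W. measure m (cylinder d w))" by (intro sum_mono) (auto simp: typical_words_def)
  also have "\<dots> = measure m (\<Union>w\<in>?W. cylinder d w)"
    using finite_typical_words disj by (intro finite_measure_finite_Union[symmetric]) auto
  also have "\<dots> \<le> 1" by simp
  finally have "real (card ?W) * exp (- (h + e) * real n) \<le> 1" .
  then show ?thesis
    unfolding mult_minus_left exp_minus
    by (simp only: divide_inverse[symmetric] pos_divide_le_eq exp_gt_zero mult_1)
qed

definition grid :: "(nat \<Rightarrow> real^2) \<Rightarrow> real \<Rightarrow> (nat \<Rightarrow> nat) \<Rightarrow> int \<times> int" where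
  "grid t \<rho> \<tau> = (\<lfloor>code t \<tau> 1 / \<rho>\<rfloor>, \<lfloor>code t \<tau> 2 / \<rho>\<rfloor>)"

lemma grid_close:
  assumes \<rho>: "0 < \<rho>" and \<omega>: "\<omega> \<in> symbol_seqs d" and \<tau>: "\<tau> \<in> symbol_seqs d" and eq: "grid t \<rho> \<tau> = grid t \<rho> \<omega>"
  shows "dist (coding_map A t \<omega>) (coding_map A t \<tau>) \<le> 2 * \<rho>"
proof -
  have close: "\<bar>x - y\<bar> \<le> \<rho>" if "\<lfloor>y / \<rho>\<rfloor> = \<lfloor>x / \<rho>\<rfloor>" for x y
  proof -
    have "\<bar>x / \<rho> - y / \<rho>\<bar> \<le> 1" using that by linarith
    then show ?thesis using \<rho> by (simp add: diff_divide_distrib[symmetric])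
  qed
  have "\<bar>code t \<omega> 1 - code t \<tau> 1\<bar> \<le> \<rho>" "\<bar>code t \<omega> 2 - code t \<tau> 2\<bar> \<le> \<rho>"
    using eq by (auto simp: grid_def intro: close)
  then show ?thesis
    using dist_le_components[of "coding_map A t \<omega>" "coding_map A t \<tau>"] \<omega> \<tau> by (simp add: coding_map_component)
qed

text \<open>Along one axis the image of the cylinder meets boundedly many mesh intervals, along the other at most a constant
times \<open>E\<close>.\<close>

lemma card_grid_cylinder:
  assumes w: "set w \<subseteq> {1..d}" and \<rho>: "0 < \<rho>" and E: "1 \<le> E"
    and a1: "alpha1 A w \<le> E * \<rho>" and a2: "alpha2 A w \<le> \<rho>"
  shows "finite (grid t \<rho> ` cylinder d w)"
    and "real (card (grid t \<rho> ` cylinder d w)) \<le> (spread t + 2)\<^sup>2 * E"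
proof -
  define M where "M = spread t / 2"
  have M: "0 \<le> M" "spread t = 2 * M" using spread_nonneg[of t] by (auto simp: M_def)
  let ?FL = "\<lambda>z. (\<lambda>\<tau>. \<lfloor>code t \<tau> z / \<rho>\<rfloor>) ` cylinder d w"
  have FL: "finite (?FL z)" "real (card (?FL z)) \<le> 2 * (weight w z * M / \<rho>) + 2" for z
  proof -
    have diff: "\<bar>code t \<omega> z / \<rho> - code t \<tau> z / \<rho>\<bar> \<le> weight w z * M / \<rho>"
      if "\<omega> \<in> cylinder d w" "\<tau> \<in> cylinder d w" for \<omega> \<tau>
    proof -
      let ?n = "length w"
      have iw: "initial_word \<omega> ?n = w" "initial_word \<tau> ?n = w" "\<omega> \<in> symbol_seqs d" "\<tau> \<in> symbol_seqs d"
        using that by (auto simp: cylinder_def)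
      have "\<bar>code t \<omega> z - code t \<tau> z\<bar> \<le> weight w z * (2 * trans_bound t / (1 - \<theta>))"
        using code_diff_le[OF iw(3,4), of ?n t z] iw(1,2) by simp
      also have "2 * trans_bound t / (1 - \<theta>) = M" using \<theta>_less_1 by (simp add: M_def spread_def field_simps)
      finally have "\<bar>code t \<omega> z - code t \<tau> z\<bar> / \<rho> \<le> weight w z * M / \<rho>"
        using \<rho> by (intro divide_right_mono) auto
      then show ?thesis using \<rho> by (simp add: diff_divide_distrib[symmetric])
    qed
    have nn: "0 \<le> weight w z * M / \<rho>" using M \<rho> weight_pos[OF w, of z] by simp
    show "finite (?FL z)" "real (card (?FL z)) \<le> 2 * (weight w z * M / \<rho>) + 2"
      using card_floor_image[of "cylinder d w" "\<lambda>\<tau>. code t \<tau> z / \<rho>", OF diff nn] by blast+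
  qed
  have sub: "grid t \<rho> ` cylinder d w \<subseteq> ?FL 1 \<times> ?FL 2" by (auto simp: grid_def)
  have fin: "finite (?FL 1 \<times> ?FL 2)" using FL(1) by blast
  show "finite (grid t \<rho> ` cylinder d w)" by (rule finite_subset[OF sub fin])
  have big: "2 * (x * M / \<rho>) + 2 \<le> (2 * M + 2) * E" if "x \<le> alpha1 A w" for x
  proof -
    have "x / \<rho> \<le> E" using \<rho> that a1 by (simp add: pos_divide_le_eq)
    then have le: "x / \<rho> * M \<le> E * M" using M by (intro mult_right_mono) auto
    have "2 * (x * M / \<rho>) + 2 = 2 * (x / \<rho> * M) + 2" by simp
    also have "\<dots> \<le> 2 * (E * M) + 2 * E" using le E by linarith
    also have "\<dots> = (2 * M + 2) * E" by (simp add: algebra_simps)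
    finally show ?thesis .
  qed
  have small: "2 * (x * M / \<rho>) + 2 \<le> 2 * M + 2" if "x \<le> alpha2 A w" for x
  proof -
    have "x / \<rho> \<le> 1" using that a2 \<rho> by (simp add: pos_divide_le_eq)
    then have "x / \<rho> * M \<le> 1 * M" using M by (intro mult_right_mono) auto
    then show ?thesis by simp
  qed
  have nn: "0 \<le> 2 * (weight w z * M / \<rho>) + 2" for z
    using M \<rho> weight_pos[OF w, of z] by simp
  have "real (card (grid t \<rho> ` cylinder d w)) \<le> real (card (?FL 1 \<times> ?FL 2))"
    using card_mono[OF fin sub] by simp
  also have "\<dots> = real (card (?FL 1)) * real (card (?FL 2))" by (simp add: card_cartesian_product)
  also have "\<dots> \<le> (2 * (weight w 1 * M / \<rho>) + 2) * (2 * (weight w 2 * M / \<rho>) + 2)"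
    by (intro mult_mono FL(2) nn) auto
  also have "\<dots> \<le> (spread t + 2)\<^sup>2 * E"
  proof -
    have "weight w 1 \<le> alpha2 A w \<or> weight w 2 \<le> alpha2 A w"
      using alpha2_eq[OF w, of 1] by (auto simp: min_def)
    then show ?thesis
    proof
      assume 1: "weight w 1 \<le> alpha2 A w"
      have "(2 * (weight w 1 * M / \<rho>) + 2) * (2 * (weight w 2 * M / \<rho>) + 2) \<le> (2 * M + 2) * ((2 * M + 2) * E)"
        using M by (intro mult_mono small[OF 1] big weight_le_alpha1 w nn) auto
      then show ?thesis by (simp add: M(2) power2_eq_square mult_ac)
    next
      assume 2: "weight w 2 \<le> alpha2 A w"
      have "(2 * (weight w 1 * M / \<rho>) + 2) * (2 * (weight w 2 * M / \<rho>) + 2) \<le> ((2 * M + 2) * E) * (2 * M + 2)"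
        using M E by (intro mult_mono small[OF 2] big weight_le_alpha1 w nn) auto
      then show ?thesis by (simp add: M(2) power2_eq_square mult_ac)
    qed
  qed
  finally show "real (card (grid t \<rho> ` cylinder d w)) \<le> (spread t + 2)\<^sup>2 * E" .
qed

lemma ball_mass_lower_cells:
  assumes t: "t \<in> space TM" and f: "0 < f"
  shows "AE \<omega> in m. \<forall>\<^sub>F n in sequentially.
    exp (- (h + \<xi>2 - \<xi>1 + 2 * f) * real n) \<le> ball_mass t (coding_map A t \<omega>) (exp (- (\<xi>2 - 2 * f) * real n))"
proof -
  note [measurable] = t
  define \<rho> where "\<rho> n = exp (- (\<xi>2 - f) * real n)" for n
  have \<rho>: "0 < \<rho> n" for n by (simp add: \<rho>_def)
  define q where "q n \<tau> = (initial_word \<tau> n, grid t (\<rho> n) \<tau>)" for n \<tau>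
  define E where "E n = exp ((\<xi>2 - \<xi>1) * real n)" for n
  define K where "K = (spread t + 2)\<^sup>2"
  have cells: "finite (grid t (\<rho> n) ` cylinder d w)" "real (card (grid t (\<rho> n) ` cylinder d w)) \<le> K * E n"
    if "w \<in> typical_words f n" for n w
  proof -
    have w: "set w \<subseteq> {1..d}" "alpha1 A w \<le> exp (- (\<xi>1 - f) * real n)" "alpha2 A w \<le> \<rho> n"
      using that by (auto simp: typical_words_def words_def \<rho>_def)
    have "exp (- (\<xi>1 - f) * real n) = E n * \<rho> n" by (simp add: E_def \<rho>_def mult_exp_exp algebra_simps)
    then have a1: "alpha1 A w \<le> E n * \<rho> n" using w(2) by simp
    have E1: "1 \<le> E n" using exponents(2) by (simp add: E_def)
    show "finite (grid t (\<rho> n) ` cylinder d w)" "real (card (grid t (\<rho> n) ` cylinder d w)) \<le> K * E n"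
      unfolding K_def by (rule card_grid_cylinder[OF w(1) \<rho> E1 a1 w(3)])+
  qed
  define V where "V n = (SIGMA w:typical_words f n. grid t (\<rho> n) ` cylinder d w)" for n
  have fin_V: "finite (V n)" for n unfolding V_def using finite_typical_words cells(1) by (intro finite_SigmaI)
  have card_V: "real (card (V n)) \<le> K * exp ((h + \<xi>2 - \<xi>1 + f) * real n)" for n
  proof -
    have "real (card (V n)) = (\<Sum>w\<in>typical_words f n. real (card (grid t (\<rho> n) ` cylinder d w)))"
      unfolding V_def by (subst card_SigmaI) (auto simp: finite_typical_words cells(1))
    also have "\<dots> \<le> (\<Sum>w\<in>typical_words f n. K * E n)" by (intro sum_mono cells(2))
    also have "\<dots> = real (card (typical_words f n)) * (K * E n)" by simp
    also have "\<dots> \<le> exp ((h + f) * real n) * (K * E n)"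
      by (intro mult_right_mono card_typical_words) (simp add: K_def E_def)
    also have "\<dots> = K * exp ((h + \<xi>2 - \<xi>1 + f) * real n)"
      by (simp add: E_def mult_exp_exp algebra_simps)
    finally show ?thesis .
  qed
  have cell_sets: "{\<tau> \<in> space m. q n \<tau> = v} \<in> sets m" for n v
  proof -
    obtain w i j where v: "v = (w, i, j)" by (cases v) auto
    have "{\<tau> \<in> space m. initial_word \<tau> n = w \<and> \<lfloor>code t \<tau> 1 / \<rho> n\<rfloor> = i \<and> \<lfloor>code t \<tau> 2 / \<rho> n\<rfloor> = j} \<in> sets m"
      by measurable
    then show ?thesis by (simp add: q_def grid_def v)
  qed
  have four: "\<forall>\<^sub>F n in sequentially. 2 \<le> exp (f * real n)" by (rule eventually_exp_absorb_const[OF f])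
  have "AE \<omega> in m. \<forall>\<^sub>F n in sequentially. q n \<omega> \<in> V n \<longrightarrow>
      exp (- (h + \<xi>2 - \<xi>1 + f + f) * real n) \<le> measure m {\<tau> \<in> space m. q n \<tau> = q n \<omega>}"
    by (rule AE_cell_mass[OF cell_sets fin_V card_V f])
  then show ?thesis using AE_typical
  proof eventually_elim
    case (elim \<omega>)
    have \<omega>: "\<omega> \<in> space m" "\<omega> \<in> symbol_seqs d" using elim(2) by (auto simp: typical_def space_m)
    from elim(1) typical_bounds[OF elim(2) f] four show ?case
    proof eventually_elim
      case (elim n)
      have "initial_word \<omega> n \<in> typical_words f n"
        using elim(2) initial_word_in_words[OF \<omega>(2)] by (simp add: typical_words_def cyl_measure_def)
      moreover have "\<omega> \<in> cylinder d (initial_word \<omega> n)" using \<omega>(1) by (simp add: cylinder_eq)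
      ultimately have "q n \<omega> \<in> V n" unfolding V_def q_def by blast
      then have "exp (- (h + \<xi>2 - \<xi>1 + f + f) * real n) \<le> measure m {\<tau> \<in> space m. q n \<tau> = q n \<omega>}"
        using elim(1) by blast
      also have "\<dots> \<le> ball_mass t (coding_map A t \<omega>) (exp (- (\<xi>2 - 2 * f) * real n))"
        unfolding ball_mass_def
      proof (intro finite_measure_mono ball_sets t subsetI)
        fix \<tau> assume "\<tau> \<in> {\<tau> \<in> space m. q n \<tau> = q n \<omega>}"
        then have \<tau>: "\<tau> \<in> space m" "grid t (\<rho> n) \<tau> = grid t (\<rho> n) \<omega>" by (auto simp: q_def)
        have "dist (coding_map A t \<omega>) (coding_map A t \<tau>) \<le> 2 * \<rho> n"
          using \<tau> \<omega> by (intro grid_close \<rho>) (auto simp: space_m)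
        also have "\<dots> \<le> exp (f * real n) * \<rho> n" using elim \<rho>[of n] by (intro mult_right_mono) auto
        also have "\<dots> = exp (- (\<xi>2 - 2 * f) * real n)" by (simp add: \<rho>_def mult_exp_exp algebra_simps)
        finally show "\<tau> \<in> {\<tau> \<in> space m. dist (coding_map A t \<omega>) (coding_map A t \<tau>) \<le> exp (- (\<xi>2 - 2 * f) * real n)}"
          using \<tau>(1) by simp
      qed
      finally show ?case by (simp add: algebra_simps)
    qed
  qed
qed

lemma AE_mass_at_least:
  assumes t: "t \<in> space TM"
  shows "AE \<omega> in m. mass_at_least t (coding_map A t \<omega>)"
  unfolding mass_at_least_def AE_all_countable
proof
  fix j :: nat
  define e where "e = 1 / real (Suc j)"
  have e: "0 < e" by (simp add: e_def)
  show "AE \<omega> in m. \<forall>\<^sub>F n in sequentially. exp (- (mass_exp + 1 / real (Suc j)) * real n)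
      \<le> ball_mass t (coding_map A t \<omega>) (exp (- (scale_exp - 1 / real (Suc j)) * real n))"
    unfolding e_def[symmetric]
  proof (cases "h \<le> \<xi>1")
    case True
    show "AE \<omega> in m. \<forall>\<^sub>F n in sequentially. exp (- (mass_exp + e) * real n)
        \<le> ball_mass t (coding_map A t \<omega>) (exp (- (scale_exp - e) * real n))"
      using AE_typical
      by eventually_elim (use ball_mass_lower_cylinder[OF t _ e] True in \<open>simp add: mass_exp_def scale_exp_def\<close>)
  next
    case False
    then show "AE \<omega> in m. \<forall>\<^sub>F n in sequentially. exp (- (mass_exp + e) * real n)
        \<le> ball_mass t (coding_map A t \<omega>) (exp (- (scale_exp - e) * real n))"
      using ball_mass_lower_cells[OF t half_gt_zero[OF e]] by (simp add: mass_exp_def scale_exp_def)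
  qed
qed

section \<open>The dimension of the projected measure\<close>

text \<open>The two mass conditions are measurable conditions on the point of the plane, so they pass from almost every
sequence to almost every point.\<close>

lemma projected_measure_exact:
  assumes t: "t \<in> space TM" and up: "AE \<omega> in m. mass_at_most t (coding_map A t \<omega>)"
  shows "has_exact_dimension (projected_measure A t m) (mass_exp / scale_exp)"
proof -
  note [measurable] = coding_map_measurable[OF t]
  let ?\<mu> = "projected_measure A t m"
  have ball: "measure ?\<mu> (cball x r) = ball_mass t x r" for x r
  proof -
    have "measure ?\<mu> (cball x r) = measure m (coding_map A t -` cball x r \<inter> space m)"
      unfolding projected_measure_def by (intro measure_distr) auto
    also have "coding_map A t -` cball x r \<inter> space m = {\<tau> \<in> space m. dist x (coding_map A t \<tau>) \<le> r}" by auto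
    finally show ?thesis by (simp add: ball_mass_def)
  qed
  have [measurable]: "(\<lambda>x. ball_mass t x r) \<in> borel_measurable borel" for r
    unfolding ball_mass_def by measurable
  have [measurable]: "Measurable.pred borel (mass_at_most t)" "Measurable.pred borel (mass_at_least t)"
    unfolding mass_at_most_def[abs_def] mass_at_least_def[abs_def] by measurable
  have "AE \<omega> in m. mass_at_most t (coding_map A t \<omega>) \<and> mass_at_least t (coding_map A t \<omega>)"
    using up AE_mass_at_least[OF t] by eventually_elim simp
  then have "AE x in ?\<mu>. mass_at_most t x \<and> mass_at_least t x"
    unfolding projected_measure_def by (subst AE_distr_iff) auto
  moreover have "((\<lambda>r. ln (measure ?\<mu> (cball x r)) / ln r) \<longlongrightarrow> mass_exp / scale_exp) (at_right 0)"
    if "mass_at_most t x \<and> mass_at_least t x" for x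
    unfolding ball
  proof (rule local_dimension_of_scales)
    show "0 < scale_exp" using exponents by (simp add: scale_exp_def)
  qed (use that t in \<open>auto simp: mass_at_most_def mass_at_least_def intro: ball_mass_mono\<close>)
  ultimately have "AE x in ?\<mu>. ((\<lambda>r. ln (measure ?\<mu> (cball x r)) / ln r) \<longlongrightarrow> mass_exp / scale_exp) (at_right 0)"
    by (rule AE_mp[OF _ AE_I2[OF impI]])
  moreover have "prob_space ?\<mu>" unfolding projected_measure_def by (intro prob_space_distr) measurable
  moreover have "sets ?\<mu> = sets borel" by (simp add: projected_measure_def)
  ultimately show ?thesis unfolding has_exact_dimension_def by blast
qed

lemma mass_exp_div_scale_exp:
  "mass_exp / scale_exp = (if h \<le> \<xi>1 then h / \<xi>1 else 1 + (h - \<xi>1) / \<xi>2)"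
  using exponents by (simp add: mass_exp_def scale_exp_def field_simps)

theorem AE_exact_dimension:
  "AE t in TM. strong_separation d A t \<longrightarrow>
     has_exact_dimension (projected_measure A t m) (if h \<le> \<xi>1 then h / \<xi>1 else 1 + (h - \<xi>1) / \<xi>2)"
  using AE_mass_at_most AE_space
  by eventually_elim (simp add: projected_measure_exact mass_exp_div_scale_exp[symmetric])

end

theorem corollary2p3:
  fixes d l :: nat and a b :: "nat \<Rightarrow> real" and s :: real and m :: "(nat \<Rightarrow> nat) measure"
  assumes "1 < l" and "l \<le> d"
    and "\<forall>i\<in>{1..d}. 0 < a i \<and> a i < 1 \<and> 0 < b i \<and> b i < 1"
    and "\<exists>i\<in>{1..l - 1}. a i \<noteq> b i"
    and "\<forall>i\<in>{1..d}. \<forall>j\<in>{1..d}. i \<noteq> j \<longrightarrow>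
           u_num d l a b i + u_num d l a b j < 1 \<and> v_num d l a b i + v_num d l a b j < 1"
    and "0 < s" and "s < 2"
    and "kaenmaki_measure d (ifs_matrix l a b) s m"
  shows "AE t in translation_measure d.
           strong_separation d (ifs_matrix l a b) t \<longrightarrow>
           (let h = shift_entropy d m;
                \<chi>1 = chi1 (ifs_matrix l a b) m;
                \<chi>2 = chi2 (ifs_matrix l a b) m
            in has_exact_dimension (projected_measure (ifs_matrix l a b) t m)
                 (if h \<le> \<chi>1 then h / \<chi>1 else 1 + (h - \<chi>1) / \<chi>2))"
proof -
  from assms(8) obtain C where C: "1 \<le> C" and bounds: "\<And>n w. 1 \<le> n \<Longrightarrow> w \<in> words d n \<Longrightarrow>
      1 / C * exp (- pressure d (ifs_matrix l a b) s * real (length w)) * sv_fun (ifs_matrix l a b) s w \<le> measure m (cylinder d w) \<and>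
      measure m (cylinder d w) \<le> C * exp (- pressure d (ifs_matrix l a b) s * real (length w)) * sv_fun (ifs_matrix l a b) s w"
    and m: "prob_space m" "sets m = sets (symbol_space d)" "shift_ergodic m"
    unfolding kaenmaki_measure_def by blast
  interpret prob_space m by (rule m(1))
  interpret gibbs_measure d l a b m s "pressure d (ifs_matrix l a b) s" C
    by unfold_locales (use assms m C bounds in auto)
  show ?thesis
    using AE_exact_dimension unfolding h_def \<xi>1_def \<xi>2_def Let_def .
qed

end
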